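(* Let $(\mathcal{E},\mathcal{F})$ and $(\mathcal{E}',\mathcal{F}')$ be two regular Dirichlet forms on $L^2(E,m)$ with Beurling–Deny triples $(\mathcal{E}^{(\mathrm{c})},J,k)$ and $(\mathcal{E}^{(\mathrm{c})'},J',k')$ respectively. Then $(\mathcal{E}',\mathcal{F}')$ is a regular subspace of $(\mathcal{E},\mathcal{F})$ if and only if all of the following hold: $\mathcal{F}'\cap C_\mathrm{c}(E)\subset \mathcal{F}\cap C_\mathrm{c}(E)$, $J=J'$, $k=k'$, and $\mu^c_{<u,v>}={\mu'}^{c}_{<u,v>}$ for all $u,v\in\mathcal{F}'\cap C_\mathrm{c}(E)$.
   Context: $E$ is a locally compact separable metric space and $m$ a Radon measure on $E$ with full support; $C_\mathrm{c}(E)$ is the space of continuous functions with compact support. A Dirichlet form $(\mathcal{E},\mathcal{F})$ on $L^2(E,m)$ is a densely defined, non-negative definite, symmetric, closed, Markovian bilinear form; $\mathcal{E}_1(u,v)=\mathcal{E}(u,v)+(u,v)_m$. It is regular if $\mathcal{F}\cap C_\mathrm{c}(E)$ is dense in $\mathcal{F}$ in the $\mathcal{E}_1^{1/2}$-norm and dense in $C_\mathrm{c}(E)$ in the uniform norm. For regular Dirichlet forms $(\mathcal{E},\mathcal{F})$, $(\mathcal{E}',\mathcal{F}')$ on $L^2(E,m)$, $(\mathcal{E}',\mathcal{F}')$ is a regular subspace of $(\mathcal{E},\mathcal{F})$ if $\mathcal{F}'\subset\mathcal{F}$ and $\mathcal{E}(u,v)=\mathcal{E}'(u,v)$ for all $u,v\in\mathcal{F}'$.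 Beurling–Deny triple: every regular Dirichlet form can be written uniquely, for $u,v\in\mathcal{F}$, as $$\mathcal{E}(u,v)=\mathcal{E}^{(\mathrm{c})}(u,v)+\int_{E\times E\setminus d}(\tilde u(x)-\tilde u(y))(\tilde v(x)-\tilde v(y))J(dx,dy)+\int_E\tilde u(x)\tilde v(x)k(dx),$$ where $\tilde u$ is a quasi-continuous $m$-version of $u$, $d$ is the diagonal, $\mathcal{E}^{(\mathrm{c})}$ is a symmetric form on $\mathcal{F}$ with the strongly local property ($\mathcal{E}^{(\mathrm{c})}(u,v)=0$ whenever $u,v$ have compact supports and $v$ is constant on a neighbourhood of the support of $u$) and the Markovian property, $J$ (the jumping measure) is a symmetric positive Radon measure on $E\times E\setminus d$, and $k$ (the killing measure) is a positive Radon measure on $E$; $J$ and $k$ charge no sets of zero capacity. For bounded $u\in\mathcal{F}$, $\mu^c_{<u>}$ is the strongly local part of the energy measure of $u$, i.e. the unique finite positive measure on $E$ with $\int_E f\,d\mu^c_{<u>}=2\mathcal{E}^{(\mathrm{c})}(uf,u)-\mathcal{E}^{(\mathrm{c})}(u^2,f)$ for all $f\in\mathcal{F}\cap C_\mathrm{c}(E)$. For bounded $u,v\in\mathcal{F}$, $\mu^c_{<u,v>}:=\frac12(\mu^c_{<u+v>}-\mu^c_{<u>}-\mu^c_{<v>})$, a bounded signed measure. ${\mu'}^c_{<u,v>}$ is defined in the same way from $(\mathcal{E}',\mathcal{F}')$. *)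

theory Defs
  imports "HOL-Analysis.Analysis"
begin

text \<open>
  The state space is a type of class \<^class>\<open>metric_space\<close> and
  \<^class>\<open>second_countable_topology\<close>; for metric spaces the latter is equivalent to
  separability.  Elements of \<open>L\<^sup>2(E,m)\<close> are represented by Borel functions; a domain \<open>F\<close> is a set
  of such functions that is saturated under \<open>m\<close>-a.e. equality, so that inclusions and
  equalities of domains are those of the sets of equivalence classes.
\<close>

definition L2 :: "'a measure \<Rightarrow> ('a \<Rightarrow> real) set" where
  "L2 m = {f \<in> borel_measurable m. integrable m (\<lambda>x. (f x)\<^sup>2)}"

definition Cc :: "('a::topological_space \<Rightarrow> real) set" where
  "Cc = {f. continuous_on UNIV f \<and> compact (closure {x. f x \<noteq> 0})}"

text \<open>On the locally compact second countable spaces used here, every Borel measure that is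
  finite on compact sets is regular, so regularity is not listed.\<close>

definition radon_measure_on :: "'a::topological_space set \<Rightarrow> 'a measure \<Rightarrow> bool" where
  "radon_measure_on S M \<longleftrightarrow>
     sets M = sets (restrict_space borel S) \<and>
     (\<forall>K. compact K \<and> K \<subseteq> S \<longrightarrow> emeasure M K < \<infinity>)"

definition full_support :: "'a::topological_space measure \<Rightarrow> bool" where
  "full_support m \<longleftrightarrow> (\<forall>U. open U \<and> U \<noteq> {} \<longrightarrow> emeasure m U > 0)"

type_synonym 'a form = "('a \<Rightarrow> real) \<Rightarrow> ('a \<Rightarrow> real) \<Rightarrow> real"

definition symmetric_form :: "'a measure \<Rightarrow> 'a form \<Rightarrow> ('a \<Rightarrow> real) set \<Rightarrow> bool" where
  "symmetric_form m E F \<longleftrightarrow>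
     F \<subseteq> L2 m \<and>
     (\<lambda>x. 0) \<in> F \<and>
     (\<forall>u\<in>F. \<forall>v\<in>F. (\<lambda>x. u x + v x) \<in> F) \<and>
     (\<forall>u\<in>F. \<forall>c. (\<lambda>x. c * u x) \<in> F) \<and>
     (\<forall>u\<in>F. \<forall>v\<in>borel_measurable m. (AE x in m. u x = v x) \<longrightarrow>
        v \<in> F \<and> (\<forall>w\<in>F. E v w = E u w)) \<and>
     (\<forall>u\<in>F. \<forall>v\<in>F. \<forall>w\<in>F. E (\<lambda>x. u x + v x) w = E u w + E v w) \<and>
     (\<forall>u\<in>F. \<forall>w\<in>F. \<forall>c. E (\<lambda>x. c * u x) w = c * E u w) \<and>
     (\<forall>u\<in>F. \<forall>v\<in>F. E u v = E v u) \<and>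
     (\<forall>u\<in>F. E u u \<ge> 0)"

definition form_1 :: "'a measure \<Rightarrow> 'a form \<Rightarrow> 'a form" where
  "form_1 m E u v = E u v + (\<integral>x. u x * v x \<partial>m)"

definition dist_1 :: "'a measure \<Rightarrow> 'a form \<Rightarrow> ('a \<Rightarrow> real) \<Rightarrow> ('a \<Rightarrow> real) \<Rightarrow> real" where
  "dist_1 m E u v = sqrt (form_1 m E (\<lambda>x. u x - v x) (\<lambda>x. u x - v x))"

definition closed_form :: "'a measure \<Rightarrow> 'a form \<Rightarrow> ('a \<Rightarrow> real) set \<Rightarrow> bool" where
  "closed_form m E F \<longleftrightarrow>
     (\<forall>w. (\<forall>n::nat. w n \<in> F) \<and>
          (\<forall>\<epsilon>>0. \<exists>N. \<forall>i\<ge>N. \<forall>j\<ge>N. dist_1 m E (w i) (w j) < \<epsilon>) \<longrightarrow>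
          (\<exists>u\<in>F. (\<lambda>n. dist_1 m E (w n) u) \<longlonglongrightarrow> 0))"

definition densely_defined :: "'a measure \<Rightarrow> ('a \<Rightarrow> real) set \<Rightarrow> bool" where
  "densely_defined m F \<longleftrightarrow>
     (\<forall>f\<in>L2 m. \<forall>\<epsilon>>0. \<exists>u\<in>F. sqrt (\<integral>x. (f x - u x)\<^sup>2 \<partial>m) < \<epsilon>)"

definition markovian :: "'a form \<Rightarrow> ('a \<Rightarrow> real) set \<Rightarrow> bool" where
  "markovian E F \<longleftrightarrow>
     (\<forall>u\<in>F. let v = (\<lambda>x. min (max (u x) 0) 1) in v \<in> F \<and> E v v \<le> E u u)"

definition dirichlet_form :: "'a measure \<Rightarrow> 'a form \<Rightarrow> ('a \<Rightarrow> real) set \<Rightarrow> bool" where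
  "dirichlet_form m E F \<longleftrightarrow>
     symmetric_form m E F \<and> densely_defined m F \<and> closed_form m E F \<and> markovian E F"

definition regular_dirichlet_form ::
    "'a::topological_space measure \<Rightarrow> 'a form \<Rightarrow> ('a \<Rightarrow> real) set \<Rightarrow> bool" where
  "regular_dirichlet_form m E F \<longleftrightarrow>
     dirichlet_form m E F \<and>
     (\<forall>u\<in>F. \<forall>\<epsilon>>0. \<exists>w\<in>F \<inter> Cc. dist_1 m E u w < \<epsilon>) \<and>
     (\<forall>f\<in>Cc. \<forall>\<epsilon>>0. \<exists>w\<in>F \<inter> Cc. \<forall>x. \<bar>f x - w x\<bar> < \<epsilon>)"

definition regular_subspace ::
    "'a form \<Rightarrow> ('a \<Rightarrow> real) set \<Rightarrow> 'a form \<Rightarrow> ('a \<Rightarrow> real) set \<Rightarrow> bool" where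
  "regular_subspace E' F' E F \<longleftrightarrow> F' \<subseteq> F \<and> (\<forall>u\<in>F'. \<forall>v\<in>F'. E u v = E' u v)"

text \<open>The 1-capacity, first for open sets and then for arbitrary sets; the infimum over the
  empty set is \<open>\<infinity>\<close>.\<close>

definition cap_open ::
    "'a::topological_space measure \<Rightarrow> 'a form \<Rightarrow> ('a \<Rightarrow> real) set \<Rightarrow> 'a set \<Rightarrow> ennreal" where
  "cap_open m E F G =
     (INF u\<in>{u\<in>F. AE x in m. x \<in> G \<longrightarrow> u x \<ge> 1}. ennreal (form_1 m E u u))"

definition cap ::
    "'a::topological_space measure \<Rightarrow> 'a form \<Rightarrow> ('a \<Rightarrow> real) set \<Rightarrow> 'a set \<Rightarrow> ennreal" where
  "cap m E F A = (INF G\<in>{G. open G \<and> A \<subseteq> G}. cap_open m E F G)"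

definition quasi_continuous ::
    "'a::topological_space measure \<Rightarrow> 'a form \<Rightarrow> ('a \<Rightarrow> real) set \<Rightarrow> ('a \<Rightarrow> real) \<Rightarrow> bool" where
  "quasi_continuous m E F u \<longleftrightarrow>
     (\<forall>\<epsilon>>0. \<exists>G. open G \<and> cap m E F G < ennreal \<epsilon> \<and> continuous_on (- G) u)"

text \<open>A quasi-continuous function can be changed on a set of zero capacity to become Borel and
  everywhere finite.  Requiring this of the version makes the integrals against \<open>J\<close> and \<open>k\<close>
  below meaningful without completing these measures.\<close>

definition qc_version ::
    "'a::topological_space measure \<Rightarrow> 'a form \<Rightarrow> ('a \<Rightarrow> real) set \<Rightarrow>
     ('a \<Rightarrow> real) \<Rightarrow> ('a \<Rightarrow> real) \<Rightarrow> bool" where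
  "qc_version m E F u ut \<longleftrightarrow>
     ut \<in> borel_measurable borel \<and> (AE x in m. ut x = u x) \<and> quasi_continuous m E F ut"

text \<open>The support of an a.e. equivalence class, i.e. the support of the measure \<open>|u| m\<close>.\<close>

definition ess_support :: "'a::topological_space measure \<Rightarrow> ('a \<Rightarrow> real) \<Rightarrow> 'a set" where
  "ess_support m u = - \<Union>{U. open U \<and> (AE x in m. x \<in> U \<longrightarrow> u x = 0)}"

definition strongly_local ::
    "'a::topological_space measure \<Rightarrow> 'a form \<Rightarrow> ('a \<Rightarrow> real) set \<Rightarrow> bool" where
  "strongly_local m E F \<longleftrightarrow>
     (\<forall>u\<in>F. \<forall>v\<in>F.
        compact (ess_support m u) \<and> compact (ess_support m v) \<and>
        (\<exists>U c. open U \<and> ess_support m u \<subseteq> U \<and> (AE x in m. x \<in> U \<longrightarrow> v x = c)) \<longrightarrow>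
        E u v = 0)"

text \<open>\<^const>\<open>Id\<close> is the diagonal of the product space, and the jumping measure \<open>J\<close> lives on the
  space \<open>- Id\<close>.\<close>

definition beurling_deny ::
    "'a::{metric_space, second_countable_topology} measure \<Rightarrow> 'a form \<Rightarrow> ('a \<Rightarrow> real) set \<Rightarrow>
     'a form \<Rightarrow> ('a \<times> 'a) measure \<Rightarrow> 'a measure \<Rightarrow> bool" where
  "beurling_deny m E F Ec J k \<longleftrightarrow>
     symmetric_form m Ec F \<and> strongly_local m Ec F \<and> markovian Ec F \<and>
     radon_measure_on (- Id) J \<and>
     (\<forall>A\<in>sets J. emeasure J (prod.swap -` A) = emeasure J A) \<and>
     radon_measure_on UNIV k \<and>
     (\<forall>N\<in>sets borel. cap m E F N = 0 \<longrightarrow>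
        emeasure J (N \<times> UNIV - Id) = 0 \<and> emeasure k N = 0) \<and>
     (\<forall>u\<in>F. \<forall>ut. qc_version m E F u ut \<longrightarrow>
        integrable J (\<lambda>(x, y). (ut x - ut y)\<^sup>2) \<and> integrable k (\<lambda>x. (ut x)\<^sup>2)) \<and>
     (\<forall>u\<in>F. \<forall>v\<in>F. \<forall>ut vt. qc_version m E F u ut \<and> qc_version m E F v vt \<longrightarrow>
        E u v = Ec u v + (\<integral>(x, y). (ut x - ut y) * (vt x - vt y) \<partial>J) + (\<integral>x. ut x * vt x \<partial>k))"

text \<open>The strongly local part \<open>\<mu>\<^sup>c\<^bsub><u>\<^esub>\<close> of the energy measure, meaningful for bounded \<open>u \<in> F\<close>.\<close>

definition energy_measure_c ::
    "'a form \<Rightarrow> ('a \<Rightarrow> real) set \<Rightarrow> ('a::topological_space \<Rightarrow> real) \<Rightarrow> 'a measure" where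
  "energy_measure_c Ec F u =
     (THE \<mu>. sets \<mu> = sets borel \<and> finite_measure \<mu> \<and>
        (\<forall>f\<in>F \<inter> Cc. (\<integral>x. f x \<partial>\<mu>) =
           2 * Ec (\<lambda>x. u x * f x) u - Ec (\<lambda>x. (u x)\<^sup>2) f))"

text \<open>The signed measure \<open>\<mu>\<^sup>c\<^bsub><u,v>\<^esub>\<close>, as a real-valued set function on the Borel sets.\<close>

definition mutual_energy_c ::
    "'a form \<Rightarrow> ('a \<Rightarrow> real) set \<Rightarrow> ('a::topological_space \<Rightarrow> real) \<Rightarrow> ('a \<Rightarrow> real) \<Rightarrow>
     'a set \<Rightarrow> real" where
  "mutual_energy_c Ec F u v A =
     (measure (energy_measure_c Ec F (\<lambda>x. u x + v x)) A
      - measure (energy_measure_c Ec F u) A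
      - measure (energy_measure_c Ec F v) A) / 2"

end

theory Submission
  imports Defs
begin

text \<open>
  All comparisons are made on \<open>A = F \<inter> Cc\<close>, where continuous functions are their own
  quasi-continuous versions, and are transferred to the domains by density and closedness.

  Testing with functions of disjoint supports kills the strongly local and the killing part, so
  \<open>E\<close> determines \<open>J\<close>; testing \<open>u\<close> against a function equal to 1 near its support then determines
  \<open>k\<close>.  For the strongly local part, \<open>\<mu>\<^sup>c\<^bsub><u>\<^esub>\<close> has total mass \<open>2 * Ec u u\<close>, so the energy
  measures determine \<open>Ec\<close> on \<open>A\<close>.

  Since \<open>\<mu>\<^sup>c\<^bsub><u>\<^esub>\<close> is given by a definite description, it has to be shown to exist.  Positivity
  of \<open>f \<mapsto> 2 * G (u * f) u - G (u\<^sup>2) f\<close> for a closable Markovian form \<open>G\<close> is the inequality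
  \<open>P (u\<^sup>2) - 2 * u * P u + u\<^sup>2 \<ge> 0\<close> for the Markovian resolvent \<open>P\<close>; in place of \<open>P u\<close> we use
  near-minimisers in \<open>A\<close> of \<open>G w w + n * \<integral> (w - u)\<^sup>2\<close>, which avoids completing anything.  A positive
  functional on \<open>A\<close> is then represented by a measure as in the Daniell--Stone theorem, as a premeasure
  on the regions between the graphs of two functions of \<open>A\<close>.
\<close>

section \<open>Continuous functions with compact support\<close>

text \<open>Two obstacles shape the development. First, the energy functional involves
  \<open>u * f\<close> and \<open>u\<^sup>2\<close>, whereas the Markov property directly supplies
  only lattice operations. So \<open>F \<inter> Cc\<close> must first be shown to be an algebra:
  \<open>u\<^sup>2\<close> is approximated with bounded energy by sums of truncations
  \<open>max (u - c) 0\<close>, and closedness of \<open>E\<close> captures the limit. Second,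
  passing from resolvents back to the form needs closability, which is available for
  \<open>E\<close> but not for \<open>Ec\<close>. The inequality is therefore proved for
  \<open>Ec + e * E\<close>; its left-hand side is affine in \<open>e\<close>, and \<open>e\<close>
  tends to 0. Near-minimisers solve the resolvent equation only up to a residual, and the residuals
  are multiplied by \<open>n\<close> and by the number of grid points in the Jensen argument. This
  is why the tolerance is an explicit high power of \<open>1 / n\<close>. The total mass formula
  rests on strong locality: the energy measure of \<open>u\<close> lives on the support of
  \<open>u\<close>, so the constant 1 may be replaced by a cutoff from the core.\<close>

lemma Cc_I:
  fixes f :: "'a::t2_space \<Rightarrow> real"
  assumes "continuous_on UNIV f" "compact K" "\<And>x. f x \<noteq> 0 \<Longrightarrow> x \<in> K"
  shows "f \<in> Cc"
proof -
  have "closure {x. f x \<noteq> 0} \<subseteq> K"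
    using assms by (intro closure_minimal compact_imp_closed) auto
  then show ?thesis
    unfolding Cc_def using assms
    by (metis (mono_tags, lifting) closed_Int_compact closed_closure inf.absorb1 mem_Collect_eq)
qed

lemma Cc_D:
  assumes "f \<in> Cc"
  shows "continuous_on UNIV f" "compact (closure {x. f x \<noteq> 0})"
  using assms by (auto simp: Cc_def)

lemma Cc_supp: "f x \<noteq> 0 \<Longrightarrow> x \<in> closure {x. f x \<noteq> 0}"
  using closure_subset by fastforce

lemma Cc_comp:
  fixes f g :: "'a::t2_space \<Rightarrow> real"
  assumes "f \<in> Cc" "continuous_on UNIV g" "\<And>x. f x = 0 \<Longrightarrow> g x = 0"
  shows "g \<in> Cc"
  by (rule Cc_I[of _ "closure {x. f x \<noteq> 0}"]) (use assms Cc_D Cc_supp in fast)+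

lemma Cc_add:
  fixes f g :: "'a::t2_space \<Rightarrow> real"
  assumes "f \<in> Cc" "g \<in> Cc"
  shows "(\<lambda>x. f x + g x) \<in> Cc"
proof (rule Cc_I[of _ "closure {x. f x \<noteq> 0} \<union> closure {x. g x \<noteq> 0}"])
  fix x assume "f x + g x \<noteq> 0"
  then have "f x \<noteq> 0 \<or> g x \<noteq> 0" by auto
  then show "x \<in> closure {x. f x \<noteq> 0} \<union> closure {x. g x \<noteq> 0}"
    using Cc_supp[of f x] Cc_supp[of g x] by auto
qed (use assms Cc_D in \<open>auto intro!: continuous_intros\<close>)

lemma Cc_cmult:
  fixes f :: "'a::t2_space \<Rightarrow> real"
  assumes "f \<in> Cc"
  shows "(\<lambda>x. c * f x) \<in> Cc"
  by (rule Cc_comp[OF assms]) (use assms Cc_D in \<open>auto intro!: continuous_intros\<close>)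

lemma Cc_diff:
  fixes f g :: "'a::t2_space \<Rightarrow> real"
  assumes "f \<in> Cc" "g \<in> Cc"
  shows "(\<lambda>x. f x - g x) \<in> Cc"
  using Cc_add[OF assms(1) Cc_cmult[OF assms(2), of "-1"]] by simp

lemma Cc_mult:
  fixes f g :: "'a::t2_space \<Rightarrow> real"
  assumes "f \<in> Cc" "g \<in> Cc"
  shows "(\<lambda>x. f x * g x) \<in> Cc"
  by (rule Cc_comp[OF assms(1)]) (use assms Cc_D in \<open>auto intro!: continuous_intros\<close>)

lemma Cc_power2:
  fixes f :: "'a::t2_space \<Rightarrow> real"
  assumes "f \<in> Cc"
  shows "(\<lambda>x. (f x)\<^sup>2) \<in> Cc"
  using Cc_mult[OF assms assms] by (simp add: power2_eq_square)

lemma Cc_bounded: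
  fixes f :: "'a::t2_space \<Rightarrow> real"
  assumes "f \<in> Cc"
  obtains M where "M > 0" "\<And>x. \<bar>f x\<bar> \<le> M"
proof -
  have "compact (f ` closure {x. f x \<noteq> 0})"
    using Cc_D[OF assms] by (meson compact_continuous_image continuous_on_subset top_greatest)
  then have "bounded (f ` closure {x. f x \<noteq> 0})" by (rule compact_imp_bounded)
  then obtain M where M: "M > 0" "\<And>y. y \<in> f ` closure {x. f x \<noteq> 0} \<Longrightarrow> \<bar>y\<bar> \<le> M"
    unfolding bounded_pos by auto
  have "\<bar>f x\<bar> \<le> M" for x
    using M Cc_supp[of f x] by (cases "f x = 0") auto
  with M that show thesis by blast
qed

lemma radon_sets: "radon_measure_on UNIV m \<Longrightarrow> sets m = sets borel"
  by (simp add: radon_measure_on_def sets_restrict_space)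

lemma Cc_borel: "f \<in> Cc \<Longrightarrow> f \<in> borel_measurable borel"
  by (simp add: Cc_def borel_measurable_continuous_onI)

lemma Cc_measurable:
  assumes "sets m = sets borel" "f \<in> Cc"
  shows "f \<in> borel_measurable m"
  using Cc_borel[OF assms(2)] measurable_cong_sets[OF assms(1) refl] by blast

lemma radon_finite:
  assumes "radon_measure_on UNIV m" "compact K"
  shows "emeasure m K < \<infinity>"
  using assms by (simp add: radon_measure_on_def)

lemma Cc_integrable:
  fixes f :: "'a::t2_space \<Rightarrow> real"
  assumes m: "radon_measure_on UNIV m" and f: "f \<in> Cc"
  shows "integrable m f"
proof -
  let ?K = "closure {x. f x \<noteq> 0}"
  obtain M where M: "M > 0" "\<And>x. \<bar>f x\<bar> \<le> M" using Cc_bounded[OF f] by blast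
  have K: "?K \<in> sets m" using radon_sets[OF m] Cc_D[OF f] by simp
  have "integrable m (\<lambda>x. M * indicator ?K x)"
    using radon_finite[OF m Cc_D(2)[OF f]] K by (intro integrable_mult_right integrable_real_indicator) auto
  then show ?thesis
  proof (rule Bochner_Integration.integrable_bound)
    show "f \<in> borel_measurable m" using Cc_measurable radon_sets m f by blast
    show "AE x in m. norm (f x) \<le> norm (M * indicator ?K x)"
      using M Cc_supp[of f] by (intro AE_I2) (auto simp: indicator_def)
  qed
qed

text \<open>The value 2, rather than 1, leaves room for a later uniform approximation by a function
  of the core: after an error of 1/2 and a truncation the result is still exactly 1 near
  \<open>K\<close>.\<close>

lemma Urysohn_Cc:
  fixes K U :: "'a::metric_space set"
  assumes lc: "locally compact (UNIV :: 'a set)" and K: "compact K" and U: "open U" "K \<subseteq> U"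
  obtains g W where "g \<in> Cc" "\<And>x. g x \<ge> 0" "open W" "K \<subseteq> W" "\<And>x. x \<in> W \<Longrightarrow> g x \<ge> 2"
    "closure {x. g x \<noteq> 0} \<subseteq> U"
proof (cases "K = {}")
  case True
  then show thesis by (intro that[of "\<lambda>_. 0" "{}"]) (auto simp: Cc_def)
next
  case False
  have "\<exists>V C. open V \<and> x \<in> V \<and> compact C \<and> V \<subseteq> C \<and> C \<subseteq> U" if "x \<in> K" for x
  proof -
    have "openin (top_of_set UNIV) U \<and> x \<in> U" using that U by auto
    with lc[unfolded locally_def] obtain u v where "openin (top_of_set UNIV) u" "compact v" "x \<in> u" "u \<subseteq> v" "v \<subseteq> U"
      by meson
    then show ?thesis by auto
  qed
  then obtain V C where VC: "\<And>x. x \<in> K \<Longrightarrow> open (V x) \<and> x \<in> V x \<and> compact (C x) \<and> V x \<subseteq> C x \<and> C x \<subseteq> U"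
    by metis
  then have "\<forall>x\<in>K. open (V x)" "K \<subseteq> (\<Union>x\<in>K. V x)" by auto
  then obtain D where D: "D \<subseteq> K" "finite D" "K \<subseteq> (\<Union>x\<in>D. V x)"
    using compactE_image[OF K, of K V] by metis
  let ?V = "\<Union>x\<in>D. V x" and ?C = "\<Union>x\<in>D. C x"
  have C: "compact ?C" "?V \<subseteq> ?C" "?C \<subseteq> U" "open ?V"
    using D VC by (fast intro: compact_UN open_UN)+
  obtain e where e: "0 < e" "(\<Union>x\<in>K. ball x e) \<subseteq> ?V"
    using compact_subset_open_imp_ball_epsilon_subset[OF K C(4) D(3)] by metis
  \<comment> \<open>The slope \<open>3 / e\<close> takes \<open>g\<close> from 3 on \<open>K\<close>
    to 0 at distance \<open>e\<close>; it is still at least 2 within distance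
    \<open>e / 3\<close>.\<close>
  define g where "g = (\<lambda>x. max 0 (3 - 3 / e * infdist x K))"
  have contg: "continuous_on UNIV g"
    unfolding g_def by (intro continuous_intros)
  have gC: "x \<in> ?C" if "g x \<noteq> 0" for x
  proof -
    have "3 / e * infdist x K < 3" using that by (auto simp: g_def max_def split: if_splits)
    then have "infdist x K < e" using e by (simp add: field_simps)
    then have "(INF y\<in>K. dist x y) < e" using infdist_notempty[OF False] by simp
    then obtain y where "y \<in> K" "dist x y < e"
      using cInf_lessD[of "dist x ` K" e] False by blast
    then have "x \<in> ball y e" by (simp add: dist_commute)
    with \<open>y \<in> K\<close> e C show ?thesis by blast
  qed
  show thesis
  proof (rule that[of g "{x. infdist x K < e / 3}"])
    show "g \<in> Cc" using Cc_I[OF contg C(1)] gC by blast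
    show "g x \<ge> 0" for x by (simp add: g_def)
    show "open {x. infdist x K < e / 3}"
      by (intro open_Collect_less continuous_intros)
    show "K \<subseteq> {x. infdist x K < e / 3}" using e by auto
    show "2 \<le> g x" if "x \<in> {x. infdist x K < e / 3}" for x
      using that e by (auto simp: g_def field_simps)
    have "closure {x. g x \<noteq> 0} \<subseteq> ?C"
      using gC compact_imp_closed[OF C(1)] by (intro closure_minimal) auto
    then show "closure {x. g x \<noteq> 0} \<subseteq> U" using C by blast
  qed
qed

text \<open>An abstraction of \<open>F \<inter> Cc\<close>. Closure under products is deliberately
  left out: for \<open>F \<inter> Cc\<close> it is a theorem whose proof already works inside this
  locale.\<close>

locale core =
  fixes A :: "('a::{metric_space, second_countable_topology} \<Rightarrow> real) set"
  assumes lc: "locally compact (UNIV :: 'a set)"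
    and A_Cc: "A \<subseteq> Cc"
    and zero: "(\<lambda>x. 0) \<in> A"
    and add: "u \<in> A \<Longrightarrow> v \<in> A \<Longrightarrow> (\<lambda>x. u x + v x) \<in> A"
    and cmult: "u \<in> A \<Longrightarrow> (\<lambda>x. c * u x) \<in> A"
    and unit: "u \<in> A \<Longrightarrow> (\<lambda>x. min (max (u x) 0) 1) \<in> A"
    and dense: "f \<in> Cc \<Longrightarrow> \<epsilon> > 0 \<Longrightarrow> \<exists>w\<in>A. \<forall>x. \<bar>f x - w x\<bar> < \<epsilon>"
begin

section \<open>Lattice operations and cutoff functions in a core\<close>

lemma CcD: "u \<in> A \<Longrightarrow> u \<in> Cc" using A_Cc by blast

lemma cont: "u \<in> A \<Longrightarrow> continuous_on UNIV u" using A_Cc Cc_D by blast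

lemma diff: "u \<in> A \<Longrightarrow> v \<in> A \<Longrightarrow> (\<lambda>x. u x - v x) \<in> A"
  using add[OF _ cmult[of v "-1"], of u] by simp

lemma uminus: "u \<in> A \<Longrightarrow> (\<lambda>x. - u x) \<in> A"
  using cmult[of u "-1"] by simp

lemma sum: "finite I \<Longrightarrow> (\<And>i. i \<in> I \<Longrightarrow> u i \<in> A) \<Longrightarrow> (\<lambda>x. \<Sum>i\<in>I. u i x) \<in> A"
  by (induction I rule: finite_induct) (auto intro: zero add)

lemma clip:
  assumes "u \<in> A" "c \<ge> 0"
  shows "(\<lambda>x. min (max (u x) 0) c) \<in> A"
proof (cases "c = 0")
  case True
  then have "min (max (u x) 0) c = 0" for x by auto
  then show ?thesis using zero by simp
next
  case False
  have "(\<lambda>x. c * min (max (1 / c * u x) 0) 1) \<in> A" by (intro cmult unit assms)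
  moreover have "c * min (max (1 / c * u x) 0) 1 = min (max (u x) 0) c" for x
    using False assms(2) by (auto simp: min_def max_def field_simps)
  ultimately show ?thesis by simp
qed

lemma pos_part:
  assumes "u \<in> A"
  shows "(\<lambda>x. max (u x) 0) \<in> A"
proof -
  obtain M where "M > 0" "\<And>x. \<bar>u x\<bar> \<le> M" using Cc_bounded[OF CcD[OF assms]] by blast
  then have "min (max (u x) 0) M = max (u x) 0" for x
    using abs_le_D1[of "u x" M] by (auto simp: min_def max_def)
  with clip[OF assms, of M] \<open>M > 0\<close> show ?thesis by simp
qed

lemma max: "u \<in> A \<Longrightarrow> v \<in> A \<Longrightarrow> (\<lambda>x. max (u x) (v x)) \<in> A"
proof -
  assume "u \<in> A" "v \<in> A"
  then have "(\<lambda>x. v x + max (u x - v x) 0) \<in> A" by (intro add pos_part diff)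
  moreover have "v x + max (u x - v x) 0 = max (u x) (v x)" for x by auto
  ultimately show ?thesis by simp
qed

lemma min: "u \<in> A \<Longrightarrow> v \<in> A \<Longrightarrow> (\<lambda>x. min (u x) (v x)) \<in> A"
proof -
  assume "u \<in> A" "v \<in> A"
  then have "(\<lambda>x. u x - max (u x - v x) 0) \<in> A" by (intro diff pos_part)
  moreover have "u x - max (u x - v x) 0 = min (u x) (v x)" for x by auto
  ultimately show ?thesis by simp
qed

lemma abs:
  assumes "u \<in> A"
  shows "(\<lambda>x. \<bar>u x\<bar>) \<in> A"
proof -
  have "\<bar>u x\<bar> = max (u x) (- u x)" for x by auto
  then show ?thesis using max[OF assms uminus[OF assms]] by simp
qed

lemma above:
  assumes "u \<in> A" "c \<ge> 0"
  shows "(\<lambda>x. max (u x - c) 0) \<in> A"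
proof -
  have "(\<lambda>x. max (u x) 0 - min (max (u x) 0) c) \<in> A" by (intro diff pos_part clip assms)
  moreover have "max (u x) 0 - min (max (u x) 0) c = max (u x - c) 0" for x
    using assms(2) by auto
  ultimately show ?thesis by simp
qed

lemma bump:
  assumes "compact K" "open U" "K \<subseteq> U"
  obtains f W where "f \<in> A" "\<And>x. 0 \<le> f x" "\<And>x. f x \<le> 1" "open W" "K \<subseteq> W"
    "\<And>x. x \<in> W \<Longrightarrow> f x = 1" "closure {x. f x \<noteq> 0} \<subseteq> U"
proof -
  obtain g W where g: "g \<in> Cc" "\<And>x. g x \<ge> 0" "open W" "K \<subseteq> W" "\<And>x. x \<in> W \<Longrightarrow> g x \<ge> 2"
    "closure {x. g x \<noteq> 0} \<subseteq> U"
    using Urysohn_Cc[OF lc assms] by metis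
  obtain w where w: "w \<in> A" "\<And>x. \<bar>g x - w x\<bar> < 1/2" using dense[OF g(1), of "1/2"] by auto
  \<comment> \<open>Where \<open>g\<close> vanishes, \<open>w < 1/2\<close> and the shift removes
    it; where \<open>g \<ge> 2\<close>, \<open>w - 1/2 > 1\<close> and the clip gives exactly 1. The
    doubled \<open>max\<close> is the shape produced by \<open>clip\<close> after
    \<open>above\<close>.\<close>
  let ?f = "\<lambda>x. min (max (max (w x - 1/2) 0) 0) 1"
  show thesis
  proof (rule that[of ?f W])
    show "?f \<in> A" using w by (intro clip above) auto
    show "?f x = 1" if "x \<in> W" for x using g(5)[OF that] w(2)[of x] by linarith
    have "?f x = 0" if "g x = 0" for x using that w(2)[of x] by auto
    then have "{x. ?f x \<noteq> 0} \<subseteq> {x. g x \<noteq> 0}" by blast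
    then show "closure {x. ?f x \<noteq> 0} \<subseteq> U" using closure_mono g(6) by blast
  qed (use g in auto)
qed

lemma bump_point:
  assumes "open U" "x \<in> U"
  obtains f where "f \<in> A" "\<And>y. 0 \<le> f y" "f x > 0" "closure {x. f x \<noteq> 0} \<subseteq> U"
proof -
  obtain f W where "f \<in> A" "\<And>x. 0 \<le> f x" "\<And>x. f x \<le> 1" "open W" "{x} \<subseteq> W"
    "\<And>x. x \<in> W \<Longrightarrow> f x = 1" "closure {x. f x \<noteq> 0} \<subseteq> U"
    using bump[of "{x}" U] assms by auto
  then show thesis using that[of f] by auto
qed

lemma open_pos: "u \<in> A \<Longrightarrow> open {x. u x > 0}"
  using cont by (intro open_Collect_less) auto

lemma open_cover:
  assumes "open U"
  obtains f :: "nat \<Rightarrow> 'a \<Rightarrow> real" where "\<And>n. f n \<in> A" "\<And>n x. f n x \<ge> 0"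
    "\<And>n. closure {x. f n x \<noteq> 0} \<subseteq> U" "U = (\<Union>n. {x. f n x > 0})"
proof -
  let ?P = "{f\<in>A. (\<forall>x. f x \<ge> 0) \<and> closure {x. f x \<noteq> 0} \<subseteq> U}"
  have zP: "(\<lambda>x. 0) \<in> ?P" using zero by auto
  let ?F = "(\<lambda>f. {x. f x > 0}) ` ?P"
  have "\<And>S. S \<in> ?F \<Longrightarrow> open S" using open_pos by auto
  then obtain F' where F': "F' \<subseteq> ?F" "countable F'" "\<Union>F' = \<Union>?F" by (rule Lindelof)
  have "\<Union>?F = U"
  proof
    show "\<Union>?F \<subseteq> U"
    proof
      fix x assume "x \<in> \<Union>?F"
      then obtain f where "f \<in> ?P" "f x > 0" by auto
      then show "x \<in> U" using Cc_supp[of f x] by auto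
    qed
    show "U \<subseteq> \<Union>?F"
    proof
      fix x assume "x \<in> U"
      then obtain f where "f \<in> A" "\<And>y. 0 \<le> f y" "f x > 0" "closure {x. f x \<noteq> 0} \<subseteq> U"
        using bump_point[OF assms] by metis
      then show "x \<in> \<Union>?F" by auto
    qed
  qed
  obtain C where C: "C \<subseteq> ?P" "countable C" "F' = (\<lambda>f. {x. f x > 0}) ` C"
    using F' countable_subset_image[of F' "\<lambda>f. {x. f x > 0}" ?P] by auto
  \<comment> \<open>\<open>from_nat_into\<close> enumerates only nonempty sets, and \<open>C\<close>
    may be empty when \<open>U\<close> is.\<close>
  let ?C = "insert (\<lambda>x. 0) C"
  have C': "countable ?C" "?C \<noteq> {}" "?C \<subseteq> ?P" using C zP by auto
  define f where "f = from_nat_into ?C"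
  have r: "range f = ?C" unfolding f_def by (rule range_from_nat_into) (use C' in auto)
  show thesis
  proof (rule that[of f])
    have "f n \<in> ?P" for n using r C' by blast
    then show "f n \<in> A" "f n x \<ge> 0" "closure {x. f n x \<noteq> 0} \<subseteq> U" for n x by auto
    have "U = \<Union>((\<lambda>f. {x. f x > 0}) ` C)" using F'(3) C(3) \<open>\<Union>?F = U\<close> by simp
    also have "\<dots> = \<Union>((\<lambda>f. {x. f x > 0}) ` ?C)" by auto
    also have "\<dots> = (\<Union>n. {x. f n x > 0})" unfolding r[symmetric] by auto
    finally show "U = (\<Union>n. {x. f n x > 0})" .
  qed
qed

lemma sigma_pos: "sigma_sets UNIV {{x. f x > 0} |f. f \<in> A \<and> (\<forall>x. f x \<ge> 0)} = sets borel"
proof -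
  let ?G = "{{x. f x > 0} |f. f \<in> A \<and> (\<forall>x. f x \<ge> 0)}"
  have "sigma_sets UNIV {S. open S} \<subseteq> sigma_sets UNIV ?G"
  proof (rule sigma_sets_mono, safe)
    fix U :: "'a set" assume "open U"
    then obtain f :: "nat \<Rightarrow> 'a \<Rightarrow> real" where f: "\<And>n. f n \<in> A" "\<And>n x. f n x \<ge> 0" "U = (\<Union>n. {x. f n x > 0})"
      using open_cover by metis
    have "{x. f n x > 0} \<in> sigma_sets UNIV ?G" for n using f by (intro sigma_sets.Basic) auto
    then show "U \<in> sigma_sets UNIV ?G" unfolding f(3) by (rule sigma_sets.Union)
  qed
  moreover have "sigma_sets UNIV ?G \<subseteq> sigma_sets UNIV {S. open S}"
    using open_pos by (intro sigma_sets_mono) (auto intro!: sigma_sets.Basic)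
  ultimately show ?thesis by (simp add: borel_def)
qed

end

section \<open>Borel measures are determined by integrals over a core\<close>

lemma emeasure_SUP_indicator:
  fixes h :: "nat \<Rightarrow> 'b \<Rightarrow> real"
  assumes "\<And>n. h n \<in> borel_measurable M" "\<And>n x. h n x \<le> h (Suc n) x" "S \<in> sets M"
    and "\<And>x. x \<in> space M \<Longrightarrow> (\<lambda>n. h n x) \<longlonglongrightarrow> indicator S x"
  shows "emeasure M S = (SUP n. \<integral>\<^sup>+x. ennreal (h n x) \<partial>M)"
proof -
  have inc: "incseq (\<lambda>n x. ennreal (h n x))"
    using assms(2) by (auto intro!: incseq_SucI le_funI ennreal_leI)
  have eq: "(SUP n. ennreal (h n x)) = indicator S x" if "x \<in> space M" for x
  proof (rule LIMSEQ_unique)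
    show "(\<lambda>n. ennreal (h n x)) \<longlonglongrightarrow> (SUP n. ennreal (h n x))"
      using assms(2) by (intro LIMSEQ_SUP incseq_SucI ennreal_leI)
    show "(\<lambda>n. ennreal (h n x)) \<longlonglongrightarrow> indicator S x"
      using tendsto_ennrealI[OF assms(4)[OF that]] by (simp add: ennreal_indicator)
  qed
  have "emeasure M S = (\<integral>\<^sup>+x. indicator S x \<partial>M)" using assms(3) by simp
  also have "\<dots> = (\<integral>\<^sup>+x. (SUP n. ennreal (h n x)) \<partial>M)"
    by (intro nn_integral_cong) (simp add: eq)
  also have "\<dots> = (SUP n. \<integral>\<^sup>+x. ennreal (h n x) \<partial>M)"
    by (rule nn_integral_monotone_convergence_SUP[OF inc]) (use assms(1) in auto)
  finally show ?thesis .
qed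

lemma unit_seq_mono: "(a::real) \<ge> 0 \<Longrightarrow> min (max (real n * a) 0) 1 \<le> min (max (real (Suc n) * a) 0) 1"
  by (auto simp: min_def max_def mult_right_mono algebra_simps)

lemma unit_seq_lim:
  assumes "(a::real) \<ge> 0"
  shows "(\<lambda>n. min (max (real n * a) 0) 1) \<longlonglongrightarrow> (if a > 0 then 1 else 0)"
proof (cases "a > 0")
  case True
  obtain N :: nat where N: "1 / a < real N" using reals_Archimedean2 by blast
  have "min (max (real n * a) 0) 1 = 1" if "n \<ge> N" for n
  proof -
    have "1 / a \<le> real n" using N that by linarith
    then have "1 \<le> real n * a" using True by (simp add: field_simps)
    then show ?thesis by simp
  qed
  then have "\<forall>\<^sub>F n in sequentially. min (max (real n * a) 0) 1 = 1" using eventually_sequentially by blast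
  with True show ?thesis using tendsto_eventually by auto
next
  case False
  with assms show ?thesis by simp
qed

context core
begin

lemma unit_n: "u \<in> A \<Longrightarrow> (\<lambda>x. min (max (real n * u x) 0) 1) \<in> A"
  by (intro unit cmult)

lemma emeasure_pos_SUP:
  assumes "sets M = sets borel" "f \<in> A" "\<And>x. f x \<ge> 0"
  shows "emeasure M {x. f x > 0} = (SUP n. \<integral>\<^sup>+x. ennreal (min (max (real n * f x) 0) 1) \<partial>M)"
proof (rule emeasure_SUP_indicator)
  show "(\<lambda>x. min (max (real n * f x) 0) 1) \<in> borel_measurable M" for n
    using Cc_measurable[OF assms(1) CcD[OF unit_n[OF assms(2)]]] .
  show "{x. 0 < f x} \<in> sets M" using open_pos[OF assms(2)] assms(1) by simp
  show "(\<lambda>n. min (max (real n * f x) 0) 1) \<longlonglongrightarrow> indicat_real {x. 0 < f x} x" for x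
    using unit_seq_lim[OF assms(3)[of x]] by (cases "f x > 0") simp_all
qed (rule unit_seq_mono[OF assms(3)])

text \<open>The sets \<open>{x. f x > 0}\<close> form a pi-system generating the Borel sets, since
  \<open>min\<close> realises intersections. Their measures are recovered from integrals because
  \<open>min (n * f) 1\<close> increases to the indicator and stays in the core.\<close>

lemma measure_eqI_integral:
  assumes M: "sets M = sets borel" and N: "sets N = sets borel"
    and int: "\<And>f. f \<in> A \<Longrightarrow> integrable M f" "\<And>f. f \<in> A \<Longrightarrow> integrable N f"
    and eq: "\<And>f. f \<in> A \<Longrightarrow> (\<integral>x. f x \<partial>M) = (\<integral>x. f x \<partial>N)"
  shows "M = N"
proof -
  let ?G = "{{x. f x > 0} |f. f \<in> A \<and> (\<forall>x. f x \<ge> 0)}"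
  have nn: "(\<integral>\<^sup>+x. ennreal (min (max (real n * f x) 0) 1) \<partial>M) = (\<integral>\<^sup>+x. ennreal (min (max (real n * f x) 0) 1) \<partial>N)"
    if "f \<in> A" for f n
    using unit_n[OF that, of n]
    by (subst (1 2) nn_integral_eq_integral) (auto simp: int eq)
  have em: "emeasure M {x. f x > 0} = emeasure N {x. f x > 0}" if "f \<in> A" "\<And>x. f x \<ge> 0" for f
    unfolding emeasure_pos_SUP[OF M that] emeasure_pos_SUP[OF N that] nn[OF that(1)] by (rule refl)
  obtain f :: "nat \<Rightarrow> 'a \<Rightarrow> real" where f: "\<And>n. f n \<in> A" "\<And>n x. f n x \<ge> 0" "UNIV = (\<Union>n. {x. f n x > 0})"
    using open_cover[of UNIV] by auto
  \<comment> \<open>Chebyshev's inequality gives finite measure to superlevel sets at positive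
    levels, so the cover is refined to the levels \<open>1 / Suc k\<close> to obtain the countable
    exhaustion by finite sets.\<close>
  have cov: "UNIV = (\<Union>p. {x. f (fst p) x - 1 / Suc (snd p) > 0})" (is "_ = (\<Union>p. ?S p)")
  proof safe
    fix x
    obtain n where "f n x > 0" using f(3) by auto
    then obtain k where "1 / Suc k < f n x" using nat_approx_posE by blast
    then have "x \<in> ?S (n, k)" by simp
    then show "x \<in> (\<Union>p. ?S p)" by blast
  qed auto
  let ?S' = "\<lambda>p. {x. max (f (fst p) x - 1 / Suc (snd p)) 0 > 0}"
  have S': "?S p = ?S' p" for p by auto
  show "M = N"
  proof (rule measure_eqI_generator_eq_countable[where E = ?G and \<Omega> = UNIV and A = "range ?S'"])
    show "Int_stable ?G"
    proof (rule Int_stableI, safe)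
      fix f g assume fg: "f \<in> A" "\<forall>x. 0 \<le> f x" "g \<in> A" "\<forall>x. 0 \<le> g x"
      show "\<exists>h. {x. 0 < f x} \<inter> {x. 0 < g x} = {x. 0 < h x} \<and> h \<in> A \<and> (\<forall>x. 0 \<le> h x)"
        using fg by (intro exI[of _ "\<lambda>x. min (f x) (g x)"]) (auto intro: min)
    qed
    have "?S' p \<in> ?G" for p
      using above[OF f(1)[of "fst p"], of "1 / Suc (snd p)"] by auto
    then show "range ?S' \<subseteq> ?G" by blast
    show "\<Union> (range ?S') = UNIV" using cov S' by auto
    fix a assume "a \<in> range ?S'"
    then obtain p where p: "a = ?S' p" by blast
    define n k where "n = fst p" and "k = snd p"
    have a: "a = {x. f n x - 1 / Suc k > 0}" unfolding p n_def k_def S'[symmetric] ..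
    have "emeasure M a \<le> (\<integral>\<^sup>+x. ennreal (Suc k * f n x) \<partial>M)"
    proof -
      have "a \<in> sets M" unfolding a M using cont[OF f(1)] by (intro borel_open open_Collect_less continuous_intros) auto
      then have "emeasure M a = (\<integral>\<^sup>+x. indicator a x \<partial>M)" by simp
      also have "\<dots> \<le> (\<integral>\<^sup>+x. ennreal (Suc k * f n x) \<partial>M)"
      proof (rule nn_integral_mono)
        fix x
        show "indicator a x \<le> ennreal (Suc k * f n x)"
        proof (cases "x \<in> a")
          case True
          then have "1 \<le> Suc k * f n x" by (simp add: a field_simps)
          then show ?thesis using True ennreal_leI by fastforce
        qed simp
      qed
      finally show ?thesis .
    qed
    also have "\<dots> < \<infinity>" using f int(1) cmult[OF f(1), of "Suc k" n]
      by (simp add: nn_integral_eq_integral)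
    finally show "emeasure M a \<noteq> \<infinity>" by auto
  qed (use em sigma_pos M N in auto)
qed

end

section \<open>Markovian forms on a core\<close>

text \<open>Divide by \<open>t\<close> and let \<open>t\<close> tend to 0. This serves both for
  one-sided first variations and for removing the perturbation of \<open>Ec\<close>.\<close>

lemma linear_coeff_nonneg:
  fixes b q :: real
  assumes "\<And>t. t > 0 \<Longrightarrow> 0 \<le> 2 * t * b + t\<^sup>2 * q"
  shows "0 \<le> b"
proof (rule ccontr)
  assume "\<not> 0 \<le> b"
  then have b: "b < 0" by simp
  define t where "t = - b / (\<bar>q\<bar> + 1)"
  have t: "t > 0" using b by (simp add: t_def divide_neg_pos)
  have "t * q \<le> t * (\<bar>q\<bar> + 1)" using t by (intro mult_left_mono) auto
  also have "\<dots> = - b" by (simp add: t_def add_eq_0_iff)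
  finally have "2 * b + t * q < 0" using b by linarith
  then have "t * (2 * b + t * q) < 0" using t by (rule mult_pos_neg[rotated])
  then show False using assms[OF t] by (simp add: algebra_simps power2_eq_square)
qed

text \<open>A parabola through the origin that never drops below \<open>- e\<close> has bounded
  slope there. With \<open>e = B u u\<close> this is Cauchy-Schwarz; with \<open>e\<close> the
  tolerance of a near-minimiser it is an approximate Euler-Lagrange equation.\<close>

lemma quadratic_discriminant_le:
  fixes b q e :: real
  assumes "\<And>t. - e \<le> 2 * t * b + t\<^sup>2 * q" "q \<ge> 0" "e \<ge> 0"
  shows "b\<^sup>2 \<le> e * q"
proof (cases "q = 0")
  case True
  have "b = 0"
  proof (rule ccontr)
    assume b: "b \<noteq> 0"
    have "2 * (- (e + 1) / (2 * b)) * b = - (e + 1)" using b by simp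
    then show False using assms(1)[of "- (e + 1) / (2 * b)"] True by simp
  qed
  then show ?thesis using True by simp
next
  case False
  then have q: "q > 0" using assms by simp
  have "2 * (- b / q) * b + (- b / q)\<^sup>2 * q = - b\<^sup>2 / q"
    using q by (simp add: field_simps power2_eq_square)
  then have "- e \<le> - b\<^sup>2 / q" using assms(1)[of "- b / q"] by simp
  then show ?thesis using q by (simp add: field_simps)
qed

locale bform =
  fixes V :: "('a \<Rightarrow> real) set" and B :: "('a \<Rightarrow> real) \<Rightarrow> ('a \<Rightarrow> real) \<Rightarrow> real"
  assumes V_add: "u \<in> V \<Longrightarrow> v \<in> V \<Longrightarrow> (\<lambda>x. u x + v x) \<in> V"
    and V_cmult: "u \<in> V \<Longrightarrow> (\<lambda>x. c * u x) \<in> V"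
    and B_add: "u \<in> V \<Longrightarrow> v \<in> V \<Longrightarrow> w \<in> V \<Longrightarrow> B (\<lambda>x. u x + v x) w = B u w + B v w"
    and B_cmult: "u \<in> V \<Longrightarrow> w \<in> V \<Longrightarrow> B (\<lambda>x. c * u x) w = c * B u w"
    and B_sym: "u \<in> V \<Longrightarrow> v \<in> V \<Longrightarrow> B u v = B v u"
    and B_nonneg: "u \<in> V \<Longrightarrow> 0 \<le> B u u"
begin

lemma B_add_right: "u \<in> V \<Longrightarrow> v \<in> V \<Longrightarrow> w \<in> V \<Longrightarrow> B w (\<lambda>x. u x + v x) = B w u + B w v"
  using B_add[of u v w] B_sym[of w u] B_sym[of w v] B_sym[of w "\<lambda>x. u x + v x"] V_add[of u v] by simp

lemma B_cmult_right: "u \<in> V \<Longrightarrow> w \<in> V \<Longrightarrow> B w (\<lambda>x. c * u x) = c * B w u"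
  using B_cmult[of u w c] B_sym[of w u] B_sym[of w "\<lambda>x. c * u x"] V_cmult[of u c] by simp

lemma V_diff: "u \<in> V \<Longrightarrow> v \<in> V \<Longrightarrow> (\<lambda>x. u x - v x) \<in> V"
  using V_add[OF _ V_cmult[of v "-1"], of u] by simp

lemma B_diff: "u \<in> V \<Longrightarrow> v \<in> V \<Longrightarrow> w \<in> V \<Longrightarrow> B (\<lambda>x. u x - v x) w = B u w - B v w"
  using B_add[OF _ V_cmult[of v "-1"], of u w] B_cmult[of v w "-1"] by simp

lemma B_zero: "u \<in> V \<Longrightarrow> B (\<lambda>x. 0) u = 0"
  using B_cmult[of u u 0] by simp

lemma B_expand:
  assumes "u \<in> V" "v \<in> V"
  shows "B (\<lambda>x. u x + t * v x) (\<lambda>x. u x + t * v x) = B u u + 2 * t * B u v + t\<^sup>2 * B v v"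
  using assms B_sym[OF assms]
  by (simp add: B_add B_add_right B_cmult B_cmult_right V_add V_cmult power2_eq_square)

lemma B_diff_self:
  assumes "u \<in> V" "v \<in> V"
  shows "B (\<lambda>x. u x - v x) (\<lambda>x. u x - v x) = B u u - 2 * B u v + B v v"
  using B_expand[OF assms, of "-1"] by simp

lemma B_diff_le:
  assumes "u \<in> V" "v \<in> V"
  shows "B (\<lambda>x. u x - v x) (\<lambda>x. u x - v x) \<le> 2 * B u u + 2 * B v v"
  using B_expand[OF assms, of 1] B_diff_self[OF assms] B_nonneg[OF V_add[OF assms]] by simp

lemma parallelogram:
  assumes "u \<in> V" "v \<in> V"
  shows "B (\<lambda>x. (u x + v x) / 2) (\<lambda>x. (u x + v x) / 2) =
    B u u / 2 + B v v / 2 - B (\<lambda>x. u x - v x) (\<lambda>x. u x - v x) / 4"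
proof -
  have "B (\<lambda>x. 1 / 2 * (u x + v x)) (\<lambda>x. 1 / 2 * (u x + v x)) = 1 / 4 * B (\<lambda>x. u x + v x) (\<lambda>x. u x + v x)"
    using assms by (simp add: B_cmult B_cmult_right V_add V_cmult del: times_divide_eq_left)
  also have "\<dots> = 1 / 4 * (B u u + 2 * B u v + B v v)"
    using B_expand[OF assms, of 1] by simp
  finally show ?thesis using B_diff_self[OF assms] by (simp add: field_simps)
qed

lemma Cauchy_Schwarz:
  assumes "u \<in> V" "v \<in> V"
  shows "(B u v)\<^sup>2 \<le> B u u * B v v"
proof (rule quadratic_discriminant_le)
  fix t
  show "- B u u \<le> 2 * t * B u v + t\<^sup>2 * B v v"
    using B_expand[OF assms, of t] B_nonneg[OF V_add[OF assms(1) V_cmult[OF assms(2), of t]]] by simp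
qed (use assms in \<open>auto intro: B_nonneg\<close>)

text \<open>The triangle inequality for the seminorm \<open>sqrt (B v v)\<close>, squared:
  \<open>n\<close> vectors of seminorm at most \<open>sqrt Q\<close>.\<close>

lemma B_sum_le:
  assumes "\<And>i. i < n \<Longrightarrow> v i \<in> V" "\<And>i. i < n \<Longrightarrow> B (v i) (v i) \<le> Q" "Q \<ge> 0" "(\<lambda>x. 0) \<in> V"
  shows "(\<lambda>x. \<Sum>i<n. v i x) \<in> V \<and> B (\<lambda>x. \<Sum>i<n. v i x) (\<lambda>x. \<Sum>i<n. v i x) \<le> (real n)\<^sup>2 * Q"
  using assms(1,2)
proof (induction n)
  case 0
  then show ?case using assms B_zero by simp
next
  case (Suc n)
  let ?s = "\<lambda>x. \<Sum>i<n. v i x"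
  have s: "?s \<in> V" "B ?s ?s \<le> (real n)\<^sup>2 * Q" and v: "v n \<in> V" "B (v n) (v n) \<le> Q"
    using Suc by auto
  have "(B ?s (v n))\<^sup>2 \<le> B ?s ?s * B (v n) (v n)" using Cauchy_Schwarz s v by blast
  also have "\<dots> \<le> ((real n)\<^sup>2 * Q) * Q"
    using s v B_nonneg assms(3) by (intro mult_mono) auto
  also have "\<dots> = (real n * Q)\<^sup>2" by (simp add: power2_eq_square)
  finally have "B ?s (v n) \<le> real n * Q" using assms(3) by (metis power2_le_imp_le mult_nonneg_nonneg of_nat_0_le_iff)
  then have "B ?s ?s + 2 * B ?s (v n) + B (v n) (v n) \<le> (real n)\<^sup>2 * Q + 2 * (real n * Q) + Q"
    using s v by linarith
  also have "\<dots> = (real (Suc n))\<^sup>2 * Q" by (simp add: power2_eq_square algebra_simps)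
  finally show ?case using B_expand[OF s(1) v(1), of 1] V_add[OF s(1) v(1)] by simp
qed

end

lemma bform_Cc:
  assumes "radon_measure_on UNIV (m :: 'a::t2_space measure)"
  shows "bform Cc (\<lambda>u v. \<integral>x. u x * v x \<partial>m)"
proof
  fix u v w :: "'a \<Rightarrow> real" and c :: real
  assume u: "u \<in> Cc" and v: "v \<in> Cc"
  show "(\<lambda>x. u x + v x) \<in> Cc" "(\<lambda>x. c * u x) \<in> Cc" using u v Cc_add Cc_cmult by auto
  show "(\<integral>x. u x * v x \<partial>m) = (\<integral>x. v x * u x \<partial>m)" by (simp add: mult.commute)
  assume w: "w \<in> Cc"
  show "(\<integral>x. (u x + v x) * w x \<partial>m) = (\<integral>x. u x * w x \<partial>m) + (\<integral>x. v x * w x \<partial>m)"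
    using u v w assms by (simp add: distrib_right Bochner_Integration.integral_add Cc_integrable Cc_mult)
next
  fix u w :: "'a \<Rightarrow> real" and c :: real
  show "(\<integral>x. c * u x * w x \<partial>m) = c * (\<integral>x. u x * w x \<partial>m)"
    by (simp add: mult.assoc)
  show "0 \<le> (\<integral>x. u x * u x \<partial>m)" by simp
qed

locale core_form = core A + G: bform A G for A :: "('a::{metric_space, second_countable_topology} \<Rightarrow> real) set" and G +
  fixes m :: "'a measure"
  assumes radon: "radon_measure_on UNIV m"
    and markov: "u \<in> A \<Longrightarrow> G (\<lambda>x. min (max (u x) 0) 1) (\<lambda>x. min (max (u x) 0) 1) \<le> G u u"
begin

sublocale ip: bform Cc "\<lambda>u v. \<integral>x. u x * v x \<partial>m"
  using bform_Cc[OF radon] .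

lemma clip_le:
  assumes "u \<in> A" "c > 0"
  shows "G (\<lambda>x. min (max (u x) 0) c) (\<lambda>x. min (max (u x) 0) c) \<le> G u u"
proof -
  let ?v = "\<lambda>x. 1 / c * u x"
  let ?w = "\<lambda>x. min (max (?v x) 0) 1"
  have v: "?v \<in> A" "?w \<in> A" by (intro cmult unit assms)+
  have "min (max (u x) 0) c = c * ?w x" for x
    using assms(2) by (auto simp: min_def max_def field_simps)
  then have "G (\<lambda>x. min (max (u x) 0) c) (\<lambda>x. min (max (u x) 0) c) = G (\<lambda>x. c * ?w x) (\<lambda>x. c * ?w x)"
    by simp
  also have "\<dots> = c\<^sup>2 * G ?w ?w"
    using v by (simp only: G.B_cmult G.B_cmult_right G.V_cmult power2_eq_square mult.assoc)
  also have "\<dots> \<le> c\<^sup>2 * G ?v ?v" using markov[OF v(1)] by (intro mult_left_mono) auto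
  also have "\<dots> = G u u"
    using assms by (simp add: G.B_cmult G.B_cmult_right G.V_cmult power2_eq_square del: times_divide_eq_left)
  finally show ?thesis .
qed

text \<open>Clipping \<open>u - t * v\<close> to \<open>[0, M]\<close> gives back \<open>u\<close>.
  So moving in direction \<open>- v\<close> cannot lower the energy, and the first variation
  \<open>- G u v\<close> is nonnegative.\<close>

lemma G_disjoint:
  assumes "u \<in> A" "v \<in> A" "\<And>x. u x \<ge> 0" "\<And>x. v x \<ge> 0" "\<And>x. u x = 0 \<or> v x = 0"
  shows "G u v \<le> 0"
proof -
  have "0 \<le> 2 * t * (- G u v) + t\<^sup>2 * G v v" if t: "t > 0" for t
  proof -
    obtain M where M: "M > 0" "\<And>x. \<bar>u x\<bar> \<le> M" using Cc_bounded[OF CcD[OF assms(1)]] by blast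
    have uv: "(\<lambda>x. u x + (- t) * v x) \<in> A" using assms by (intro add cmult)
    have "min (max (u x + (- t) * v x) 0) M = u x" for x
      using assms(3-5)[of x] M(2)[of x] t M(1) by (cases "u x = 0") auto
    then have "G u u \<le> G u u + 2 * (- t) * G u v + (- t)\<^sup>2 * G v v"
      using clip_le[OF uv M(1)] by (simp only: G.B_expand[OF assms(1,2)])
    then show ?thesis by simp
  qed
  then have "0 \<le> - G u v" by (rule linear_coeff_nonneg)
  then show ?thesis by simp
qed

text \<open>Here \<open>v\<close> lives where \<open>u\<close> has reached its ceiling
  \<open>c\<close>, so clipping \<open>u + t * v\<close> at \<open>c\<close> gives back
  \<open>u\<close> and the first variation in direction \<open>v\<close> is nonnegative.\<close>

lemma G_stack:
  assumes "u \<in> A" "v \<in> A" "c > 0" "\<And>x. 0 \<le> u x" "\<And>x. u x \<le> c" "\<And>x. v x \<ge> 0" "\<And>x. v x > 0 \<Longrightarrow> u x = c"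
  shows "0 \<le> G u v"
proof -
  have "0 \<le> 2 * t * G u v + t\<^sup>2 * G v v" if t: "t > 0" for t
  proof -
    have uv: "(\<lambda>x. u x + t * v x) \<in> A" using assms by (intro add cmult)
    have "min (max (u x + t * v x) 0) c = u x" for x
      using assms(4-7)[of x] t assms(3) by (cases "v x = 0") auto
    then show ?thesis
      using clip_le[OF uv assms(3)] by (simp only: G.B_expand[OF assms(1,2)])
  qed
  then show ?thesis by (rule linear_coeff_nonneg)
qed

text \<open>Split \<open>h\<close> into its part clipped to \<open>[0, c]\<close>, minus its
  negative part, plus the excess over \<open>c\<close>. Against the excess, the clipped part pairs
  nonnegatively by \<open>G_stack\<close> and the negative part nonpositively by
  \<open>G_disjoint\<close>.\<close>

lemma G_above:
  assumes h: "h \<in> A" and c: "c \<ge> 0"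
  shows "G (\<lambda>x. max (h x - c) 0) (\<lambda>x. max (h x - c) 0) \<le> G h (\<lambda>x. max (h x - c) 0)"
proof -
  let ?v = "\<lambda>x. max (h x - c) 0" and ?p = "\<lambda>x. min (max (h x) 0) c" and ?q = "\<lambda>x. max (- h x) 0"
  have A: "?v \<in> A" "?p \<in> A" "?q \<in> A" using h c by (auto intro: above clip pos_part uminus)
  have "h x = ?p x - ?q x + ?v x" for x using c by auto
  then have "G h ?v = G (\<lambda>x. ?p x - ?q x + ?v x) ?v" by presburger
  also have "\<dots> = G ?p ?v - G ?q ?v + G ?v ?v"
    using A by (simp add: G.B_add G.B_diff G.V_diff)
  finally have "G h ?v = G ?p ?v - G ?q ?v + G ?v ?v" .
  moreover have "G ?q ?v \<le> 0"
    by (rule G_disjoint) (use A c in auto)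
  moreover have "0 \<le> G ?p ?v"
  proof (cases "c = 0")
    case True
    then have "?p = (\<lambda>x. 0)" by auto
    then show ?thesis using G.B_zero[OF A(1)] by simp
  next
    case False
    then show ?thesis using A c by (intro G_stack[where c = c]) (auto split: if_splits)
  qed
  ultimately show ?thesis by linarith
qed

text \<open>With \<open>v\<close> the excess, \<open>0 \<le> G (h - v) (h - v)\<close> and
  \<open>G v v \<le> G h v\<close> give
  \<open>G h h \<ge> 2 * G h v - G v v \<ge> G v v\<close>.\<close>

lemma G_above_le:
  assumes h: "h \<in> A" and c: "c \<ge> 0"
  shows "G (\<lambda>x. max (h x - c) 0) (\<lambda>x. max (h x - c) 0) \<le> G h h"
proof -
  let ?v = "\<lambda>x. max (h x - c) 0"
  have v: "?v \<in> A" using above h c by blast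
  show ?thesis
    using G.B_diff_self[OF h v] G.B_nonneg[OF diff[OF h v]] G_above[OF h c] by linarith
qed

text \<open>The discriminant bound turns near-minimality into the second clause. For the last
  clause, the infima increase with \<open>n\<close> and are bounded by \<open>C\<close>, hence
  converge, and uniform convexity converts this into a Cauchy property in energy. The target
  \<open>g\<close> ranges over all of \<open>Cc\<close> so that the lemma can be applied to
  \<open>u\<^sup>2\<close> before \<open>u\<^sup>2\<close> is known to lie in the domain.\<close>

lemma near_minimizers:
  assumes g: "g \<in> Cc" and bd: "\<And>n. \<exists>w\<in>A. G w w + real n * (\<integral>x. (w x - g x) * (w x - g x) \<partial>m) \<le> C"
    and eta: "\<And>n. 0 < \<eta> n" "\<eta> \<longlonglongrightarrow> 0"
  obtains w :: "nat \<Rightarrow> 'a \<Rightarrow> real" where "\<And>n. w n \<in> A"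
    "\<And>n v. v \<in> A \<Longrightarrow> (G (w n) v + real n * (\<integral>x. (w n x - g x) * v x \<partial>m))\<^sup>2
        \<le> \<eta> n * (G v v + real n * (\<integral>x. v x * v x \<partial>m))"
    "\<And>n. G (w n) (w n) + real n * (\<integral>x. (w n x - g x) * (w n x - g x) \<partial>m) \<le> C + \<eta> n"
    "\<And>e. e > 0 \<Longrightarrow> \<exists>N. \<forall>i\<ge>N. \<forall>j\<ge>N. G (\<lambda>x. w i x - w j x) (\<lambda>x. w i x - w j x) < e"
proof -
  define \<Phi> where "\<Phi> n w = G w w + real n * (\<integral>x. (w x - g x) * (w x - g x) \<partial>m)" for n w
  define I where "I n = Inf (\<Phi> n ` A)" for n
  have pos: "0 \<le> \<Phi> n w" if "w \<in> A" for n w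
    using that G.B_nonneg by (simp add: \<Phi>_def)
  have bb: "bdd_below (\<Phi> n ` A)" for n using pos by (auto intro!: bdd_belowI[of _ 0])
  have ne: "\<Phi> n ` A \<noteq> {}" for n using zero by auto
  have I_le: "I n \<le> \<Phi> n w" if "w \<in> A" for n w
    unfolding I_def using bb that by (intro cInf_lower) auto
  have I_C: "I n \<le> C" for n using bd[of n] I_le unfolding \<Phi>_def[symmetric] by (meson order_trans)
  have \<Phi>_mono: "\<Phi> i w \<le> \<Phi> j w" if "i \<le> j" for i j w
    unfolding \<Phi>_def using that by (intro add_left_mono mult_right_mono) auto
  have I_mono: "I i \<le> I j" if "i \<le> j" for i j
    unfolding I_def[of j] using ne[of j] I_le[of _ i] \<Phi>_mono[OF that] by (intro cInf_greatest) (auto intro: order_trans)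
  have "\<exists>w\<in>A. \<Phi> n w < I n + \<eta> n" for n
    using cInf_lessD[OF ne, of n "I n + \<eta> n"] eta(1)[of n] unfolding I_def by auto
  then obtain w where w: "\<And>n. w n \<in> A" "\<And>n. \<Phi> n (w n) < I n + \<eta> n" by metis
  show thesis
  proof (rule that[of w])
    fix n v assume v: "v \<in> A"
    show "(G (w n) v + real n * (\<integral>x. (w n x - g x) * v x \<partial>m))\<^sup>2
        \<le> \<eta> n * (G v v + real n * (\<integral>x. v x * v x \<partial>m))"
    proof (rule quadratic_discriminant_le)
      fix t
      have wv: "(\<lambda>x. w n x + t * v x) \<in> A" using w v by (intro add cmult)
      have "(\<lambda>x. w n x + t * v x - g x) = (\<lambda>x. (w n x - g x) + t * v x)" by (simp add: algebra_simps)
      then have "\<Phi> n (\<lambda>x. w n x + t * v x) = \<Phi> n (w n) +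
          2 * t * (G (w n) v + real n * (\<integral>x. (w n x - g x) * v x \<partial>m)) + t\<^sup>2 * (G v v + real n * (\<integral>x. v x * v x \<partial>m))"
        unfolding \<Phi>_def G.B_expand[OF w(1) v]
        using ip.B_expand[OF Cc_diff[OF CcD[OF w(1)] g] CcD[OF v], of n t] by (simp add: algebra_simps)
      with I_le[OF wv, of n] w(2)[of n]
      show "- \<eta> n \<le> 2 * t * (G (w n) v + real n * (\<integral>x. (w n x - g x) * v x \<partial>m)) + t\<^sup>2 * (G v v + real n * (\<integral>x. v x * v x \<partial>m))"
        by linarith
    qed (use G.B_nonneg[OF v] eta(1)[of n] in auto)
  next
    show "G (w n) (w n) + real n * (\<integral>x. (w n x - g x) * (w n x - g x) \<partial>m) \<le> C + \<eta> n" for n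
      using w(2)[of n] I_C[of n] unfolding \<Phi>_def by linarith
  next
    \<comment> \<open>The midpoint of \<open>w i\<close> and \<open>w j\<close> competes in the
      \<open>i\<close>-th problem, and \<open>w j\<close> is nearly optimal there up to
      \<open>I j - I i\<close> because the functionals increase with their index. The parallelogram
      identity then bounds the distance.\<close>
    have dist: "G (\<lambda>x. w i x - w j x) (\<lambda>x. w i x - w j x) \<le> 2 * (I j - I i) + 2 * (\<eta> i + \<eta> j)" if ij: "i \<le> j" for i j
    proof -
      let ?a = "\<lambda>x. w i x - g x" and ?b = "\<lambda>x. w j x - g x" and ?d = "\<lambda>x. w i x - w j x"
      have "(\<lambda>x. 1 / 2 * (w i x + w j x)) \<in> A" using w by (intro add cmult)
      then have mid: "(\<lambda>x. (w i x + w j x) / 2) \<in> A" by simp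
      have mg: "(\<integral>x. ((w i x + w j x) / 2 - g x) * ((w i x + w j x) / 2 - g x) \<partial>m) =
          (\<integral>x. (?a x + ?b x) / 2 * ((?a x + ?b x) / 2) \<partial>m)"
        by (rule Bochner_Integration.integral_cong) (simp_all add: field_simps)
      have alg: "a / 2 + b / 2 - d / 4 + r * (p / 2 + q / 2 - s / 4) = (a + r * p) / 2 + (b + r * q) / 2 - (d + r * s) / 4"
        for a b d r p q s :: real by (simp add: field_simps)
      have "\<Phi> i (\<lambda>x. (w i x + w j x) / 2) = \<Phi> i (w i) / 2 + \<Phi> i (w j) / 2
          - (G ?d ?d + real i * (\<integral>x. (?a x - ?b x) * (?a x - ?b x) \<partial>m)) / 4"
        unfolding \<Phi>_def G.parallelogram[OF w(1) w(1)] mg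
          ip.parallelogram[OF Cc_diff[OF CcD[OF w(1)] g] Cc_diff[OF CcD[OF w(1)] g], of i j]
        by (rule alg)
      moreover have "0 \<le> real i * (\<integral>x. (?a x - ?b x) * (?a x - ?b x) \<partial>m)" by simp
      ultimately have "G ?d ?d \<le> 2 * \<Phi> i (w i) + 2 * \<Phi> i (w j) - 4 * \<Phi> i (\<lambda>x. (w i x + w j x) / 2)"
        by (simp add: field_simps)
      also have "\<dots> \<le> 2 * (I i + \<eta> i) + 2 * (I j + \<eta> j) - 4 * I i"
        using w(2)[of i] w(2)[of j] \<Phi>_mono[OF ij, of "w j"] I_le[OF mid, of i] by argo
      finally show ?thesis by simp
    qed
    fix e :: real assume e: "e > 0"
    have "0 \<le> I n" for n unfolding I_def using ne pos by (intro cInf_greatest) auto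
    then have "Bseq I" using I_C by (intro BseqI'[of _ C]) simp
    then have "convergent I" using I_mono by (intro Bseq_mono_convergent) auto
    then have "Cauchy I" by (rule convergent_Cauchy)
    then obtain N1 where N1: "\<And>i j. i \<ge> N1 \<Longrightarrow> j \<ge> N1 \<Longrightarrow> \<bar>I i - I j\<bar> < e / 8"
      using e unfolding Cauchy_def dist_real_def by (metis divide_pos_pos zero_less_numeral)
    obtain N2 where N2: "\<And>i. i \<ge> N2 \<Longrightarrow> \<bar>\<eta> i\<bar> < e / 8"
      using eta(2) e unfolding LIMSEQ_def dist_real_def by (metis diff_zero divide_pos_pos zero_less_numeral)
    have *: "G (\<lambda>x. w i x - w j x) (\<lambda>x. w i x - w j x) < e" if "i \<ge> max N1 N2" "j \<ge> max N1 N2" "i \<le> j" for i j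
    proof -
      have "\<bar>I i - I j\<bar> < e / 8" "\<bar>\<eta> i\<bar> < e / 8" "\<bar>\<eta> j\<bar> < e / 8" using N1 N2 that(1,2) by auto
      then have "I j - I i < e / 8" "\<eta> i < e / 8" "\<eta> j < e / 8" by linarith+
      with dist[OF that(3)] e show ?thesis by argo
    qed
    have sw: "G (\<lambda>x. w i x - w j x) (\<lambda>x. w i x - w j x) = G (\<lambda>x. w j x - w i x) (\<lambda>x. w j x - w i x)" for i j
      using G.B_diff_self[OF w(1) w(1)] G.B_sym[OF w(1) w(1)] by simp
    show "\<exists>N. \<forall>i\<ge>N. \<forall>j\<ge>N. G (\<lambda>x. w i x - w j x) (\<lambda>x. w i x - w j x) < e"
      using * sw by (metis nle_le)
  qed (use w in auto)
qed

end

section \<open>Squares as superpositions of truncations\<close>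

lemma square_step:
  fixes t d :: real
  assumes "d \<ge> 0"
  shows "0 \<le> 2 * d * max t 0 - ((max t 0)\<^sup>2 - (max (t - d) 0)\<^sup>2)"
    and "2 * d * max t 0 - ((max t 0)\<^sup>2 - (max (t - d) 0)\<^sup>2) \<le> d\<^sup>2"
proof -
  have *: "2 * d * t - t\<^sup>2 = t * (2 * d - t)" "2 * d * t - t\<^sup>2 = d\<^sup>2 - (d - t)\<^sup>2" "2 * d * t - (t\<^sup>2 - (t - d)\<^sup>2) = d\<^sup>2"
    by (simp_all add: algebra_simps power2_eq_square)
  consider "t \<le> 0" | "0 \<le> t" "t \<le> d" | "d \<le> t" "0 \<le> t" using assms by linarith
  then have "0 \<le> 2 * d * max t 0 - ((max t 0)\<^sup>2 - (max (t - d) 0)\<^sup>2) \<and>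
    2 * d * max t 0 - ((max t 0)\<^sup>2 - (max (t - d) 0)\<^sup>2) \<le> d\<^sup>2"
  proof cases
    case 1
    then show ?thesis using assms by simp
  next
    case 2
    then have a: "0 \<le> t * (2 * d - t)" by simp
    have b: "t * (2 * d - t) \<le> d\<^sup>2" using zero_le_power2[of "d - t"] *(1,2) by linarith
    have eq: "2 * d * max t 0 - ((max t 0)\<^sup>2 - (max (t - d) 0)\<^sup>2) = t * (2 * d - t)"
      using 2 *(1) by (simp add: max_def)
    show ?thesis unfolding eq using a b by blast
  next
    case 3
    then show ?thesis using * by simp
  qed
  then show "0 \<le> 2 * d * max t 0 - ((max t 0)\<^sup>2 - (max (t - d) 0)\<^sup>2)"
    "2 * d * max t 0 - ((max t 0)\<^sup>2 - (max (t - d) 0)\<^sup>2) \<le> d\<^sup>2" by auto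
qed

text \<open>The sum is the upper Riemann sum with step \<open>d\<close> of the integral of
  \<open>2 * max (t - s) 0\<close> over \<open>s \<ge> 0\<close>, which equals
  \<open>t\<^sup>2\<close>. \<open>square_step\<close> is the error of a single cell, and the
  squares telescope.\<close>

lemma square_approx:
  fixes t d :: real
  assumes "d \<ge> 0" "0 \<le> t" "t \<le> real n * d"
  shows "0 \<le> (\<Sum>i<n. 2 * d * max (t - real i * d) 0) - t\<^sup>2"
    and "(\<Sum>i<n. 2 * d * max (t - real i * d) 0) - t\<^sup>2 \<le> real n * d\<^sup>2"
proof -
  let ?b = "\<lambda>i. (max (t - real i * d) 0)\<^sup>2"
  have "(\<Sum>i<n. ?b i - ?b (Suc i)) = ?b 0 - ?b n" by (rule sum_lessThan_telescope')
  also have "\<dots> = t\<^sup>2" using assms by simp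
  finally have "(\<Sum>i<n. 2 * d * max (t - real i * d) 0) - t\<^sup>2 =
    (\<Sum>i<n. 2 * d * max (t - real i * d) 0 - (?b i - ?b (Suc i)))" by (simp add: sum_subtractf)
  also have "\<dots> = (\<Sum>i<n. 2 * d * max (t - real i * d) 0 - ((max (t - real i * d) 0)\<^sup>2 - (max (t - real i * d - d) 0)\<^sup>2))"
    by (simp add: algebra_simps)
  finally have eq: "(\<Sum>i<n. 2 * d * max (t - real i * d) 0) - t\<^sup>2 = \<dots>" .
  show "0 \<le> (\<Sum>i<n. 2 * d * max (t - real i * d) 0) - t\<^sup>2"
    unfolding eq by (intro sum_nonneg square_step assms)
  have "(\<Sum>i<n. 2 * d * max (t - real i * d) 0 - ((max (t - real i * d) 0)\<^sup>2 - (max (t - real i * d - d) 0)\<^sup>2)) \<le> (\<Sum>i<n. d\<^sup>2)"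
    by (intro sum_mono square_step assms)
  then show "(\<Sum>i<n. 2 * d * max (t - real i * d) 0) - t\<^sup>2 \<le> real n * d\<^sup>2"
    unfolding eq by simp
qed

context core_form
begin

text \<open>Each truncation of \<open>u\<close> has energy at most \<open>G u u\<close>. A Riemann
  sum of \<open>N\<close> such terms with weight \<open>2 * d\<close>, where
  \<open>N * d = M\<close>, has energy at most \<open>(2 * M)\<^sup>2 * G u u\<close> whatever
  \<open>N\<close> is, so \<open>N\<close> may be chosen large in terms of the penalty factor
  \<open>n\<close>.\<close>

lemma square_approx_energy:
  assumes u: "u \<in> A" "\<And>x. u x \<ge> 0"
  obtains C where "\<And>n::nat. \<exists>w\<in>A. G w w + real n * (\<integral>x. (w x - (u x)\<^sup>2) * (w x - (u x)\<^sup>2) \<partial>m) \<le> C"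
proof -
  obtain M where M: "M > 0" "\<And>x. \<bar>u x\<bar> \<le> M" using Cc_bounded[OF CcD[OF u(1)]] by blast
  let ?K = "closure {x. u x \<noteq> 0}"
  obtain k W where chi: "k \<in> A" "\<And>x. 0 \<le> k x" "\<And>x. k x \<le> 1" "?K \<subseteq> W" "\<And>x. x \<in> W \<Longrightarrow> k x = 1"
    using bump[OF Cc_D(2)[OF CcD[OF u(1)]], of UNIV] by (metis open_UNIV top_greatest)
  define c where "c = (\<integral>x. k x * k x \<partial>m)"
  have c: "c \<ge> 0" by (simp add: c_def)
  show thesis
  proof (rule that[of "4 * M\<^sup>2 * G u u + 1"])
    fix n :: nat
    \<comment> \<open>The pointwise error is at most \<open>M\<^sup>2 / N\<close> on the support of
      \<open>u\<close>, hence the penalty is at most \<open>n * M^4 * c / N\<^sup>2\<close>. This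
      choice makes it at most 1, the \<open>+ 1\<close> in the bound.\<close>
    obtain N0 :: nat where N0: "real n * M^4 * c < real N0" using reals_Archimedean2 by blast
    define N where "N = Suc N0"
    define d where "d = M / real N"
    have N: "real N \<ge> 1" "real n * M^4 * c \<le> (real N)\<^sup>2"
    proof -
      show "real N \<ge> 1" by (simp add: N_def)
      have "real n * M^4 * c \<le> real N * 1" using N0 by (simp add: N_def)
      also have "\<dots> \<le> real N * real N" using \<open>real N \<ge> 1\<close> by (intro mult_left_mono) auto
      finally show "real n * M^4 * c \<le> (real N)\<^sup>2" by (simp add: power2_eq_square)
    qed
    have d: "d \<ge> 0" "real N * d = M" using M N by (auto simp: d_def)
    define v where "v i = (\<lambda>x. 2 * d * max (u x - real i * d) 0)" for i :: nat
    define w where "w = (\<lambda>x. \<Sum>i<N. v i x)"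
    have v: "v i \<in> A" for i unfolding v_def using u d by (intro cmult above) auto
    have vG: "G (v i) (v i) \<le> 4 * d\<^sup>2 * G u u" for i
    proof -
      have a: "(\<lambda>x. max (u x - real i * d) 0) \<in> A" using u d by (intro above) auto
      have "G (v i) (v i) = (2 * d) * ((2 * d) * G (\<lambda>x. max (u x - real i * d) 0) (\<lambda>x. max (u x - real i * d) 0))"
        unfolding v_def using a by (simp only: G.B_cmult G.B_cmult_right cmult)
      also have "\<dots> \<le> (2 * d) * ((2 * d) * G u u)"
        using G_above_le[OF u(1), of "real i * d"] d by (intro mult_left_mono) auto
      finally show ?thesis by (simp add: power2_eq_square)
    qed
    have w: "w \<in> A" "G w w \<le> (real N)\<^sup>2 * (4 * d\<^sup>2 * G u u)"
      using G.B_sum_le[of N v, OF v vG _ zero] G.B_nonneg[OF u(1)] unfolding w_def by auto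
    have "(real N)\<^sup>2 * (4 * d\<^sup>2 * G u u) = 4 * (real N * d)\<^sup>2 * G u u"
      by (simp only: power_mult_distrib mult_ac)
    then have Gw: "G w w \<le> 4 * M\<^sup>2 * G u u" using w(2) unfolding d(2) by (simp only:)
    have pt: "\<bar>w x - (u x)\<^sup>2\<bar> \<le> M\<^sup>2 / N * k x" for x
    proof (cases "u x = 0")
      case True
      then have "w x = 0" using d by (simp add: w_def v_def)
      then show ?thesis using True chi(2) by simp
    next
      case False
      then have "k x = 1" using chi(4,5) Cc_supp[of u x] by blast
      have "0 \<le> w x - (u x)\<^sup>2" "w x - (u x)\<^sup>2 \<le> real N * d\<^sup>2"
        using square_approx[OF d(1) u(2)[of x], of N] M(2)[of x] d unfolding w_def v_def by auto
      moreover have "real N * d\<^sup>2 = M\<^sup>2 / N" using N by (simp add: d_def power2_eq_square)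
      ultimately show ?thesis using \<open>k x = 1\<close> by simp
    qed
    have "(\<integral>x. (w x - (u x)\<^sup>2) * (w x - (u x)\<^sup>2) \<partial>m) \<le> (\<integral>x. (M\<^sup>2 / N)\<^sup>2 * (k x * k x) \<partial>m)"
    proof (rule integral_mono)
      show "integrable m (\<lambda>x. (w x - (u x)\<^sup>2) * (w x - (u x)\<^sup>2))"
        using w u by (intro Cc_integrable radon Cc_mult Cc_diff Cc_power2 CcD)
      show "integrable m (\<lambda>x. (M\<^sup>2 / N)\<^sup>2 * (k x * k x))"
        using chi by (intro Cc_integrable radon Cc_mult Cc_cmult CcD)
      fix x
      have "(w x - (u x)\<^sup>2)\<^sup>2 \<le> (M\<^sup>2 / N * k x)\<^sup>2"
        using pt[of x] chi(2)[of x] M by (intro abs_le_square_iff[THEN iffD1]) auto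
      then show "(w x - (u x)\<^sup>2) * (w x - (u x)\<^sup>2) \<le> (M\<^sup>2 / N)\<^sup>2 * (k x * k x)"
        by (simp add: power2_eq_square algebra_simps)
    qed
    also have "\<dots> = (M\<^sup>2 / N)\<^sup>2 * c" by (simp add: c_def)
    finally have "real n * (\<integral>x. (w x - (u x)\<^sup>2) * (w x - (u x)\<^sup>2) \<partial>m) \<le> real n * ((M\<^sup>2 / N)\<^sup>2 * c)"
      by (rule mult_left_mono) simp
    also have "\<dots> = (real n * M^4 * c) / (real N)\<^sup>2" by (simp add: power_divide)
    also have "\<dots> \<le> 1" using N by (simp add: divide_le_eq_1 N_def)
    finally show "\<exists>w\<in>A. G w w + real n * (\<integral>x. (w x - (u x)\<^sup>2) * (w x - (u x)\<^sup>2) \<partial>m) \<le> 4 * M\<^sup>2 * G u u + 1"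
      using w(1) Gw by (intro bexI[of _ w]) auto
  qed
qed

end

section \<open>Positivity of the energy functional\<close>

text \<open>Closability is phrased for a limit already in \<open>A\<close>; no limit object outside
  the core has to be constructed.\<close>

locale closable_form = core_form A G m
  for A :: "('a::{metric_space, second_countable_topology} \<Rightarrow> real) set" and G m +
  assumes mult: "u \<in> A \<Longrightarrow> v \<in> A \<Longrightarrow> (\<lambda>x. u x * v x) \<in> A"
    and closable: "(\<And>n::nat. w n \<in> A) \<Longrightarrow> g \<in> A \<Longrightarrow>
      (\<And>e. e > 0 \<Longrightarrow> \<exists>N. \<forall>i\<ge>N. \<forall>j\<ge>N. G (\<lambda>x. w i x - w j x) (\<lambda>x. w i x - w j x) < e) \<Longrightarrow>
      (\<lambda>n. \<integral>x. (w n x - g x) * (w n x - g x) \<partial>m) \<longlonglongrightarrow> 0 \<Longrightarrow>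
      (\<lambda>n. G (\<lambda>x. w n x - g x) (\<lambda>x. w n x - g x)) \<longlonglongrightarrow> 0"

context core_form
begin

lemmas Cc_intros = Cc_integrable[OF radon] Cc_add Cc_diff Cc_mult Cc_power2

text \<open>For the exact Markovian resolvent \<open>P\<close>, the pointwise inequality
  \<open>2 * c * u - u\<^sup>2 \<le> c\<^sup>2\<close> yields
  \<open>2 * c * P u - P (u\<^sup>2) \<le> c\<^sup>2\<close>. The function \<open>v\<close> measures
  the violation of this by the approximations \<open>a\<close> and \<open>b\<close>; testing both
  resolvent equations with \<open>v\<close> itself shows that the violation is of the order of the
  tolerance.\<close>

lemma resolvent_lower_bound:
  assumes A: "a \<in> A" "b \<in> A" "u \<in> A" and nu: "\<nu> \<ge> 0" and eta: "\<eta> \<ge> 0"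
    and Ra: "\<And>v. v \<in> A \<Longrightarrow> (G a v + \<nu> * (\<integral>x. (a x - u x) * v x \<partial>m))\<^sup>2
        \<le> \<eta> * (G v v + \<nu> * (\<integral>x. v x * v x \<partial>m))"
    and Rb: "\<And>v. v \<in> A \<Longrightarrow> (G b v + \<nu> * (\<integral>x. (b x - (u x)\<^sup>2) * v x \<partial>m))\<^sup>2
        \<le> \<eta> * (G v v + \<nu> * (\<integral>x. v x * v x \<partial>m))"
    and v_def: "v = (\<lambda>x. max (2 * c * a x - b x - c\<^sup>2) 0)"
  shows "v \<in> A" "\<nu> * (\<integral>x. v x * v x \<partial>m) \<le> (8 * c\<^sup>2 + 2) * \<eta>"
proof -
  let ?h = "\<lambda>x. 2 * c * a x - b x"
  have h: "?h \<in> A" using A by (intro diff cmult)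
  show v: "v \<in> A" unfolding v_def using above[OF h, of "c\<^sup>2"] by simp
  define H where "H = G v v + \<nu> * (\<integral>x. v x * v x \<partial>m)"
  have H0: "\<nu> * (\<integral>x. v x * v x \<partial>m) \<le> H" "0 \<le> H" using G.B_nonneg[OF v] nu by (simp_all add: H_def)
  define R1 where "R1 = G a v + \<nu> * (\<integral>x. (a x - u x) * v x \<partial>m)"
  define R2 where "R2 = G b v + \<nu> * (\<integral>x. (b x - (u x)\<^sup>2) * v x \<partial>m)"
  have R: "R1\<^sup>2 \<le> \<eta> * H" "R2\<^sup>2 \<le> \<eta> * H" using Ra[OF v] Rb[OF v] by (simp_all add: R1_def R2_def H_def)
  have "G v v \<le> G ?h v" using G_above[OF h, of "c\<^sup>2"] by (simp add: v_def)
  also have "\<dots> = 2 * c * G a v - G b v"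
    using A v by (simp only: G.B_diff G.B_cmult cmult)
  finally have Gv: "G v v \<le> 2 * c * G a v - G b v" .
  have i1: "integrable m (\<lambda>x. v x * v x)" using v by (auto intro!: Cc_intros intro: CcD)
  have i2: "integrable m (\<lambda>x. (a x - u x) * v x)" using A v by (auto intro!: Cc_intros intro: CcD)
  have i3: "integrable m (\<lambda>x. (b x - (u x)\<^sup>2) * v x)" using A v by (auto intro!: Cc_intros intro: CcD)
  have "(\<integral>x. v x * v x \<partial>m) \<le> (\<integral>x. 2 * c * ((a x - u x) * v x) - (b x - (u x)\<^sup>2) * v x \<partial>m)"
  proof (rule integral_mono[OF i1 Bochner_Integration.integrable_diff[OF integrable_mult_right[OF i2] i3]])
    fix x
    show "v x * v x \<le> 2 * c * ((a x - u x) * v x) - (b x - (u x)\<^sup>2) * v x"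
    proof (cases "v x = 0")
      case False
      then have v0: "v x = 2 * c * a x - b x - c\<^sup>2" "v x \<ge> 0" by (auto simp: v_def max_def split: if_splits)
      \<comment> \<open>Completing the square: the surplus \<open>(u x - c)\<^sup>2\<close> is
        exactly the slack in the pointwise inequality, and it has the favourable sign.\<close>
      have "2 * c * (a x - u x) - (b x - (u x)\<^sup>2) = v x + (u x - c)\<^sup>2"
        unfolding v0(1) by (simp add: power2_eq_square algebra_simps)
      then have "v x * v x \<le> (2 * c * (a x - u x) - (b x - (u x)\<^sup>2)) * v x"
        using v0(2) by (intro mult_right_mono) auto
      then show ?thesis by (simp add: algebra_simps)
    qed simp
  qed
  also have "\<dots> = 2 * c * (\<integral>x. (a x - u x) * v x \<partial>m) - (\<integral>x. (b x - (u x)\<^sup>2) * v x \<partial>m)"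
    using i2 i3 by (subst Bochner_Integration.integral_diff) auto
  finally have "\<nu> * (\<integral>x. v x * v x \<partial>m) \<le>
      \<nu> * (2 * c * (\<integral>x. (a x - u x) * v x \<partial>m) - (\<integral>x. (b x - (u x)\<^sup>2) * v x \<partial>m))"
    using nu by (rule mult_left_mono)
  then have HR: "H \<le> 2 * c * R1 - R2"
    using Gv unfolding H_def R1_def R2_def by (simp add: algebra_simps)
  \<comment> \<open>Both residuals are at most \<open>sqrt (\<eta> * H)\<close>, so squaring gives
    an inequality quadratic in \<open>H\<close> on the left and linear on the right, from which one
    factor \<open>H\<close> cancels.\<close>
  have "H\<^sup>2 \<le> (2 * c * R1 - R2)\<^sup>2" using HR H0 by (intro power_mono) auto
  also have "\<dots> \<le> 2 * (4 * c\<^sup>2 * R1\<^sup>2 + R2\<^sup>2)"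
    using zero_le_power2[of "2 * c * R1 + R2"] by (simp add: power2_eq_square algebra_simps)
  also have "\<dots> \<le> 2 * (4 * c\<^sup>2 * (\<eta> * H) + \<eta> * H)"
    using R by (intro mult_left_mono add_mono) auto
  also have "\<dots> = (8 * c\<^sup>2 + 2) * \<eta> * H" by (simp add: algebra_simps)
  finally have *: "H * H \<le> (8 * c\<^sup>2 + 2) * \<eta> * H" by (simp add: power2_eq_square)
  have "H \<le> (8 * c\<^sup>2 + 2) * \<eta>"
  proof (cases "H = 0")
    case True
    then show ?thesis using eta by simp
  next
    case False
    then show ?thesis using * H0(2) by (metis less_eq_real_def mult_right_le_imp_le)
  qed
  with H0 show "\<nu> * (\<integral>x. v x * v x \<partial>m) \<le> (8 * c\<^sup>2 + 2) * \<eta>" by linarith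
qed

text \<open>Here \<open>a\<close> and \<open>b\<close> stand for the resolvents of \<open>u\<close> and \<open>u\<^sup>2\<close>.  Jensen's inequality comes from
  \<open>u\<^sup>2 = (SUP c. 2 * c * u - c\<^sup>2)\<close>, with \<open>c\<close> restricted to a grid of mesh \<open>1 / q\<close>; \<open>s\<close> is the weight in
  \<open>2 * f * v \<le> s * f\<^sup>2 + v\<^sup>2 / s\<close>.\<close>

lemma resolvent_Jensen:
  fixes M q :: nat
  assumes A: "a \<in> A" "b \<in> A" "u \<in> A" "f \<in> A" and nu: "\<nu> \<ge> 0" and eta: "\<eta> \<ge> 0"
    and Ra: "\<And>v. v \<in> A \<Longrightarrow> (G a v + \<nu> * (\<integral>x. (a x - u x) * v x \<partial>m))\<^sup>2
        \<le> \<eta> * (G v v + \<nu> * (\<integral>x. v x * v x \<partial>m))"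
    and Rb: "\<And>v. v \<in> A \<Longrightarrow> (G b v + \<nu> * (\<integral>x. (b x - (u x)\<^sup>2) * v x \<partial>m))\<^sup>2
        \<le> \<eta> * (G v v + \<nu> * (\<integral>x. v x * v x \<partial>m))"
    and M: "\<And>x. \<bar>u x\<bar> \<le> real M" and f: "\<And>x. 0 \<le> f x" "\<And>x. f x \<le> L" and q: "q > 0" and s: "s > 0"
  shows "- (real (2 * M * q + 1) * ((\<nu> * s * (\<integral>x. f x * f x \<partial>m) + (8 * (real M)\<^sup>2 + 2) * \<eta> / s) / 2)
      + \<nu> / q * ((\<integral>x. f x \<partial>m) + L * (\<integral>x. (u x - a x) * (u x - a x) \<partial>m)) + \<nu> / (real q)\<^sup>2 * (\<integral>x. f x \<partial>m))
    \<le> \<nu> * (\<integral>x. f x * (b x - 2 * u x * a x + (u x)\<^sup>2) \<partial>m)"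
proof -
  \<comment> \<open>A grid of mesh \<open>1 / q\<close> from \<open>- M\<close> to \<open>M\<close>,
    hence \<open>2 * M * q + 1\<close> points; it covers the range of \<open>u\<close>.\<close>
  define c where "c j = real j / real q - real M" for j :: nat
  define v where "v j = (\<lambda>x. max (2 * c j * a x - b x - (c j)\<^sup>2) 0)" for j
  define J where "J = {..2 * M * q}"
  have cM: "\<bar>c j\<bar> \<le> real M" if "j \<in> J" for j
  proof -
    have "real j \<le> real (2 * M * q)" using that unfolding J_def by (simp only: atMost_iff of_nat_le_iff)
    then have "real j / real q \<le> 2 * real M" using q by (simp add: field_simps)
    then show ?thesis using q by (simp add: c_def abs_le_iff)
  qed
  have vA: "v j \<in> A" and vb: "\<nu> * (\<integral>x. v j x * v j x \<partial>m) \<le> (8 * (c j)\<^sup>2 + 2) * \<eta>" for j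
    using resolvent_lower_bound[OF A(1-3) nu eta Ra Rb v_def[of j]] by auto
  have vb': "\<nu> * (\<integral>x. v j x * v j x \<partial>m) \<le> (8 * (real M)\<^sup>2 + 2) * \<eta>" if "j \<in> J" for j
  proof -
    have "(c j)\<^sup>2 \<le> (real M)\<^sup>2" using cM[OF that] by (metis abs_of_nat abs_le_square_iff)
    then show ?thesis using vb[of j] eta by (intro order_trans[OF vb[of j]] mult_right_mono) auto
  qed
  have fv: "\<nu> * (\<integral>x. f x * v j x \<partial>m) \<le> (\<nu> * s * (\<integral>x. f x * f x \<partial>m) + (8 * (real M)\<^sup>2 + 2) * \<eta> / s) / 2" if "j \<in> J" for j
  proof -
    have i': "integrable m (\<lambda>x. f x * v j x)" "integrable m (\<lambda>x. f x * f x)" "integrable m (\<lambda>x. v j x * v j x)"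
      using A(4) vA[of j] by (auto intro!: Cc_intros intro: CcD)
    note i = i'(1) integrable_mult_right[OF i'(2), of "s / 2"] integrable_mult_right[OF i'(3), of "1 / (2 * s)"]
    have "(\<integral>x. f x * v j x \<partial>m) \<le> (\<integral>x. s / 2 * (f x * f x) + 1 / (2 * s) * (v j x * v j x) \<partial>m)"
    proof (rule integral_mono[OF i(1) Bochner_Integration.integrable_add[OF i(2,3)]])
      fix x
      have "0 \<le> (s * f x - v j x)\<^sup>2 / (2 * s)" using s by simp
      also have "\<dots> = s / 2 * (f x * f x) + 1 / (2 * s) * (v j x * v j x) - f x * v j x"
        using s by (simp add: power2_eq_square field_simps)
      finally show "f x * v j x \<le> s / 2 * (f x * f x) + 1 / (2 * s) * (v j x * v j x)" by simp
    qed
    also have "\<dots> = s / 2 * (\<integral>x. f x * f x \<partial>m) + 1 / (2 * s) * (\<integral>x. v j x * v j x \<partial>m)"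
      using i by (subst Bochner_Integration.integral_add) auto
    finally have "\<nu> * (\<integral>x. f x * v j x \<partial>m) \<le> \<nu> * \<dots>" using nu by (rule mult_left_mono)
    also have "\<dots> = \<nu> * s * (\<integral>x. f x * f x \<partial>m) / 2 + (\<nu> * (\<integral>x. v j x * v j x \<partial>m)) / (2 * s)"
      using s by (simp add: field_simps)
    also have "\<dots> \<le> \<nu> * s * (\<integral>x. f x * f x \<partial>m) / 2 + ((8 * (real M)\<^sup>2 + 2) * \<eta>) / (2 * s)"
      using vb'[OF that] s by (intro add_left_mono divide_right_mono) auto
    also have "\<dots> = (\<nu> * s * (\<integral>x. f x * f x \<partial>m) + (8 * (real M)\<^sup>2 + 2) * \<eta> / s) / 2"
      unfolding add_divide_distrib divide_divide_eq_left by (simp only: mult.commute)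
    finally show ?thesis .
  qed
  \<comment> \<open>At each \<open>x\<close> the parameter is the grid point just below
    \<open>u x\<close>. This choice varies with \<open>x\<close>, so its violation
    \<open>v j\<close> is bounded by the sum over the whole grid.\<close>
  have pt: "- (\<Sum>j\<in>J. f x * v j x) - (1 / q * f x + 1 / q * (L * ((u x - a x) * (u x - a x)))) - 1 / (real q)\<^sup>2 * f x
      \<le> f x * (b x - 2 * u x * a x + (u x)\<^sup>2)" for x
  proof -
    define j where "j = nat \<lfloor>(u x + M) * q\<rfloor>"
    have uM: "0 \<le> u x + M" "u x + M \<le> 2 * M" using M[of x] by linarith+
    have j0: "real j \<le> (u x + M) * q" "(u x + M) * q < real j + 1"
      using uM unfolding j_def by (simp_all add: of_nat_nat)
    have "(u x + M) * q \<le> 2 * M * q" using uM mult_right_mono[of "u x + M" "2 * M" q] by simp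
    then have "j \<in> J" using j0(1) unfolding J_def by (simp add: flip: of_nat_le_iff[where 'a = real])
    have d: "0 \<le> u x - c j" "u x - c j \<le> 1 / q"
    proof -
      have eq: "u x - c j = ((u x + M) * q - j) / q" using q by (simp add: c_def field_simps)
      show "0 \<le> u x - c j" unfolding eq using j0(1) by simp
      show "u x - c j \<le> 1 / q" unfolding eq using j0(2) by (intro divide_right_mono) auto
    qed
    define d where "d = u x - c j"
    define t where "t = u x - a x"
    have "- v j x \<le> b x - 2 * c j * a x + (c j)\<^sup>2" by (simp add: v_def)
    also have "\<dots> = (b x - 2 * u x * a x + (u x)\<^sup>2) - 2 * d * t + d\<^sup>2"
      by (simp add: d_def t_def power2_eq_square algebra_simps)
    finally have 1: "- v j x + 2 * d * t - d\<^sup>2 \<le> b x - 2 * u x * a x + (u x)\<^sup>2" by simp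
    \<comment> \<open>Replacing \<open>u x\<close> by the grid point leaves the cross term
      \<open>2 * d * t\<close>. It is absorbed with \<open>d \<le> 1 / q\<close> and
      \<open>t\<^sup>2\<close>, whose integral is controlled through the penalty.\<close>
    have "0 \<le> d * (1 + t)\<^sup>2" using d unfolding d_def[symmetric] by simp
    then have "- (d * (1 + t\<^sup>2)) \<le> 2 * d * t" by (simp add: power2_eq_square algebra_simps)
    moreover have "d * (1 + t\<^sup>2) \<le> 1 / q * (1 + t\<^sup>2)"
      using d unfolding d_def[symmetric] by (intro mult_right_mono) auto
    moreover have "d\<^sup>2 \<le> (1 / q)\<^sup>2" using d unfolding d_def[symmetric] by (intro power_mono) auto
    ultimately have "- v j x - 1 / q * (1 + t\<^sup>2) - (1 / q)\<^sup>2 \<le> b x - 2 * u x * a x + (u x)\<^sup>2"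
      using 1 by linarith
    then have "f x * (- v j x - 1 / q * (1 + t\<^sup>2) - (1 / q)\<^sup>2) \<le> f x * (b x - 2 * u x * a x + (u x)\<^sup>2)"
      using f(1)[of x] by (rule mult_left_mono)
    moreover have "f x * v j x \<le> (\<Sum>j\<in>J. f x * v j x)"
      using \<open>j \<in> J\<close> f(1)[of x] by (intro member_le_sum) (auto simp: J_def v_def)
    moreover have "1 / q * (f x * t\<^sup>2) \<le> 1 / q * (L * t\<^sup>2)"
      using f(2)[of x] by (intro mult_left_mono mult_right_mono) auto
    moreover have "f x * (- v j x - 1 / q * (1 + t\<^sup>2) - (1 / q)\<^sup>2) =
        - (f x * v j x) - 1 / q * f x - 1 / q * (f x * t\<^sup>2) - 1 / (real q)\<^sup>2 * f x"
      by (simp add: algebra_simps power_divide)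
    moreover have "- S - (y + w) - r \<le> h" if "k \<le> h" "z \<le> S" "v \<le> w" "k = - z - y - v - r" for S y w r h k z v :: real
      using that by linarith
    ultimately have "- (\<Sum>j\<in>J. f x * v j x) - (1 / q * f x + 1 / q * (L * t\<^sup>2)) - 1 / (real q)\<^sup>2 * f x
      \<le> f x * (b x - 2 * u x * a x + (u x)\<^sup>2)" by blast
    then show ?thesis by (simp only: t_def power2_eq_square)
  qed
  have i: "integrable m (\<lambda>x. f x * v j x)" "integrable m f" "integrable m (\<lambda>x. (u x - a x) * (u x - a x))" for j
    using A vA[of j] by (auto intro!: Cc_intros intro: CcD)
  have "(\<integral>x. - (\<Sum>j\<in>J. f x * v j x) - (1 / q * f x + 1 / q * (L * ((u x - a x) * (u x - a x)))) - 1 / (real q)\<^sup>2 * f x \<partial>m)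
      \<le> (\<integral>x. f x * (b x - 2 * u x * a x + (u x)\<^sup>2) \<partial>m)" (is "integral\<^sup>L m ?l \<le> _")
  proof (rule integral_mono)
    have "(\<lambda>x. f x * (b x - 2 * (u x * a x) + (u x)\<^sup>2)) \<in> Cc"
      using A by (intro Cc_intros Cc_cmult CcD)
    then show "integrable m (\<lambda>x. f x * (b x - 2 * u x * a x + (u x)\<^sup>2))"
      using Cc_integrable[OF radon] by (simp add: mult.assoc)
    show "integrable m ?l" using i
      by (intro Bochner_Integration.integrable_add Bochner_Integration.integrable_diff
        Bochner_Integration.integrable_sum Bochner_Integration.integrable_minus integrable_mult_right)
  qed (rule pt)
  also have "integral\<^sup>L m ?l = - (\<Sum>j\<in>J. \<integral>x. f x * v j x \<partial>m)
      - (1 / q * (\<integral>x. f x \<partial>m) + 1 / q * (L * (\<integral>x. (u x - a x) * (u x - a x) \<partial>m))) - 1 / (real q)\<^sup>2 * (\<integral>x. f x \<partial>m)"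
    using i by (simp only: Bochner_Integration.integral_diff Bochner_Integration.integral_add Bochner_Integration.integral_minus
        Bochner_Integration.integral_sum integral_mult_right_zero Bochner_Integration.integrable_add Bochner_Integration.integrable_diff
        Bochner_Integration.integrable_sum Bochner_Integration.integrable_minus integrable_mult_right)
  finally have "\<nu> * (- (\<Sum>j\<in>J. \<integral>x. f x * v j x \<partial>m)
      - (1 / q * (\<integral>x. f x \<partial>m) + 1 / q * (L * (\<integral>x. (u x - a x) * (u x - a x) \<partial>m))) - 1 / (real q)\<^sup>2 * (\<integral>x. f x \<partial>m))
      \<le> \<nu> * (\<integral>x. f x * (b x - 2 * u x * a x + (u x)\<^sup>2) \<partial>m)"
    using nu by (rule mult_left_mono)
  moreover have "(\<Sum>j\<in>J. \<nu> * (\<integral>x. f x * v j x \<partial>m)) \<le> real (card J) * ((\<nu> * s * (\<integral>x. f x * f x \<partial>m) + (8 * (real M)\<^sup>2 + 2) * \<eta> / s) / 2)"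
    using fv by (rule sum_bounded_above)
  moreover have "card J = 2 * M * q + 1" by (simp add: J_def)
  moreover have "\<nu> * (- (\<Sum>j\<in>J. \<integral>x. f x * v j x \<partial>m)
      - (1 / q * (\<integral>x. f x \<partial>m) + 1 / q * (L * (\<integral>x. (u x - a x) * (u x - a x) \<partial>m))) - 1 / (real q)\<^sup>2 * (\<integral>x. f x \<partial>m))
    = - (\<Sum>j\<in>J. \<nu> * (\<integral>x. f x * v j x \<partial>m)) - (\<nu> / q * ((\<integral>x. f x \<partial>m) + L * (\<integral>x. (u x - a x) * (u x - a x) \<partial>m)) + \<nu> / (real q)\<^sup>2 * (\<integral>x. f x \<partial>m))"
    unfolding sum_distrib_left[symmetric] by (simp add: algebra_simps)
  ultimately show ?thesis by (simp only:)
qed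

end

context closable_form
begin

lemma square_mem: "u \<in> A \<Longrightarrow> (\<lambda>x. (u x)\<^sup>2) \<in> A"
  using mult[of u u] by (simp add: power2_eq_square)

text \<open>Here \<open>w n\<close> stands for the resolvent \<open>n * R_n g\<close>, the would-be
  minimiser of \<open>G w w + n * \<integral> (w - g)^2\<close>. The conditions are the resolvent
  equation up to tolerance \<open>\<eta> n\<close>, the rate \<open>1 / n\<close> of squared
  \<open>L2\<close> convergence to \<open>g\<close>, and weak convergence in energy.\<close>

definition resolvent_seq where
  "resolvent_seq \<eta> g w \<longleftrightarrow> (\<forall>n. w n \<in> A) \<and>
    (\<forall>n. \<forall>v\<in>A. (G (w n) v + real n * (\<integral>x. (w n x - g x) * v x \<partial>m))\<^sup>2
        \<le> \<eta> n * (G v v + real n * (\<integral>x. v x * v x \<partial>m))) \<and>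
    (\<forall>n. real n * (\<integral>x. (g x - w n x) * (g x - w n x) \<partial>m) \<le> G g g + 1) \<and>
    (\<forall>v\<in>A. (\<lambda>n. G (w n) v) \<longlonglongrightarrow> G g v)"

lemma resolvent_seqD:
  assumes "resolvent_seq \<eta> g w"
  shows "w n \<in> A"
    "v \<in> A \<Longrightarrow> (G (w n) v + real n * (\<integral>x. (w n x - g x) * v x \<partial>m))\<^sup>2
        \<le> \<eta> n * (G v v + real n * (\<integral>x. v x * v x \<partial>m))"
    "real n * (\<integral>x. (g x - w n x) * (g x - w n x) \<partial>m) \<le> G g g + 1"
    "v \<in> A \<Longrightarrow> (\<lambda>n. G (w n) v) \<longlonglongrightarrow> G g v"
  using assms by (simp_all add: resolvent_seq_def)

text \<open>The competitor \<open>g\<close> itself bounds every infimum by \<open>G g g\<close>,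
  which forces the \<open>L2\<close> distance to 0. Together with the Cauchy property in energy,
  closability then gives convergence in energy.\<close>

lemma resolvent_seq_exists:
  assumes g: "g \<in> A" and eta: "\<And>n. 0 < \<eta> n" "\<And>n. \<eta> n \<le> 1" "\<eta> \<longlonglongrightarrow> 0"
  shows "\<exists>w. resolvent_seq \<eta> g w"
proof -
  have "\<exists>w\<in>A. G w w + real n * (\<integral>x. (w x - g x) * (w x - g x) \<partial>m) \<le> G g g" for n
    using g by (intro bexI[of _ g]) auto
  from near_minimizers[OF CcD[OF g] this eta(1,3)]
  obtain w where w: "\<And>n. w n \<in> A"
    "\<And>n v. v \<in> A \<Longrightarrow> (G (w n) v + real n * (\<integral>x. (w n x - g x) * v x \<partial>m))\<^sup>2
        \<le> \<eta> n * (G v v + real n * (\<integral>x. v x * v x \<partial>m))"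
    "\<And>n. G (w n) (w n) + real n * (\<integral>x. (w n x - g x) * (w n x - g x) \<partial>m) \<le> G g g + \<eta> n"
    "\<And>e. e > 0 \<Longrightarrow> \<exists>N. \<forall>i\<ge>N. \<forall>j\<ge>N. G (\<lambda>x. w i x - w j x) (\<lambda>x. w i x - w j x) < e"
    by blast
  have b: "real n * (\<integral>x. (w n x - g x) * (w n x - g x) \<partial>m) \<le> G g g + 1" for n
    using w(3)[of n] G.B_nonneg[OF w(1)[of n]] eta(2)[of n] by linarith
  have "(\<lambda>n. \<integral>x. (w n x - g x) * (w n x - g x) \<partial>m) \<longlonglongrightarrow> 0"
  proof (rule tendsto_sandwich[of "\<lambda>_. 0" _ _ "\<lambda>n. (G g g + 1) / real n"])
    show "\<forall>\<^sub>F n in sequentially. (\<integral>x. (w n x - g x) * (w n x - g x) \<partial>m) \<le> (G g g + 1) / real n"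
      using eventually_gt_at_top[of 0]
    proof eventually_elim
      case (elim n)
      then show ?case using b[of n] by (simp add: field_simps)
    qed
    show "(\<lambda>n. (G g g + 1) / real n) \<longlonglongrightarrow> 0" by (rule lim_const_over_n)
  qed auto
  then have cl: "(\<lambda>n. G (\<lambda>x. w n x - g x) (\<lambda>x. w n x - g x)) \<longlonglongrightarrow> 0"
    using closable[OF w(1) g w(4)] by blast
  have "(\<lambda>n. G (w n) v) \<longlonglongrightarrow> G g v" if v: "v \<in> A" for v
  proof -
    have "(\<lambda>n. G (\<lambda>x. w n x - g x) (\<lambda>x. w n x - g x) * G v v) \<longlonglongrightarrow> 0 * G v v"
      by (intro tendsto_mult cl tendsto_const)
    then have lim: "(\<lambda>n. G (\<lambda>x. w n x - g x) (\<lambda>x. w n x - g x) * G v v) \<longlonglongrightarrow> 0" by simp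
    have "(\<lambda>n. (G (\<lambda>x. w n x - g x) v)\<^sup>2) \<longlonglongrightarrow> 0"
      by (rule tendsto_sandwich[OF _ _ tendsto_const lim])
        (auto intro!: always_eventually G.Cauchy_Schwarz diff w g v)
    then have "(\<lambda>n. G (\<lambda>x. w n x - g x) v) \<longlonglongrightarrow> 0"
      using tendsto_real_sqrt[of "\<lambda>n. (G (\<lambda>x. w n x - g x) v)\<^sup>2" 0 sequentially] by (simp add: tendsto_rabs_zero_iff)
    then have "(\<lambda>n. G (w n) v - G g v) \<longlonglongrightarrow> 0" using w g v by (simp only: G.B_diff)
    then show ?thesis by (simp only: LIM_zero_iff)
  qed
  moreover have "real n * (\<integral>x. (g x - w n x) * (g x - w n x) \<partial>m) \<le> G g g + 1" for n
  proof -
    have "(\<integral>x. (g x - w n x) * (g x - w n x) \<partial>m) = (\<integral>x. (w n x - g x) * (w n x - g x) \<partial>m)"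
      by (rule Bochner_Integration.integral_cong) (simp_all add: algebra_simps)
    then show ?thesis using b[of n] by simp
  qed
  ultimately show ?thesis unfolding resolvent_seq_def using w(1,2) by (intro exI[of _ w]) simp
qed

text \<open>Up to residuals, \<open>2 * G a (u * f) - G b f\<close> equals
  \<open>n * \<integral> f * (b - 2 * u * a + u^2)\<close> for the approximate resolvents
  \<open>a\<close>, \<open>b\<close> of \<open>u\<close>, \<open>u\<^sup>2\<close>. Jensen's
  inequality makes this at least \<open>- C / (n + 1)\<close>, and weak convergence in energy passes
  the bound to the limit.\<close>

lemma energy_nonneg:
  assumes u: "u \<in> A" and f: "f \<in> A" "\<And>x. f x \<ge> 0"
  shows "0 \<le> 2 * G (\<lambda>x. u x * f x) u - G (\<lambda>x. (u x)\<^sup>2) f"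
proof -
  \<comment> \<open>With mesh \<open>1 / (n + 1)\<^sup>2\<close> and \<open>s = 1 / (n + 1)^4\<close> below, the exponent 7 makes every error \<open>O(1 / n)\<close>.\<close>
  define \<eta> where "\<eta> n = 1 / (real (n + 1))^7" for n
  have eta: "0 < \<eta> n" "\<eta> n \<le> 1" for n by (auto simp: \<eta>_def divide_le_eq_1)
  have "(\<lambda>n. (1 / real (Suc n))^7) \<longlonglongrightarrow> 0^7" by (intro tendsto_power lim_inverse_n'[THEN LIMSEQ_Suc])
  then have etalim: "\<eta> \<longlonglongrightarrow> 0" by (simp add: \<eta>_def[abs_def] power_divide)
  note uf = mult[OF u f(1)] and u2 = square_mem[OF u]
  obtain a where "resolvent_seq \<eta> u a" using resolvent_seq_exists[OF u eta etalim] by blast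
  note a = resolvent_seqD[OF this]
  obtain b where "resolvent_seq \<eta> (\<lambda>x. (u x)\<^sup>2) b" using resolvent_seq_exists[OF u2 eta etalim] by blast
  note b = resolvent_seqD[OF this]
  obtain M0 where M0: "M0 > 0" "\<And>x. \<bar>u x\<bar> \<le> M0" using Cc_bounded[OF CcD[OF u]] by blast
  obtain M :: nat where M: "M0 < real M" using reals_Archimedean2 by blast
  have uM: "\<bar>u x\<bar> \<le> real M" for x using M0(2)[of x] M by linarith
  have M1: "1 \<le> M" using M M0(1) by (cases M) auto
  obtain L where L: "L > 0" "\<And>x. \<bar>f x\<bar> \<le> L" using Cc_bounded[OF CcD[OF f(1)]] by blast
  have fL: "f x \<le> L" for x using L(2)[of x] by linarith
  define If where "If = (\<integral>x. f x \<partial>m)"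
  define If2 where "If2 = (\<integral>x. f x * f x \<partial>m)"
  define Cuf where "Cuf = G (\<lambda>x. u x * f x) (\<lambda>x. u x * f x) + (\<integral>x. (u x * f x) * (u x * f x) \<partial>m)"
  define Cf where "Cf = G f f + If2"
  define K where "K = 8 * (real M)\<^sup>2 + 2"
  have nn: "0 \<le> If" "0 \<le> If2" "0 \<le> Cuf" "0 \<le> Cf" "0 \<le> K"
    using f G.B_nonneg[OF uf] G.B_nonneg[OF f(1)] by (auto simp: If_def If2_def Cuf_def Cf_def K_def)
  define C where "C = 2 * real M * (If2 + K) + (If + L * (G u u + 1)) + If + (Cuf + 1) + (Cf + 1)"
  define X where "X n = 2 * G (a n) (\<lambda>x. u x * f x) - G (b n) f" for n
  have main: "- (C / real (n + 1)) \<le> X n" for n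
  proof -
    define p where "p = real (n + 1)"
    have p: "p \<ge> 1" "real n \<le> p" "0 < p" by (auto simp: p_def)
    have eta_p: "\<eta> n = 1 / p^7" by (simp add: \<eta>_def p_def)
    \<comment> \<open>From \<open>R\<^sup>2 \<le> c / p\<^sup>2\<close> via
      \<open>2 * \<bar>R\<bar> \<le> p * R\<^sup>2 + 1 / p\<close>, which keeps square roots out of
      the constant \<open>C\<close>.\<close>
    have r: "\<bar>R\<bar> \<le> (c + 1) / (2 * p)" if "R\<^sup>2 \<le> \<eta> n * (g + real n * i)" "0 \<le> g" "0 \<le> i" "c = g + i" for R g i c :: real
    proof -
      have "g + real n * i \<le> p * g + p * i"
        using that p by (intro add_mono mult_right_mono) (auto simp: mult_le_cancel_right1)
      then have "\<eta> n * (g + real n * i) \<le> \<eta> n * (p * c)"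
        using eta(1)[of n] that(4) by (intro mult_left_mono) (auto simp: algebra_simps)
      also have "\<dots> = c / p^6" using p by (simp add: eta_p field_simps power_Suc[symmetric] del: power_Suc)
      also have "\<dots> \<le> c / p^2" using p that by (intro divide_left_mono power_increasing) auto
      finally have "R\<^sup>2 \<le> c / p\<^sup>2" using that(1) by linarith
      then have "p * R\<^sup>2 \<le> p * (c / p\<^sup>2)" using p by (intro mult_left_mono) auto
      then have pR: "p * R\<^sup>2 \<le> c / p" using p by (simp add: power2_eq_square)
      have "0 \<le> p * (\<bar>R\<bar> - 1 / p)\<^sup>2" using p by simp
      also have "\<dots> = p * R\<^sup>2 - 2 * \<bar>R\<bar> + 1 / p"
        using p by (simp add: power2_diff power_divide field_simps) (simp add: power2_eq_square)
      finally have "2 * \<bar>R\<bar> \<le> c / p + 1 / p" using pR by linarith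
      then show ?thesis using p by (simp add: field_simps)
    qed
    define R1 where "R1 = G (a n) (\<lambda>x. u x * f x) + real n * (\<integral>x. (a n x - u x) * (u x * f x) \<partial>m)"
    define R2 where "R2 = G (b n) f + real n * (\<integral>x. (b n x - (u x)\<^sup>2) * f x \<partial>m)"
    have R1: "\<bar>R1\<bar> \<le> (Cuf + 1) / (2 * p)"
      by (rule r[OF a(2)[OF uf, of n, folded R1_def]]) (use G.B_nonneg[OF uf] in \<open>auto simp: Cuf_def\<close>)
    have R2: "\<bar>R2\<bar> \<le> (Cf + 1) / (2 * p)"
      by (rule r[OF b(2)[OF f(1), of n, folded R2_def]]) (use G.B_nonneg[OF f(1)] in \<open>auto simp: Cf_def If2_def\<close>)
    define q :: nat where "q = (n + 1)^2"
    have q: "real q = p\<^sup>2" "0 < q" by (simp_all add: q_def p_def)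
    have s: "0 < 1 / p^4" using p by simp
    let ?Iu = "\<integral>x. (u x - a n x) * (u x - a n x) \<partial>m"
    have J: "- (real (2 * M * q + 1) * ((real n * (1 / p^4) * If2 + K * \<eta> n / (1 / p^4)) / 2)
      + real n / q * (If + L * ?Iu) + real n / (real q)\<^sup>2 * If)
      \<le> real n * (\<integral>x. f x * (b n x - 2 * u x * a n x + (u x)\<^sup>2) \<partial>m)"
      unfolding If_def If2_def K_def
      by (rule resolvent_Jensen[OF a(1) b(1) u f(1) _ _ a(2) b(2) uM f(2) fL q(2) s]) (use eta[of n] in auto)
    have "(\<integral>x. f x * (b n x - 2 * u x * a n x + (u x)\<^sup>2) \<partial>m) =
        (\<integral>x. (b n x - (u x)\<^sup>2) * f x - 2 * ((a n x - u x) * (u x * f x)) \<partial>m)"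
      by (rule Bochner_Integration.integral_cong) (auto simp: power2_eq_square algebra_simps)
    also have "\<dots> = (\<integral>x. (b n x - (u x)\<^sup>2) * f x \<partial>m) - 2 * (\<integral>x. (a n x - u x) * (u x * f x) \<partial>m)"
    proof -
      have "integrable m (\<lambda>x. (b n x - (u x)\<^sup>2) * f x)" "integrable m (\<lambda>x. (a n x - u x) * (u x * f x))"
        using a(1)[of n] b(1)[of n] u f(1) by (auto intro!: Cc_intros intro: CcD)
      then show ?thesis by (subst Bochner_Integration.integral_diff) auto
    qed
    \<comment> \<open>The two resolvent equations exchange energies for penalty integrals:
      \<open>(b - u^2) - 2 * u * (a - u)\<close> is the Jensen expression
      \<open>b - 2 * u * a + u^2\<close>.\<close>
    finally have X: "X n = 2 * R1 - R2 + real n * (\<integral>x. f x * (b n x - 2 * u x * a n x + (u x)\<^sup>2) \<partial>m)"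
      unfolding X_def R1_def R2_def by (simp only: right_diff_distrib distrib_left mult_ac)
    \<comment> \<open>The grid has \<open>O(p\<^sup>2)\<close> points. With
      \<open>s = 1 / p^4\<close>, each point costs \<open>O(1 / p^3)\<close>: \<open>p * s\<close>
      from the \<open>f\<close> term and \<open>\<eta> / s = p^4 / p^7\<close> from the
      violation.\<close>
    have e1: "real (2 * M * q + 1) * ((real n * (1 / p^4) * If2 + K * \<eta> n / (1 / p^4)) / 2) \<le> 2 * real M * (If2 + K) / p"
    proof -
      have "real (2 * M * q + 1) \<le> 4 * real M * p\<^sup>2"
      proof -
        have "1 * 1 \<le> real M * p\<^sup>2" using M1 p by (intro mult_mono) auto
        then show ?thesis by (simp add: q(1))
      qed
      moreover have "real n * (1 / p^4) * If2 + K * \<eta> n / (1 / p^4) \<le> (If2 + K) / p^3"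
      proof -
        have "real n * (1 / p^4) * If2 \<le> p * (1 / p^4) * If2"
          using p nn by (intro mult_right_mono) auto
        also have "\<dots> = If2 / p^3" using p by (simp add: field_simps power_Suc[symmetric] del: power_Suc)
        finally have "real n * (1 / p^4) * If2 \<le> If2 / p^3" .
        moreover have "K * \<eta> n / (1 / p^4) = K / p^3"
          using p by (simp add: eta_p field_simps power_add[symmetric])
        ultimately show ?thesis by (simp add: add_divide_distrib)
      qed
      moreover have "0 \<le> real n * (1 / p^4) * If2 + K * \<eta> n / (1 / p^4)"
        using nn p eta(1)[of n] by (intro add_nonneg_nonneg mult_nonneg_nonneg divide_nonneg_nonneg) auto
      ultimately have "real (2 * M * q + 1) * ((real n * (1 / p^4) * If2 + K * \<eta> n / (1 / p^4)) / 2)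
          \<le> 4 * real M * p\<^sup>2 * ((If2 + K) / p^3 / 2)"
        using p by (intro mult_mono divide_right_mono) auto
      also have "\<dots> = 2 * real M * (If2 + K) / p" using p by (simp add: field_simps power2_eq_square power3_eq_cube)
      finally show ?thesis .
    qed
    have e2: "real n / q * (If + L * ?Iu) \<le> (If + L * (G u u + 1)) / p"
    proof -
      have "real n * (If + L * ?Iu) = real n * If + L * (real n * ?Iu)" by (simp add: algebra_simps)
      also have "\<dots> \<le> p * If + L * (G u u + 1)"
        using p nn L a(3)[of n] by (intro add_mono mult_right_mono mult_left_mono) auto
      also have "\<dots> \<le> p * If + p * (L * (G u u + 1))"
        using p mult_right_mono[of 1 p "L * (G u u + 1)"] L(1) G.B_nonneg[OF u] by simp
      finally have "real n * (If + L * ?Iu) / p\<^sup>2 \<le> p * (If + L * (G u u + 1)) / p\<^sup>2"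
        by (intro divide_right_mono) (auto simp: algebra_simps)
      then show ?thesis using p by (simp add: q(1) power2_eq_square)
    qed
    have e3: "real n / (real q)\<^sup>2 * If \<le> If / p"
    proof -
      have "real n / (real q)\<^sup>2 \<le> p / p\<^sup>2"
        unfolding q(1) using p by (intro frac_le) (auto intro: power_increasing simp: power_mult[symmetric])
      also have "\<dots> = 1 / p" using p by (simp add: power2_eq_square)
      finally show ?thesis using nn mult_right_mono[of "real n / (real q)\<^sup>2" "1 / p" If] by simp
    qed
    have "- (C / p) = - (2 * real M * (If2 + K) / p + (If + L * (G u u + 1)) / p + If / p) - 2 * ((Cuf + 1) / (2 * p)) - 2 * ((Cf + 1) / (2 * p))"
      using p by (simp add: C_def field_simps)
    also have "\<dots> \<le> X n"
      using J e1 e2 e3 R1 R2 nn p unfolding X by (smt (verit) divide_nonneg_pos)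
    finally show ?thesis by (simp add: p_def)
  qed
  have "X \<longlonglongrightarrow> 2 * G u (\<lambda>x. u x * f x) - G (\<lambda>x. (u x)\<^sup>2) f"
    unfolding X_def[abs_def] by (intro tendsto_intros a(4) b(4) uf f)
  moreover have "(\<lambda>n. - (C / real (n + 1))) \<longlonglongrightarrow> - 0"
    using LIMSEQ_ignore_initial_segment[OF lim_const_over_n[of C], of 1] by (intro tendsto_minus)
  ultimately have "- 0 \<le> 2 * G u (\<lambda>x. u x * f x) - G (\<lambda>x. (u x)\<^sup>2) f"
    by (intro LIMSEQ_le[of "\<lambda>n. - (C / real (n + 1))" _ X]) (use main in auto)
  then show ?thesis using G.B_sym[OF uf u] by simp
qed

end

section \<open>Representation of positive functionals\<close>

text \<open>Closed below and open above, so that slabs behave like half-open intervals: a difference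
  of two slabs is a disjoint union of two slabs.\<close>

definition slab :: "('a \<Rightarrow> real) \<Rightarrow> ('a \<Rightarrow> real) \<Rightarrow> ('a \<times> real) set" where
  "slab f g = {(x, t). f x \<le> t \<and> t < g x}"

lemma mem_slab: "(x, t) \<in> slab f g \<longleftrightarrow> f x \<le> t \<and> t < g x"
  by (simp add: slab_def)

text \<open>Recovers \<open>g - f\<close> from the set alone, so that the premeasure
  \<open>L (fibre_length S)\<close> does not depend on how \<open>S\<close> is written as a
  slab.\<close>

definition fibre_length :: "('a \<times> real) set \<Rightarrow> 'a \<Rightarrow> real" where
  "fibre_length S x = measure lborel {t. (x, t) \<in> S}"

lemma fibre_slab: "{t. (x, t) \<in> slab f g} = {f x..<g x}"
  by (auto simp: mem_slab)

lemma fibre_length_slab: "(\<And>x. f x \<le> g x) \<Longrightarrow> fibre_length (slab f g) = (\<lambda>x. g x - f x)"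
  by (auto simp: fibre_length_def fibre_slab)

locale positive_functional = core A for A :: "('a::{metric_space, second_countable_topology} \<Rightarrow> real) set" +
  fixes L :: "('a \<Rightarrow> real) \<Rightarrow> real"
  assumes L_add: "u \<in> A \<Longrightarrow> v \<in> A \<Longrightarrow> L (\<lambda>x. u x + v x) = L u + L v"
    and L_cmult: "u \<in> A \<Longrightarrow> L (\<lambda>x. c * u x) = c * L u"
    and L_nonneg: "u \<in> A \<Longrightarrow> (\<And>x. 0 \<le> u x) \<Longrightarrow> 0 \<le> L u"
begin

lemma L_diff: "u \<in> A \<Longrightarrow> v \<in> A \<Longrightarrow> L (\<lambda>x. u x - v x) = L u - L v"
  using L_add[OF _ cmult[of v "-1"], of u] L_cmult[of v "-1"] by simp

lemma L_zero: "L (\<lambda>x. 0) = 0"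
  using L_cmult[OF zero, of 0] by simp

lemma L_sum: "finite I \<Longrightarrow> (\<And>i. i \<in> I \<Longrightarrow> u i \<in> A) \<Longrightarrow> L (\<lambda>x. \<Sum>i\<in>I. u i x) = (\<Sum>i\<in>I. L (u i))"
  by (induction I rule: finite_induct) (auto simp: L_zero L_add sum)

lemma L_mono: "u \<in> A \<Longrightarrow> v \<in> A \<Longrightarrow> (\<And>x. u x \<le> v x) \<Longrightarrow> L u \<le> L v"
  using L_nonneg[OF diff[of v u]] L_diff[of v u] by simp

text \<open>Dini's theorem: all \<open>r n\<close> vanish outside the compact support of
  \<open>r 0\<close>, so monotone pointwise convergence is uniform there. A cutoff \<open>k\<close>
  equal to 1 on that support turns the uniform bound into \<open>r n \<le> d * k\<close>, to which
  positivity of \<open>L\<close> applies.\<close>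

lemma L_decreasing:
  assumes r: "\<And>n. r n \<in> A" "\<And>n x. 0 \<le> r n x" "\<And>n x. r (Suc n) x \<le> r n x" "\<And>x. (\<lambda>n. r n x) \<longlonglongrightarrow> 0"
  shows "(\<lambda>n. L (r n)) \<longlonglongrightarrow> 0"
proof -
  let ?K = "closure {x. r 0 x \<noteq> 0}"
  have K: "compact ?K" using Cc_D(2)[OF CcD[OF r(1)]] .
  obtain k W where k: "k \<in> A" "\<And>x. 0 \<le> k x" "\<And>x. k x \<le> 1" "?K \<subseteq> W" "\<And>x. x \<in> W \<Longrightarrow> k x = 1"
    using bump[OF K, of UNIV] by (metis open_UNIV top_greatest)
  have dec: "r j x \<le> r i x" if "i \<le> j" for i j x
    using that r(3) by (induction rule: dec_induct) (auto intro: order_trans)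
  have Lk: "0 \<le> L k" using k by (intro L_nonneg)
  show ?thesis
  proof (rule LIMSEQ_I)
    fix e :: real assume e: "0 < e"
    define d where "d = e / (L k + 1)"
    have d: "d > 0" using e Lk by (simp add: d_def)
    have op: "open {x. r n x < d}" for n using cont[OF r(1)] by (intro open_Collect_less) auto
    have cov: "?K \<subseteq> (\<Union>n. {x. r n x < d})"
    proof
      fix x
      have "\<forall>\<^sub>F n in sequentially. r n x < d" using order_tendstoD(2)[OF r(4) d] .
      then show "x \<in> (\<Union>n. {x. r n x < d})" by (auto dest: eventually_happens)
    qed
    obtain D where D: "finite D" "?K \<subseteq> (\<Union>n\<in>D. {x. r n x < d})"
      using compactE_image[OF K, of UNIV "\<lambda>n. {x. r n x < d}"] op cov by auto
    obtain N where N: "\<And>i. i \<in> D \<Longrightarrow> i \<le> N" using D(1) finite_nat_set_iff_bounded_le by auto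
    have "norm (L (r n) - 0) < e" if n: "n \<ge> N" for n
    proof -
      have "r n x \<le> d * k x" for x
      proof (cases "r 0 x = 0")
        case True
        then have "r n x = 0" using dec[of 0 n x] r(2)[of n x] by simp
        then show ?thesis using d k(2) by simp
      next
        case False
        then have "x \<in> ?K" using Cc_supp[of "r 0" x] by blast
        then obtain i where "i \<in> D" "r i x < d" using D by auto
        then have "r n x < d" using dec[of i n x] N n by (meson le_trans order.strict_trans1)
        moreover have "k x = 1" using \<open>x \<in> ?K\<close> k by blast
        ultimately show ?thesis by simp
      qed
      then have "L (r n) \<le> L (\<lambda>x. d * k x)" using r k by (intro L_mono cmult)
      also have "\<dots> = d * L k" using k by (simp add: L_cmult)
      also have "\<dots> < d * (L k + 1)" using d by simp
      also have "\<dots> = e" using Lk by (simp add: d_def)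
      finally show ?thesis using L_nonneg[OF r(1) r(2)] by simp
    qed
    then show "\<exists>N. \<forall>n\<ge>N. norm (L (r n) - 0) < e" by blast
  qed
qed

definition slabs :: "('a \<times> real) set set" where
  "slabs = {slab f g |f g. f \<in> A \<and> g \<in> A \<and> (\<forall>x. f x \<le> g x)}"

lemma slabsI: "f \<in> A \<Longrightarrow> g \<in> A \<Longrightarrow> (\<And>x. f x \<le> g x) \<Longrightarrow> slab f g \<in> slabs"
  by (auto simp: slabs_def)

lemma semiring_slabs: "semiring_of_sets UNIV slabs"
proof
  have "slab (\<lambda>x. 0) (\<lambda>x. 0) = ({} :: ('a \<times> real) set)" by (auto simp: slab_def)
  then show "{} \<in> slabs" using slabsI[OF zero zero] by simp
next
  fix a b assume "a \<in> slabs" "b \<in> slabs"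
  then obtain f g f' g' where a: "a = slab f g" "f \<in> A" "g \<in> A" "\<And>x. f x \<le> g x"
    and b: "b = slab f' g'" "f' \<in> A" "g' \<in> A" "\<And>x. f' x \<le> g' x" by (auto simp: slabs_def)
  \<comment> \<open>The outer \<open>max\<close> keeps the upper graph above the lower one; over
    points where the fibres do not meet, the slab degenerates to an empty fibre.\<close>
  have "a \<inter> b = slab (\<lambda>x. max (f x) (f' x)) (\<lambda>x. max (max (f x) (f' x)) (min (g x) (g' x)))"
    unfolding a b by (auto simp: slab_def)
  also have "\<dots> \<in> slabs" by (intro slabsI max min a b) auto
  finally show "a \<inter> b \<in> slabs" .
  \<comment> \<open>The part of \<open>a\<close> below \<open>b\<close> and the part of
    \<open>a\<close> above \<open>b\<close>.\<close>
  let ?C1 = "slab f (\<lambda>x. max (f x) (min (g x) (f' x)))"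
    and ?C2 = "slab (\<lambda>x. max (f x) (g' x)) (\<lambda>x. max (max (f x) (g' x)) (g x))"
  have "?C1 \<in> slabs" "?C2 \<in> slabs" by (intro slabsI max min a b; simp)+
  moreover have "a - b = \<Union>{?C1, ?C2}" unfolding a b by (auto simp: slab_def)
  moreover have "?C1 \<inter> ?C2 = {}"
  proof -
    have False if "p \<in> ?C1" "p \<in> ?C2" for p
      using that b(4)[of "fst p"] by (cases p) (auto simp: mem_slab)
    then show ?thesis by blast
  qed
  then have "disjoint {?C1, ?C2}" by (auto simp: disjoint_def)
  ultimately show "\<exists>C\<subseteq>slabs. finite C \<and> disjoint C \<and> a - b = \<Union>C"
    by (intro exI[of _ "{?C1, ?C2}"]) auto
qed auto

text \<open>Countable additivity holds on each fibre by that of Lebesgue measure. The remainders are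
  therefore functions of the core decreasing pointwise to 0, and \<open>L_decreasing\<close> carries
  this over to \<open>L\<close>.\<close>

lemma slab_premeasure:
  "positive slabs (\<lambda>S. ennreal (L (fibre_length S)))"
  "countably_additive slabs (\<lambda>S. ennreal (L (fibre_length S)))"
proof -
  have "fibre_length ({} :: ('a \<times> real) set) = (\<lambda>x. 0)" by (auto simp: fibre_length_def)
  then show "positive slabs (\<lambda>S. ennreal (L (fibre_length S)))"
    by (simp add: positive_def L_zero)
  show "countably_additive slabs (\<lambda>S. ennreal (L (fibre_length S)))"
    unfolding countably_additive_def
  proof (intro allI impI)
    fix S :: "nat \<Rightarrow> ('a \<times> real) set"
    assume S: "range S \<subseteq> slabs" "disjoint_family S" "(\<Union>i. S i) \<in> slabs"
    have "\<exists>f g. S i = slab f g \<and> f \<in> A \<and> g \<in> A \<and> (\<forall>x. f x \<le> g x)" for i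
      using S(1) unfolding slabs_def by blast
    then obtain f g where fg: "\<And>i. S i = slab (f i) (g i)" "\<And>i. f i \<in> A" "\<And>i. g i \<in> A" "\<And>i x. f i x \<le> g i x"
      by metis
    obtain f' g' where fg': "(\<Union>i. S i) = slab f' g'" "f' \<in> A" "g' \<in> A" "\<And>x. f' x \<le> g' x"
      using S(3) unfolding slabs_def by blast
    let ?d = "\<lambda>i x. g i x - f i x" and ?D = "\<lambda>x. g' x - f' x"
    have d: "fibre_length (S i) = ?d i" for i unfolding fg(1) by (rule fibre_length_slab[OF fg(4)])
    have D: "fibre_length (\<Union>i. S i) = ?D" unfolding fg'(1) by (rule fibre_length_slab[OF fg'(4)])
    have dA: "?d i \<in> A" for i using fg by (intro diff)
    have DA: "?D \<in> A" using fg' by (intro diff)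
    have sums: "(\<lambda>i. ?d i x) sums ?D x" for x
    proof -
      have "(\<lambda>i. measure lborel {t. (x, t) \<in> S i}) sums measure lborel (\<Union>i. {t. (x, t) \<in> S i})"
      proof (rule measure_UNION)
        show "range (\<lambda>i. {t. (x, t) \<in> S i}) \<subseteq> sets lborel" by (auto simp: fg(1) fibre_slab)
        show "disjoint_family (\<lambda>i. {t. (x, t) \<in> S i})"
          using S(2) unfolding disjoint_family_on_def by blast
        have "(\<Union>i. {t. (x, t) \<in> S i}) = {t. (x, t) \<in> slab f' g'}" unfolding fg'(1)[symmetric] by auto
        then show "emeasure lborel (\<Union>i. {t. (x, t) \<in> S i}) \<noteq> \<infinity>"
          using fg'(4)[of x] by (simp add: fibre_slab)
      qed
      moreover have "(\<Union>i. {t. (x, t) \<in> S i}) = {t. (x, t) \<in> (\<Union>i. S i)}" by auto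
      ultimately have "(\<lambda>i. fibre_length (S i) x) sums fibre_length (\<Union>i. S i) x"
        by (simp add: fibre_length_def)
      then show ?thesis by (simp only: d D)
    qed
    define r where "r n x = ?D x - (\<Sum>i<n. ?d i x)" for n x
    have sA: "(\<lambda>x. \<Sum>i<n. ?d i x) \<in> A" for n using dA by (intro sum) auto
    have rA: "r n \<in> A" for n unfolding r_def[abs_def] by (intro diff[OF DA sA])
    have "(\<lambda>n. L (r n)) \<longlonglongrightarrow> 0"
    proof (rule L_decreasing[OF rA])
      show "0 \<le> r n x" for n x
      proof -
        have "(\<Sum>i<n. ?d i x) \<le> (\<Sum>i. ?d i x)"
          using sums_summable[OF sums[of x]] fg(4) by (intro sum_le_suminf) auto
        then show ?thesis using sums_unique[OF sums[of x]] by (simp add: r_def)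
      qed
      show "r (Suc n) x \<le> r n x" for n x using fg(4)[of n x] by (simp add: r_def)
      show "(\<lambda>n. r n x) \<longlonglongrightarrow> 0" for x
        using tendsto_diff[OF tendsto_const sums[of x, unfolded sums_def], of "?D x"] by (simp add: r_def)
    qed
    moreover have "L (r n) = L ?D - (\<Sum>i<n. L (?d i))" for n
      unfolding r_def[abs_def] using dA by (simp add: L_diff[OF DA sA] L_sum)
    ultimately have "(\<lambda>n. L ?D - (L ?D - (\<Sum>i<n. L (?d i)))) \<longlonglongrightarrow> L ?D - 0"
      by (intro tendsto_diff tendsto_const) simp
    then have "(\<lambda>i. L (?d i)) sums L ?D" by (simp add: sums_def)
    then have "(\<Sum>i. ennreal (L (?d i))) = ennreal (L ?D)"
      using L_nonneg[OF dA] fg(4) by (intro suminf_ennreal_eq) auto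
    then show "(\<Sum>i. ennreal (L (fibre_length (S i)))) = ennreal (L (fibre_length (\<Union>i. S i)))"
      unfolding d D .
  qed
qed

text \<open>The extended measure \<open>M\<close> on the product with the real line should be
  \<open>\<mu>\<close> times Lebesgue measure, so \<open>\<mu>\<close> is read off as its mass over
  the strip of heights \<open>[0, 1)\<close>. That \<open>\<mu>\<close> represents \<open>L\<close>
  then has to be checked, by slicing functions horizontally.\<close>

theorem representing_measure:
  obtains \<mu> where "radon_measure_on UNIV \<mu>" "\<And>f. f \<in> A \<Longrightarrow> (\<integral>x. f x \<partial>\<mu>) = L f"
proof -
  interpret S: semiring_of_sets UNIV slabs by (rule semiring_slabs)
  obtain \<mu>' where mu': "\<And>S. S \<in> slabs \<Longrightarrow> \<mu>' S = ennreal (L (fibre_length S))"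
    and ms: "measure_space UNIV (sigma_sets UNIV slabs) \<mu>'"
    using S.caratheodory[OF slab_premeasure] by blast
  define M where "M = measure_of UNIV (sigma_sets UNIV slabs) \<mu>'"
  have sa: "sigma_algebra UNIV (sigma_sets UNIV slabs)" by (rule sigma_algebra_sigma_sets) simp
  have sM: "sets M = sigma_sets UNIV slabs" unfolding M_def by (simp add: sigma_algebra.sets_measure_of_eq[OF sa])
  have spM: "space M = UNIV" unfolding M_def by (simp add: space_measure_of_conv)
  have slab_M: "slab f g \<in> sets M" if "f \<in> A" "g \<in> A" "\<And>x. f x \<le> g x" for f g
    unfolding sM using slabsI[OF that] by (rule sigma_sets.Basic)
  have eM: "emeasure M (slab f g) = ennreal (L (\<lambda>x. g x - f x))" if "f \<in> A" "g \<in> A" "\<And>x. f x \<le> g x" for f g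
  proof -
    have "emeasure M (slab f g) = \<mu>' (slab f g)"
      unfolding M_def using ms slab_M[OF that] sM
      by (intro emeasure_measure_of_sigma[OF sa]) (auto simp: measure_space_def)
    then show ?thesis using mu'[OF slabsI[OF that]] fibre_length_slab[of f g] that by simp
  qed
  \<comment> \<open>A half-open cylinder over an open set is a countable union of slabs under
    \<open>min (n * h) 1\<close>; fixing the heights to \<open>[0, 1)\<close> is what makes the
    truncation at 1 suffice.\<close>
  have cyl: "U \<times> {0..<1} \<in> sets M" if U: "open U" for U
  proof -
    obtain h :: "nat \<Rightarrow> 'a \<Rightarrow> real" where h: "\<And>n. h n \<in> A" "\<And>n x. h n x \<ge> 0" "U = (\<Union>n. {x. h n x > 0})"
      using open_cover[OF U] by metis
    let ?s = "\<lambda>i n. slab (\<lambda>x. 0) (\<lambda>x. min (max (real n * h i x) 0) 1)"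
    have "U \<times> {0..<1} = (\<Union>i. \<Union>n. ?s i n)"
    proof safe
      fix x and t :: real assume x: "x \<in> U" and t: "t \<in> {0..<1}"
      then obtain i where i: "h i x > 0" using h by auto
      have "(\<lambda>n. min (max (real n * h i x) 0) 1) \<longlonglongrightarrow> 1"
        using unit_seq_lim[OF h(2)[of i x]] i by (simp only: if_True)
      then have "\<forall>\<^sub>F n in sequentially. t < min (max (real n * h i x) 0) 1"
        using t by (intro order_tendstoD(1)) auto
      then obtain n where "t < min (max (real n * h i x) 0) 1" using eventually_happens[of _ sequentially] by auto
      then have "(x, t) \<in> ?s i n" using t by (simp add: mem_slab)
      then show "(x, t) \<in> (\<Union>i. \<Union>n. ?s i n)" by blast
    next
      fix x t i n assume s: "(x, t) \<in> ?s i n"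
      then have t: "0 \<le> t" "t < min (max (real n * h i x) 0) 1" unfolding mem_slab by auto
      then show "t \<in> {0..<1}" by simp
      from t have "h i x \<noteq> 0" by auto
      then have "h i x > 0" using h(2)[of i x] by simp
      then show "x \<in> U" using h by auto
    qed
    also have "\<dots> \<in> sets M" using slab_M[OF zero unit_n[OF h(1)]] by (intro sets.countable_UN) auto
    finally show ?thesis .
  qed
  define R where "R = restrict_space M (UNIV \<times> {0..<1})"
  define \<mu> where "\<mu> = distr R borel fst"
  have spR: "space R = UNIV \<times> {0..<1}" by (simp add: R_def space_restrict_space spM)
  have fst_R: "fst \<in> measurable R borel"
  proof (rule borel_measurableI)
    fix U :: "'a set" assume U: "open U"
    have "fst -` U \<inter> space R = U \<times> {0..<1}" unfolding spR by auto
    also have "\<dots> \<in> sets R"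
      unfolding R_def using cyl[OF U] cyl[OF open_UNIV] by (subst sets_restrict_space_iff) (auto simp: spM)
    finally show "fst -` U \<inter> space R \<in> sets R" .
  qed
  have sets_mu: "sets \<mu> = sets borel" and sp_mu: "space \<mu> = UNIV" by (simp_all add: \<mu>_def)
  have e_mu: "emeasure \<mu> B = emeasure M (B \<times> {0..<1})" if B: "B \<in> sets borel" for B
  proof -
    have eq: "fst -` B \<inter> space R = B \<times> {0..<1}" unfolding spR by auto
    have "emeasure \<mu> B = emeasure R (B \<times> {0..<1})" unfolding \<mu>_def eq[symmetric] by (rule emeasure_distr[OF fst_R B])
    also have "\<dots> = emeasure M (B \<times> {0..<1})"
      unfolding R_def using cyl[OF open_UNIV] by (intro emeasure_restrict_space) (auto simp: spM)
    finally show ?thesis .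
  qed
  have cyl_B: "B \<times> {0..<1} \<in> sets M" if B: "B \<in> sets borel" for B :: "'a set"
  proof -
    have "fst -` B \<inter> space R = B \<times> {0..<1}" unfolding spR by auto
    with measurable_sets[OF fst_R B] have "B \<times> {0..<1} \<in> sets R" by simp
    then show ?thesis unfolding R_def using cyl[OF open_UNIV] by (subst (asm) sets_restrict_space_iff) (auto simp: spM)
  qed
  \<comment> \<open>For \<open>0 \<le> g \<le> 1\<close>, the slab under \<open>g\<close> lies
    between the cylinders over \<open>{x. 1 \<le> g x}\<close> and
    \<open>{x. 0 < g x}\<close>.\<close>
  have lower: "emeasure \<mu> {x. 1 \<le> g x} \<le> ennreal (L g)"
    and upper: "ennreal (L g) \<le> emeasure \<mu> {x. 0 < g x}"
    if g: "g \<in> A" "\<And>x. 0 \<le> g x" "\<And>x. g x \<le> 1" for g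
  proof -
    have B: "{x. 1 \<le> g x} \<in> sets borel" "{x. 0 < g x} \<in> sets borel"
      by (rule borel_closed[OF closed_Collect_le[OF continuous_on_const cont[OF g(1)]]],
        rule borel_open[OF open_Collect_less[OF continuous_on_const cont[OF g(1)]]])
    have e: "emeasure M (slab (\<lambda>x. 0) g) = ennreal (L g)" using eM[OF zero g(1)] g(2) by simp
    have "emeasure M ({x. 1 \<le> g x} \<times> {0..<1}) \<le> emeasure M (slab (\<lambda>x. 0) g)"
      using slab_M[OF zero g(1)] g(2) by (intro emeasure_mono) (auto simp: mem_slab)
    then show "emeasure \<mu> {x. 1 \<le> g x} \<le> ennreal (L g)" by (simp add: e_mu B e)
    have "emeasure M (slab (\<lambda>x. 0) g) \<le> emeasure M ({x. 0 < g x} \<times> {0..<1})"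
      using cyl_B[OF B(2)] g(3) by (intro emeasure_mono) (force simp: slab_def intro: order.strict_trans2)+
    then show "ennreal (L g) \<le> emeasure \<mu> {x. 0 < g x}" by (simp add: e_mu B e)
  qed
  have radon: "radon_measure_on UNIV \<mu>"
    unfolding radon_measure_on_def
  proof (intro conjI allI impI)
    show "sets \<mu> = sets (restrict_space borel UNIV)" using sets_mu by (simp add: sets_restrict_space)
    fix K :: "'a set" assume "compact K \<and> K \<subseteq> UNIV"
    then obtain k W where k: "k \<in> A" "\<And>x. 0 \<le> k x" "\<And>x. k x \<le> 1" "K \<subseteq> W" "\<And>x. x \<in> W \<Longrightarrow> k x = 1"
      using bump[of K UNIV] by (metis open_UNIV)
    have "emeasure \<mu> K \<le> emeasure \<mu> {x. 1 \<le> k x}"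
      using k
        borel_closed[OF closed_Collect_le[OF continuous_on_const cont[OF k(1)], of 1]]
      by (intro emeasure_mono) (auto simp: sets_mu)
    also have "\<dots> \<le> ennreal (L k)" using lower[OF k(1-3)] .
    also have "\<dots> < \<infinity>" by simp
    finally show "emeasure \<mu> K < \<infinity>" .
  qed
  have fin: "emeasure \<mu> {x. c < f x} \<noteq> \<infinity>" if f: "f \<in> A" "c \<ge> 0" for f c
  proof -
    have "{x. c < f x} \<subseteq> closure {x. f x \<noteq> 0}" using f(2) by (intro order_trans[OF _ closure_subset]) auto
    then have "emeasure \<mu> {x. c < f x} \<le> emeasure \<mu> (closure {x. f x \<noteq> 0})"
      by (intro emeasure_mono) (auto simp: sets_mu)
    also have "\<dots> < \<infinity>" using radon_finite[OF radon Cc_D(2)[OF CcD[OF f(1)]]] .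
    finally show ?thesis by simp
  qed
  have int: "integrable \<mu> f" if "f \<in> A" for f using Cc_integrable[OF radon CcD[OF that]] .
  have main: "(\<integral>x. f x \<partial>\<mu>) = L f" if f: "f \<in> A" "\<And>x. 0 \<le> f x" for f
  proof -
    obtain K0 where K0: "K0 > 0" "\<And>x. \<bar>f x\<bar> \<le> K0" using Cc_bounded[OF CcD[OF f(1)]] by blast
    define a where "a c = measure \<mu> {x. c < f x}" for c
    have bd: "\<bar>L f - (\<integral>x. f x \<partial>\<mu>)\<bar> \<le> a 0 / real n" if n: "n > 0" for n :: nat
    proof -
      \<comment> \<open>Enough slices of height \<open>1 / n\<close> to exceed the maximum of
        \<open>f\<close>.\<close>
      obtain N :: nat where N: "K0 * real n < real N" using reals_Archimedean2 by blast
      \<comment> \<open>The \<open>i\<close>-th horizontal slice of \<open>f\<close>, rescaled to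
        height 1. Both \<open>L (g i)\<close> and the integral of \<open>g i\<close> lie between
        consecutive values of the distribution function \<open>a\<close>, so their differences
        telescope to at most \<open>a 0\<close>.\<close>
      define g where "g i x = real n * min (max (f x - real i / n) 0) (1 / n)" for i :: nat and x
      have gA: "g i \<in> A" for i
      proof -
        have "(\<lambda>x. max (f x - real i / n) 0) \<in> A" using f n by (intro above) auto
        from clip[OF this, of "1 / n"] have "(\<lambda>x. min (max (f x - real i / n) 0) (1 / n)) \<in> A" by simp
        then show ?thesis unfolding g_def[abs_def] by (rule cmult)
      qed
      have g01: "0 \<le> g i x" "g i x \<le> 1" for i x
      proof -
        show "0 \<le> g i x" by (simp add: g_def)
        have "g i x \<le> real n * (1 / n)" unfolding g_def by (intro mult_left_mono) auto
        then show "g i x \<le> 1" using n by simp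
      qed
      have gpos: "{x. 0 < g i x} = {x. real i / n < f x}" for i
        using n by (auto simp: g_def zero_less_mult_iff)
      have gone: "{x. real (Suc i) / n < f x} \<subseteq> {x. 1 \<le> g i x}" for i
      proof
        fix x assume "x \<in> {x. real (Suc i) / n < f x}"
        then have "1 / n \<le> f x - real i / n" by (simp add: add_divide_distrib)
        then have "min (max (f x - real i / n) 0) (1 / n) = 1 / n" by (simp add: min_absorb2 le_max_iff_disj)
        then show "x \<in> {x. 1 \<le> g i x}" using n by (simp add: g_def)
      qed
      have borel: "{x. c < f x} \<in> sets \<mu>" "{x. 1 \<le> g i x} \<in> sets \<mu>" for c i
        unfolding sets_mu
        by (rule borel_open[OF open_Collect_less[OF continuous_on_const cont[OF f(1)]]],
          rule borel_closed[OF closed_Collect_le[OF continuous_on_const cont[OF gA]]])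
      have em: "emeasure \<mu> {x. real i / n < f x} = ennreal (a (real i / n))" for i
        unfolding a_def using fin[OF f(1), of "real i / n"] by (intro emeasure_eq_ennreal_measure) auto
      have lo: "ennreal (a (real (Suc i) / n)) \<le> emeasure \<mu> {x. 1 \<le> g i x}" for i
        unfolding em[symmetric] by (intro emeasure_mono gone borel)
      have L1: "a (real (Suc i) / n) \<le> L (g i)" "L (g i) \<le> a (real i / n)" for i
      proof -
        have "ennreal (a (real (Suc i) / n)) \<le> ennreal (L (g i))"
          using lo[of i] lower[OF gA g01] by (rule order_trans)
        then show "a (real (Suc i) / n) \<le> L (g i)" using L_nonneg[OF gA g01(1)] by (simp add: ennreal_le_iff)
        have "ennreal (L (g i)) \<le> ennreal (a (real i / n))"
          using upper[OF gA g01, of i] unfolding gpos em .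
        then show "L (g i) \<le> a (real i / n)" by (simp add: ennreal_le_iff a_def)
      qed
      have I1: "a (real (Suc i) / n) \<le> (\<integral>x. g i x \<partial>\<mu>)" "(\<integral>x. g i x \<partial>\<mu>) \<le> a (real i / n)" for i
      proof -
        have s: "{x. real j / n < f x} \<in> sets \<mu>" "emeasure \<mu> {x. real j / n < f x} < \<infinity>" for j
          using borel em by auto
        have "(\<integral>x. indicator {x. real (Suc i) / n < f x} x \<partial>\<mu>) \<le> (\<integral>x. g i x \<partial>\<mu>)"
          using gone[of i] g01 by (intro integral_mono integrable_real_indicator s int gA) (auto simp: indicator_def)
        then show "a (real (Suc i) / n) \<le> (\<integral>x. g i x \<partial>\<mu>)" using s(1) sp_mu by (simp add: a_def)
        have "(\<integral>x. g i x \<partial>\<mu>) \<le> (\<integral>x. indicator {x. real i / n < f x} x \<partial>\<mu>)"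
        proof (intro integral_mono integrable_real_indicator s int gA)
          fix x
          show "g i x \<le> indicator {x. real i / n < f x} x"
            using g01[of i x] gpos[of i] by (cases "0 < g i x") (auto simp: indicator_def)
        qed
        then show "(\<integral>x. g i x \<partial>\<mu>) \<le> a (real i / n)" using s(1) sp_mu by (simp add: a_def)
      qed
      have "f x = (\<Sum>i<N. 1 / n * g i x)" for x
      proof -
        have "1 / n * g i x = min (f x) (real (Suc i) / n) - min (f x) (real i / n)" for i
        proof -
          have "1 / n * g i x = min (max (f x - real i / n) 0) (1 / n)" using n by (simp add: g_def)
          moreover have "real (Suc i) / n = real i / n + 1 / n" by (simp add: add_divide_distrib)
          moreover have "min (max (t - c) 0) d = min t (c + d) - min t c" if "0 \<le> d" for t c d :: real
            using that by (auto simp: min_def max_def)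
          ultimately show ?thesis by simp
        qed
        then have "(\<Sum>i<N. 1 / n * g i x) = min (f x) (real N / n) - min (f x) (real 0 / n)"
          by (simp only: sum_lessThan_telescope[of "\<lambda>i. min (f x) (real i / n)"])
        moreover have "f x \<le> real N / n"
        proof -
          have "f x * real n \<le> K0 * real n" using K0(2)[of x] by (intro mult_right_mono) auto
          with N have "f x * real n \<le> real N" by linarith
          then show ?thesis using n by (simp only: pos_le_divide_eq of_nat_0_less_iff)
        qed
        ultimately show ?thesis using f(2)[of x] by simp
      qed
      then have feq: "f = (\<lambda>x. \<Sum>i<N. 1 / n * g i x)" by (rule ext)
      have "L f = (\<Sum>i<N. L (\<lambda>x. 1 / n * g i x))" by (subst feq) (rule L_sum, simp, rule cmult, rule gA)
      also have "\<dots> = 1 / n * (\<Sum>i<N. L (g i))" by (simp only: L_cmult[OF gA] sum_distrib_left)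
      finally have Lf: "L f = 1 / n * (\<Sum>i<N. L (g i))" .
      have "(\<integral>x. f x \<partial>\<mu>) = (\<Sum>i<N. \<integral>x. 1 / n * g i x \<partial>\<mu>)"
        by (subst feq) (rule Bochner_Integration.integral_sum, rule integrable_mult_right, rule int, rule gA)
      also have "\<dots> = 1 / n * (\<Sum>i<N. \<integral>x. g i x \<partial>\<mu>)" by (simp only: integral_mult_right_zero sum_distrib_left)
      finally have If: "(\<integral>x. f x \<partial>\<mu>) = 1 / n * (\<Sum>i<N. \<integral>x. g i x \<partial>\<mu>)" .
      have abs_diff_le: "\<bar>y - z\<bar> \<le> b - c" if "c \<le> y" "y \<le> b" "c \<le> z" "z \<le> b" for y z b c :: real
        using that by linarith
      have "\<bar>(\<Sum>i<N. L (g i)) - (\<Sum>i<N. \<integral>x. g i x \<partial>\<mu>)\<bar> = \<bar>\<Sum>i<N. L (g i) - (\<integral>x. g i x \<partial>\<mu>)\<bar>"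
        by (simp add: sum_subtractf)
      also have "\<dots> \<le> (\<Sum>i<N. \<bar>L (g i) - (\<integral>x. g i x \<partial>\<mu>)\<bar>)" by (rule sum_abs)
      also have "\<dots> \<le> (\<Sum>i<N. a (real i / n) - a (real (Suc i) / n))"
        by (intro sum_mono abs_diff_le L1 I1)
      also have "\<dots> = a (real 0 / n) - a (real N / n)" by (rule sum_lessThan_telescope')
      also have "\<dots> \<le> a 0" by (simp add: a_def)
      finally have "\<bar>(\<Sum>i<N. L (g i)) - (\<Sum>i<N. \<integral>x. g i x \<partial>\<mu>)\<bar> / n \<le> a 0 / n" by (intro divide_right_mono) auto
      then show ?thesis unfolding Lf If by (simp add: diff_divide_distrib[symmetric])
    qed
    have "(\<lambda>n. a 0 / real n) \<longlonglongrightarrow> 0" by (rule lim_const_over_n)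
    moreover have "\<forall>\<^sub>F n in sequentially. \<bar>L f - (\<integral>x. f x \<partial>\<mu>)\<bar> \<le> a 0 / real n"
      using eventually_gt_at_top[of 0] by eventually_elim (rule bd)
    ultimately have "\<bar>L f - (\<integral>x. f x \<partial>\<mu>)\<bar> \<le> 0" by (intro tendsto_lowerbound) auto
    then show ?thesis by simp
  qed
  show thesis
  proof (rule that[OF radon])
    fix f assume f: "f \<in> A"
    let ?p = "\<lambda>x. max (f x) 0" and ?q = "\<lambda>x. max (- f x) 0"
    have pq: "?p \<in> A" "?q \<in> A" using f by (auto intro: pos_part uminus)
    have eq: "f = (\<lambda>x. ?p x - ?q x)" by auto
    have "(\<integral>x. f x \<partial>\<mu>) = (\<integral>x. ?p x \<partial>\<mu>) - (\<integral>x. ?q x \<partial>\<mu>)"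
      by (subst eq) (rule Bochner_Integration.integral_diff, rule int, rule pq(1), rule int, rule pq(2))
    also have "\<dots> = L ?p - L ?q" using main[OF pq(1)] main[OF pq(2)] by simp
    also have "\<dots> = L (\<lambda>x. ?p x - ?q x)" using L_diff[OF pq] by simp
    also have "\<dots> = L f" using eq by simp
    finally show "(\<integral>x. f x \<partial>\<mu>) = L f" .
  qed
qed

end

section \<open>Energy measures of regular Dirichlet forms\<close>

lemma L2_mult_integrable:
  assumes "f \<in> L2 m" "g \<in> L2 m"
  shows "integrable m (\<lambda>x. f x * g x)"
proof (rule Bochner_Integration.integrable_bound)
  show "integrable m (\<lambda>x. (f x)\<^sup>2 + (g x)\<^sup>2)" using assms by (auto simp: L2_def)
  show "(\<lambda>x. f x * g x) \<in> borel_measurable m" using assms by (auto simp: L2_def)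
  have "\<bar>a * b\<bar> \<le> a\<^sup>2 + b\<^sup>2" for a b :: real
  proof -
    have "0 \<le> (\<bar>a\<bar> - \<bar>b\<bar>)\<^sup>2" "0 \<le> \<bar>a * b\<bar>" by simp_all
    then show ?thesis unfolding power2_diff power2_abs abs_mult by linarith
  qed
  then show "AE x in m. norm (f x * g x) \<le> norm ((f x)\<^sup>2 + (g x)\<^sup>2)" by (intro AE_I2) (simp add: abs_of_nonneg)
qed

lemma L2_diff_integrable:
  assumes "f \<in> L2 m" "g \<in> L2 m"
  shows "integrable m (\<lambda>x. (f x - g x) * (f x - g x))"
proof -
  have "(\<lambda>x. (f x - g x) * (f x - g x)) = (\<lambda>x. f x * f x - 2 * (f x * g x) + g x * g x)"
    by (auto simp: algebra_simps)
  then show ?thesis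
    using L2_mult_integrable[OF assms(1) assms(1)] L2_mult_integrable[OF assms] L2_mult_integrable[OF assms(2) assms(2)]
    by simp
qed

lemma L2_triangle:
  assumes "f \<in> L2 m" "g \<in> L2 m" "h \<in> L2 m"
  shows "(\<integral>x. (f x - h x) * (f x - h x) \<partial>m)
    \<le> 2 * (\<integral>x. (f x - g x) * (f x - g x) \<partial>m) + 2 * (\<integral>x. (h x - g x) * (h x - g x) \<partial>m)"
proof -
  note i = L2_diff_integrable[OF assms(1,2)] L2_diff_integrable[OF assms(3,2)]
  have "(\<integral>x. (f x - h x) * (f x - h x) \<partial>m)
    \<le> (\<integral>x. 2 * ((f x - g x) * (f x - g x)) + 2 * ((h x - g x) * (h x - g x)) \<partial>m)"
  proof (rule integral_mono[OF L2_diff_integrable[OF assms(1,3)]])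
    show "integrable m (\<lambda>x. 2 * ((f x - g x) * (f x - g x)) + 2 * ((h x - g x) * (h x - g x)))" using i by simp
    fix x
    have "0 \<le> ((f x - g x) + (h x - g x))\<^sup>2" by simp
    then show "(f x - h x) * (f x - h x) \<le> 2 * ((f x - g x) * (f x - g x)) + 2 * ((h x - g x) * (h x - g x))"
      by (simp add: power2_eq_square algebra_simps)
  qed
  also have "\<dots> = 2 * (\<integral>x. (f x - g x) * (f x - g x) \<partial>m) + 2 * (\<integral>x. (h x - g x) * (h x - g x) \<partial>m)"
    using i by (simp add: Bochner_Integration.integral_add)
  finally show ?thesis .
qed

lemma bform_symmetric_form: "symmetric_form m E F \<Longrightarrow> bform F E"
  unfolding symmetric_form_def bform_def by blast

lemma bform_subset: "bform F E \<Longrightarrow> A \<subseteq> F \<Longrightarrow>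
    (\<And>u v. u \<in> A \<Longrightarrow> v \<in> A \<Longrightarrow> (\<lambda>x. u x + v x) \<in> A) \<Longrightarrow>
    (\<And>u c. u \<in> A \<Longrightarrow> (\<lambda>x. c * u x) \<in> A) \<Longrightarrow> bform A E"
  unfolding bform_def by (meson subsetD)

lemma symmetric_form_AE:
  assumes "symmetric_form m E F" "u \<in> F" "v \<in> borel_measurable m" "AE x in m. u x = v x"
  shows "v \<in> F" "w \<in> F \<Longrightarrow> E v w = E u w"
  using assms unfolding symmetric_form_def by blast+

lemma symmetric_form_L2: "symmetric_form m E F \<Longrightarrow> u \<in> F \<Longrightarrow> u \<in> L2 m"
  unfolding symmetric_form_def by blast

lemma dist_1_sq:
  assumes "symmetric_form m E F" "u \<in> F" "v \<in> F"
  shows "(dist_1 m E u v)\<^sup>2 = E (\<lambda>x. u x - v x) (\<lambda>x. u x - v x) + (\<integral>x. (u x - v x) * (u x - v x) \<partial>m)"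
    "0 \<le> E (\<lambda>x. u x - v x) (\<lambda>x. u x - v x)" "0 \<le> dist_1 m E u v"
proof -
  interpret bform F E using bform_symmetric_form assms(1) .
  show "0 \<le> E (\<lambda>x. u x - v x) (\<lambda>x. u x - v x)" using assms by (intro B_nonneg V_diff)
  moreover have "0 \<le> (\<integral>x. (u x - v x) * (u x - v x) \<partial>m)" by simp
  ultimately show "(dist_1 m E u v)\<^sup>2 = E (\<lambda>x. u x - v x) (\<lambda>x. u x - v x) + (\<integral>x. (u x - v x) * (u x - v x) \<partial>m)"
    "0 \<le> dist_1 m E u v"
    unfolding dist_1_def form_1_def by (simp_all only: real_sqrt_pow2 add_nonneg_nonneg real_sqrt_ge_zero)
qed

lemma dist_1_tendsto:
  assumes "symmetric_form m E F" "\<And>n. w n \<in> F" "u \<in> F" "(\<lambda>n. dist_1 m E (w n) u) \<longlonglongrightarrow> 0"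
  shows "(\<lambda>n. E (\<lambda>x. w n x - u x) (\<lambda>x. w n x - u x)) \<longlonglongrightarrow> 0"
    "(\<lambda>n. \<integral>x. (w n x - u x) * (w n x - u x) \<partial>m) \<longlonglongrightarrow> 0"
proof -
  note sq = dist_1_sq[OF assms(1,2,3)]
  have "(\<lambda>n. (dist_1 m E (w n) u)\<^sup>2) \<longlonglongrightarrow> 0\<^sup>2" by (intro tendsto_power assms(4))
  then have lim: "(\<lambda>n. (dist_1 m E (w n) u)\<^sup>2) \<longlonglongrightarrow> 0" by simp
  have i: "0 \<le> (\<integral>x. (w n x - u x) * (w n x - u x) \<partial>m)" for n by simp
  show "(\<lambda>n. E (\<lambda>x. w n x - u x) (\<lambda>x. w n x - u x)) \<longlonglongrightarrow> 0"
    by (rule tendsto_sandwich[OF _ _ tendsto_const lim]; intro always_eventually allI) (use sq(1,2) i in \<open>auto simp: add_increasing2\<close>)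
  show "(\<lambda>n. \<integral>x. (w n x - u x) * (w n x - u x) \<partial>m) \<longlonglongrightarrow> 0"
    by (rule tendsto_sandwich[OF _ _ tendsto_const lim]; intro always_eventually allI) (use sq(1,2) i in \<open>auto simp: add_increasing\<close>)
qed

text \<open>Closedness produces some limit \<open>U\<close>, which need not be the prescribed
  function \<open>g\<close>. Both are \<open>L2\<close> limits of \<open>w\<close>, so they agree
  almost everywhere, and saturation of the domain moves membership and energies from
  \<open>U\<close> to \<open>g\<close>.\<close>

lemma closed_limit:
  assumes sym: "symmetric_form m E F" and cl: "closed_form m E F" and w: "\<And>n::nat. w n \<in> F" and g: "g \<in> L2 m"
    and cau: "\<And>e. e > 0 \<Longrightarrow> \<exists>N. \<forall>i\<ge>N. \<forall>j\<ge>N. E (\<lambda>x. w i x - w j x) (\<lambda>x. w i x - w j x) < e"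
    and lim: "(\<lambda>n. \<integral>x. (w n x - g x) * (w n x - g x) \<partial>m) \<longlonglongrightarrow> 0"
  shows "g \<in> F" "(\<lambda>n. E (\<lambda>x. w n x - g x) (\<lambda>x. w n x - g x)) \<longlonglongrightarrow> 0"
proof -
  interpret bform F E using bform_symmetric_form sym .
  note wL = symmetric_form_L2[OF sym w]
  have "\<exists>N. \<forall>i\<ge>N. \<forall>j\<ge>N. dist_1 m E (w i) (w j) < e" if e: "e > 0" for e
  proof -
    obtain N1 where N1: "\<And>i j. i \<ge> N1 \<Longrightarrow> j \<ge> N1 \<Longrightarrow> E (\<lambda>x. w i x - w j x) (\<lambda>x. w i x - w j x) < e\<^sup>2 / 2"
      using cau[of "e\<^sup>2 / 2"] e by auto
    have "\<forall>\<^sub>F n in sequentially. (\<integral>x. (w n x - g x) * (w n x - g x) \<partial>m) < e\<^sup>2 / 8"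
      using order_tendstoD(2)[OF lim, of "e\<^sup>2 / 8"] e by simp
    then obtain N2 where N2: "\<And>n. n \<ge> N2 \<Longrightarrow> (\<integral>x. (w n x - g x) * (w n x - g x) \<partial>m) < e\<^sup>2 / 8"
      unfolding eventually_sequentially by blast
    have "dist_1 m E (w i) (w j) < e" if "i \<ge> max N1 N2" "j \<ge> max N1 N2" for i j
    proof -
      \<comment> \<open>The budget: \<open>e\<^sup>2 / 2\<close> for the energy, and twice
        \<open>2 * (e\<^sup>2 / 8)\<close> for the squared \<open>L2\<close> distances to
        \<open>g\<close>.\<close>
      have "(dist_1 m E (w i) (w j))\<^sup>2 < e\<^sup>2 / 2 + (2 * (e\<^sup>2 / 8) + 2 * (e\<^sup>2 / 8))"
        unfolding dist_1_sq(1)[OF sym w w]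
        using N1[of i j] N2[of i] N2[of j] that L2_triangle[OF wL[of i] g wL[of j]] by simp
      then have "(dist_1 m E (w i) (w j))\<^sup>2 < e\<^sup>2" by simp
      then show ?thesis by (rule power2_less_imp_less) (use e in linarith)
    qed
    then show ?thesis by (intro exI[of _ "max N1 N2"] allI impI)
  qed
  then have "(\<forall>n. w n \<in> F) \<and> (\<forall>e>0. \<exists>N. \<forall>i\<ge>N. \<forall>j\<ge>N. dist_1 m E (w i) (w j) < e)"
    using w by simp
  from cl[unfolded closed_form_def, rule_format, OF this]
  obtain U where U: "U \<in> F" "(\<lambda>n. dist_1 m E (w n) U) \<longlonglongrightarrow> 0" by (elim bexE)
  note limU = dist_1_tendsto[OF sym w U]
  have UL: "U \<in> L2 m" using symmetric_form_L2[OF sym U(1)] .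
  have "(\<integral>x. (g x - U x) * (g x - U x) \<partial>m) \<le> 0"
  proof (rule LIMSEQ_le_const)
    have sw: "(\<integral>x. (p x - q x) * (p x - q x) \<partial>m) = (\<integral>x. (q x - p x) * (q x - p x) \<partial>m)" for p q :: "'a \<Rightarrow> real"
      by (rule Bochner_Integration.integral_cong) (simp_all add: algebra_simps)
    have "(\<lambda>n. 2 * (\<integral>x. (w n x - g x) * (w n x - g x) \<partial>m) + 2 * (\<integral>x. (w n x - U x) * (w n x - U x) \<partial>m)) \<longlonglongrightarrow> 2 * 0 + 2 * 0"
      by (intro tendsto_intros lim limU)
    then show "(\<lambda>n. 2 * (\<integral>x. (w n x - g x) * (w n x - g x) \<partial>m) + 2 * (\<integral>x. (w n x - U x) * (w n x - U x) \<partial>m)) \<longlonglongrightarrow> 0"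
      by simp
    show "\<exists>N. \<forall>n\<ge>N. (\<integral>x. (g x - U x) * (g x - U x) \<partial>m) \<le>
        2 * (\<integral>x. (w n x - g x) * (w n x - g x) \<partial>m) + 2 * (\<integral>x. (w n x - U x) * (w n x - U x) \<partial>m)"
      using L2_triangle[OF g wL UL] unfolding sw[of g "w _"] sw[of U "w _"] by blast
  qed
  moreover have "0 \<le> (\<integral>x. (g x - U x) * (g x - U x) \<partial>m)" by simp
  ultimately have "(\<integral>x. (g x - U x) * (g x - U x) \<partial>m) = 0" by linarith
  then have ae: "AE x in m. U x = g x"
    by (subst (asm) integral_nonneg_eq_0_iff_AE[OF L2_diff_integrable[OF g UL]]) auto
  have gm: "g \<in> borel_measurable m" using g by (simp add: L2_def)
  show gF: "g \<in> F" using symmetric_form_AE(1)[OF sym U(1) gm ae] .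
  have "E (\<lambda>x. w n x - g x) (\<lambda>x. w n x - g x) = E (\<lambda>x. w n x - U x) (\<lambda>x. w n x - U x)" for n
  proof -
    have m: "(\<lambda>x. w n x - g x) \<in> borel_measurable m" using gm wL[of n] by (auto simp: L2_def)
    have "AE x in m. w n x - U x = w n x - g x" using ae by eventually_elim simp
    note * = symmetric_form_AE[OF sym V_diff[OF w U(1)] m this]
    show ?thesis using *(2)[of "\<lambda>x. w n x - g x"] *(2)[of "\<lambda>x. w n x - U x"]
        B_sym[of "\<lambda>x. w n x - U x" "\<lambda>x. w n x - g x"] *(1) V_diff[OF w U(1)] by simp
  qed
  then show "(\<lambda>n. E (\<lambda>x. w n x - g x) (\<lambda>x. w n x - g x)) \<longlonglongrightarrow> 0" using limU(1) by simp
qed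

lemma Cc_L2:
  assumes "radon_measure_on UNIV m" "f \<in> Cc"
  shows "(f :: 'a::t2_space \<Rightarrow> real) \<in> L2 m"
  using Cc_measurable[OF radon_sets[OF assms(1)] assms(2)] Cc_integrable[OF assms(1) Cc_power2[OF assms(2)]]
  by (simp add: L2_def)

locale regular_form =
  fixes m :: "'a::{metric_space, second_countable_topology} measure" and E F
  assumes lc: "locally compact (UNIV :: 'a set)"
    and radon: "radon_measure_on UNIV m"
    and regular: "regular_dirichlet_form m E F"
begin

lemma sym: "symmetric_form m E F" and cl: "closed_form m E F" and mk: "markovian E F"
  using regular by (auto simp: regular_dirichlet_form_def dirichlet_form_def)

sublocale FE: bform F E
  using bform_symmetric_form[OF sym] .

sublocale core "F \<inter> Cc"
proof
  show "(\<lambda>x. 0) \<in> F \<inter> Cc" using sym by (auto simp: symmetric_form_def Cc_def)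
  fix u :: "'a \<Rightarrow> real" assume u: "u \<in> F \<inter> Cc"
  have "(\<lambda>x. min (max (u x) 0) 1) \<in> Cc"
    by (rule Cc_comp[of u]) (use u Cc_D in \<open>auto intro!: continuous_intros\<close>)
  then show "(\<lambda>x. min (max (u x) 0) 1) \<in> F \<inter> Cc" using u mk by (auto simp: markovian_def Let_def)
qed (use lc FE.V_add FE.V_cmult Cc_add Cc_cmult regular in \<open>auto simp: regular_dirichlet_form_def\<close>)

lemma core_form_on: "bform F B \<Longrightarrow> markovian B F \<Longrightarrow> core_form (F \<inter> Cc) B m"
proof -
  assume B: "bform F B" and mB: "markovian B F"
  interpret bform "F \<inter> Cc" B using bform_subset[OF B _ add cmult] by blast
  show ?thesis by unfold_locales (use radon mB in \<open>auto simp: markovian_def Let_def\<close>)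
qed

sublocale FC: core_form "F \<inter> Cc" E m
  using core_form_on[OF FE.bform_axioms mk] .

text \<open>The penalised problems with target \<open>u\<^sup>2\<close> have values bounded
  uniformly in the penalty by \<open>square_approx_energy\<close>. Their near-minimisers are thus
  Cauchy in energy and converge to \<open>u\<^sup>2\<close> in \<open>L2\<close>, and closedness of
  \<open>E\<close> places \<open>u\<^sup>2\<close> in the domain.\<close>

lemma square_nonneg_mem:
  assumes u: "u \<in> F \<inter> Cc" "\<And>x. 0 \<le> u x"
  shows "(\<lambda>x. (u x)\<^sup>2) \<in> F \<inter> Cc"
proof -
  let ?g = "\<lambda>x. (u x)\<^sup>2"
  have g: "?g \<in> Cc" using Cc_power2 u by blast
  obtain C where C: "\<And>n::nat. \<exists>w\<in>F \<inter> Cc. E w w + real n * (\<integral>x. (w x - (u x)\<^sup>2) * (w x - (u x)\<^sup>2) \<partial>m) \<le> C"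
    using FC.square_approx_energy[OF u] by blast
  have eta: "0 < 1 / real (Suc n)" for n by simp
  have etalim: "(\<lambda>n. 1 / real (Suc n)) \<longlonglongrightarrow> 0" by (rule lim_inverse_n'[THEN LIMSEQ_Suc])
  obtain w where w: "\<And>n. w n \<in> F \<inter> Cc"
    "\<And>n. E (w n) (w n) + real n * (\<integral>x. (w n x - ?g x) * (w n x - ?g x) \<partial>m) \<le> C + 1 / real (Suc n)"
    "\<And>e. e > 0 \<Longrightarrow> \<exists>N. \<forall>i\<ge>N. \<forall>j\<ge>N. E (\<lambda>x. w i x - w j x) (\<lambda>x. w i x - w j x) < e"
    by (rule FC.near_minimizers[OF g C eta etalim]) blast
  have b: "real n * (\<integral>x. (w n x - ?g x) * (w n x - ?g x) \<partial>m) \<le> C + 1" for n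
  proof -
    have "1 / real (Suc n) \<le> 1" by simp
    then show ?thesis using w(2)[of n] FC.G.B_nonneg[OF w(1)[of n]] by linarith
  qed
  have "(\<lambda>n. \<integral>x. (w n x - ?g x) * (w n x - ?g x) \<partial>m) \<longlonglongrightarrow> 0"
  proof (rule tendsto_sandwich[of "\<lambda>_. 0" _ _ "\<lambda>n. (C + 1) / real n"])
    show "\<forall>\<^sub>F n in sequentially. (\<integral>x. (w n x - ?g x) * (w n x - ?g x) \<partial>m) \<le> (C + 1) / real n"
      using eventually_gt_at_top[of 0]
    proof eventually_elim
      case (elim n)
      then show ?case using b[of n] by (simp add: field_simps)
    qed
    show "(\<lambda>n. (C + 1) / real n) \<longlonglongrightarrow> 0" by (rule lim_const_over_n)
  qed auto
  then have "?g \<in> F"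
    using closed_limit(1)[OF sym cl _ Cc_L2[OF radon g] w(3)] w(1) by blast
  with g show ?thesis by blast
qed

lemma square_mem: "u \<in> F \<inter> Cc \<Longrightarrow> (\<lambda>x. (u x)\<^sup>2) \<in> F \<inter> Cc"
  using square_nonneg_mem[OF abs, of u] by simp

lemma mult_mem:
  assumes "u \<in> F \<inter> Cc" "v \<in> F \<inter> Cc"
  shows "(\<lambda>x. u x * v x) \<in> F \<inter> Cc"
proof -
  have "(\<lambda>x. 1 / 2 * ((u x + v x)\<^sup>2 - (u x)\<^sup>2 - (v x)\<^sup>2)) \<in> F \<inter> Cc"
    using assms by (intro cmult diff square_mem add)
  moreover have "1 / 2 * ((u x + v x)\<^sup>2 - (u x)\<^sup>2 - (v x)\<^sup>2) = u x * v x" for x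
    by (simp add: power2_eq_square algebra_simps)
  ultimately show ?thesis by simp
qed

end

lemma form_1_zero: "symmetric_form m E F \<Longrightarrow> (\<lambda>x. 0) \<in> F \<and> form_1 m E (\<lambda>x. 0) (\<lambda>x. 0) = 0"
  unfolding form_1_def using bform.B_zero[OF bform_symmetric_form] by (auto simp: symmetric_form_def)

text \<open>The exceptional open set can be empty, whose capacity is 0 because the zero function is
  an admissible competitor.\<close>

lemma qc_version_self:
  assumes sym: "symmetric_form m E F" and u: "continuous_on UNIV u"
  shows "qc_version m E F u u"
proof -
  have "cap_open m E F {} \<le> ennreal (form_1 m E (\<lambda>x. 0) (\<lambda>x. 0))"
    unfolding cap_open_def using form_1_zero[OF sym] by (intro INF_lower) auto
  then have "cap_open m E F {} = 0" using form_1_zero[OF sym] by simp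
  moreover have "cap m E F {} \<le> cap_open m E F {}" unfolding cap_def by (intro INF_lower) auto
  ultimately have "cap m E F {} = 0" by simp
  then have "quasi_continuous m E F u"
    unfolding quasi_continuous_def using u by (auto intro!: exI[of _ "{}"])
  then show ?thesis using u by (simp add: qc_version_def borel_measurable_continuous_onI)
qed

lemma ess_support_subset: "ess_support m f \<subseteq> closure {x. f x \<noteq> 0}"
proof -
  have "x \<in> ess_support m f \<Longrightarrow> x \<in> closure {x. f x \<noteq> 0}" for x
  proof (rule ccontr)
    assume x: "x \<in> ess_support m f" "x \<notin> closure {x. f x \<noteq> 0}"
    have "AE y in m. y \<in> - closure {x. f x \<noteq> 0} \<longrightarrow> f y = 0"
      using Cc_supp[of f] by (intro AE_I2) blast
    then have "- closure {x. f x \<noteq> 0} \<in> {U. open U \<and> (AE x in m. x \<in> U \<longrightarrow> f x = 0)}"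
      by (simp add: open_Compl)
    then show False using x unfolding ess_support_def by blast
  qed
  then show ?thesis by blast
qed

lemma compact_ess_support:
  assumes "f \<in> Cc"
  shows "compact (ess_support m f)"
proof -
  have "closed (ess_support m f)" unfolding ess_support_def by (intro closed_Compl open_Union) auto
  then have "compact (closure {x. f x \<noteq> 0} \<inter> ess_support m f)" using Cc_D[OF assms] by (intro compact_Int_closed)
  then show ?thesis using ess_support_subset[of m f] by (simp add: Int_absorb1)
qed

locale bd_form = regular_form m E F
  for m :: "'a::{metric_space, second_countable_topology} measure" and E F +
  fixes Ec :: "'a form" and J :: "('a \<times> 'a) measure" and k :: "'a measure"
  assumes bd: "beurling_deny m E F Ec J k"
begin

lemma bdD: "symmetric_form m Ec F" "strongly_local m Ec F" "markovian Ec F"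
     "radon_measure_on (- Id) J" "\<And>A. A \<in> sets J \<Longrightarrow> emeasure J (prod.swap -` A) = emeasure J A"
     "radon_measure_on UNIV k"
  using bd unfolding beurling_deny_def by blast+

lemma decomp:
  assumes "u \<in> F \<inter> Cc" "v \<in> F \<inter> Cc"
  shows "E u v = Ec u v + (\<integral>(x, y). (u x - u y) * (v x - v y) \<partial>J) + (\<integral>x. u x * v x \<partial>k)"
proof -
  have "qc_version m E F u u" "qc_version m E F v v"
    using assms cont by (auto intro!: qc_version_self[OF sym])
  then show ?thesis using bd assms unfolding beurling_deny_def by blast
qed

sublocale EcF: bform F Ec
  using bform_symmetric_form[OF bdD(1)] .

sublocale EcC: core_form "F \<inter> Cc" Ec m
  using core_form_on[OF EcF.bform_axioms bdD(3)] .

text \<open>The jumping and killing parts are nonnegative on the diagonal. This is the upper half of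
  the norm comparison between \<open>Ec + e * E\<close> and \<open>E\<close>.\<close>

lemma Ec_le:
  assumes "u \<in> F \<inter> Cc"
  shows "Ec u u \<le> E u u"
proof -
  have "0 \<le> (\<integral>(x, y). (u x - u y) * (u x - u y) \<partial>J)" by (intro integral_nonneg_AE AE_I2) auto
  moreover have "0 \<le> (\<integral>x. u x * u x \<partial>k)" by simp
  ultimately show ?thesis unfolding decomp[OF assms assms] by linarith
qed

lemma Ec_local:
  assumes "u \<in> F \<inter> Cc" "v \<in> F \<inter> Cc" "open W" "closure {x. u x \<noteq> 0} \<subseteq> W" "\<And>x. x \<in> W \<Longrightarrow> v x = c"
  shows "Ec u v = 0"
proof -
  have "\<exists>U c. open U \<and> ess_support m u \<subseteq> U \<and> (AE x in m. x \<in> U \<longrightarrow> v x = c)"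
    using assms ess_support_subset[of m u] by (intro exI[of _ W] exI[of _ c] conjI AE_I2) auto
  then show ?thesis using bdD(2) assms compact_ess_support[of u m] compact_ess_support[of v m]
    unfolding strongly_local_def by blast
qed

text \<open>Neither \<open>Ec\<close> nor its restriction to \<open>F \<inter> Cc\<close> need be closable by itself; adding a small
  multiple of \<open>E\<close> makes the energy norm equivalent to that of \<open>E\<close>.\<close>

lemma perturbed:
  assumes e: "e > 0"
  shows "closable_form (F \<inter> Cc) (\<lambda>u v. Ec u v + e * E u v) m"
proof -
  let ?G = "\<lambda>u v. Ec u v + e * E u v"
  have B: "bform F ?G"
    using e by unfold_locales (auto simp: EcF.V_add EcF.V_cmult EcF.B_add EcF.B_cmult FE.B_add FE.B_cmult
        EcF.B_nonneg FE.B_nonneg EcF.B_sym FE.B_sym algebra_simps)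
  have M: "markovian ?G F"
    unfolding markovian_def Let_def
  proof
    fix u assume u: "u \<in> F"
    let ?v = "\<lambda>x. min (max (u x) 0) 1"
    have "?v \<in> F" "E ?v ?v \<le> E u u" "Ec ?v ?v \<le> Ec u u"
      using u mk bdD(3) by (auto simp: markovian_def Let_def)
    then show "?v \<in> F \<and> ?G ?v ?v \<le> ?G u u" using e by (auto intro!: add_mono mult_left_mono)
  qed
  interpret core_form "F \<inter> Cc" ?G m using core_form_on[OF B M] .
  show ?thesis
  proof
    fix u v assume "u \<in> F \<inter> Cc" "v \<in> F \<inter> Cc"
    then show "(\<lambda>x. u x * v x) \<in> F \<inter> Cc" by (rule mult_mem)
  next
    fix w :: "nat \<Rightarrow> 'a \<Rightarrow> real" and g
    assume w: "\<And>n. w n \<in> F \<inter> Cc" and g: "g \<in> F \<inter> Cc"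
      and cau: "\<And>d. d > 0 \<Longrightarrow> \<exists>N. \<forall>i\<ge>N. \<forall>j\<ge>N. ?G (\<lambda>x. w i x - w j x) (\<lambda>x. w i x - w j x) < d"
      and lim: "(\<lambda>n. \<integral>x. (w n x - g x) * (w n x - g x) \<partial>m) \<longlonglongrightarrow> 0"
    \<comment> \<open>\<open>e * E\<close> is dominated by the perturbed form, so Cauchy sequences
      for the latter are Cauchy for \<open>E\<close>; after closedness of \<open>E\<close> is used,
      convergence returns through the bound \<open>(1 + e) * E\<close>.\<close>
    have "\<exists>N. \<forall>i\<ge>N. \<forall>j\<ge>N. E (\<lambda>x. w i x - w j x) (\<lambda>x. w i x - w j x) < d" if d: "d > 0" for d
    proof -
      obtain N where N: "\<forall>i\<ge>N. \<forall>j\<ge>N. ?G (\<lambda>x. w i x - w j x) (\<lambda>x. w i x - w j x) < e * d"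
        using cau[of "e * d"] e d by auto
      have "E (\<lambda>x. w i x - w j x) (\<lambda>x. w i x - w j x) < d" if "i \<ge> N" "j \<ge> N" for i j
      proof -
        have "e * E (\<lambda>x. w i x - w j x) (\<lambda>x. w i x - w j x) < e * d"
          using N that EcC.G.B_nonneg[OF diff[OF w w], of i j] by fastforce
        then show ?thesis using e by simp
      qed
      then show ?thesis by (intro exI[of _ N] allI impI)
    qed
    from closed_limit(2)[OF sym cl _ _ this lim]
    have "(\<lambda>n. E (\<lambda>x. w n x - g x) (\<lambda>x. w n x - g x)) \<longlonglongrightarrow> 0"
      using w g Cc_L2[OF radon] by blast
    then have "(\<lambda>n. (1 + e) * E (\<lambda>x. w n x - g x) (\<lambda>x. w n x - g x)) \<longlonglongrightarrow> (1 + e) * 0"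
      by (intro tendsto_mult tendsto_const)
    then have lim': "(\<lambda>n. (1 + e) * E (\<lambda>x. w n x - g x) (\<lambda>x. w n x - g x)) \<longlonglongrightarrow> 0" by simp
    show "(\<lambda>n. ?G (\<lambda>x. w n x - g x) (\<lambda>x. w n x - g x)) \<longlonglongrightarrow> 0"
    proof (rule tendsto_sandwich[OF _ _ tendsto_const lim']; intro always_eventually allI)
      fix n
      show "0 \<le> ?G (\<lambda>x. w n x - g x) (\<lambda>x. w n x - g x)" using G.B_nonneg[OF diff[OF w g]] .
      show "?G (\<lambda>x. w n x - g x) (\<lambda>x. w n x - g x) \<le> (1 + e) * E (\<lambda>x. w n x - g x) (\<lambda>x. w n x - g x)"
        using Ec_le[OF diff[OF w g], of n] by (simp add: distrib_right)
    qed
  qed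
qed

text \<open>The inequality for \<open>Ec + t * E\<close> reads \<open>0 \<le> ?b + t * ?q\<close>
  for every \<open>t > 0\<close>, so its constant term \<open>?b\<close> is nonnegative.\<close>

lemma Ec_energy_nonneg:
  assumes u: "u \<in> F \<inter> Cc" and f: "f \<in> F \<inter> Cc" "\<And>x. f x \<ge> 0"
  shows "0 \<le> 2 * Ec (\<lambda>x. u x * f x) u - Ec (\<lambda>x. (u x)\<^sup>2) f"
proof -
  let ?b = "2 * Ec (\<lambda>x. u x * f x) u - Ec (\<lambda>x. (u x)\<^sup>2) f"
    and ?q = "2 * E (\<lambda>x. u x * f x) u - E (\<lambda>x. (u x)\<^sup>2) f"
  have "0 \<le> 2 * t * (?b / 2) + t\<^sup>2 * ?q" if t: "t > 0" for t
  proof -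
    interpret P: closable_form "F \<inter> Cc" "\<lambda>u v. Ec u v + t * E u v" m by (rule perturbed[OF t])
    have "0 \<le> ?b + t * ?q" using P.energy_nonneg[OF u f] by (simp add: algebra_simps)
    then have "0 \<le> t * (?b + t * ?q)" using t by simp
    also have "t * (b + t * q) = 2 * t * (b / 2) + t\<^sup>2 * q" for b q :: real
      by (simp add: power2_eq_square algebra_simps)
    finally show ?thesis .
  qed
  then have "0 \<le> ?b / 2" by (rule linear_coeff_nonneg)
  then show ?thesis by simp
qed

text \<open>The predicate under the definite description in \<open>energy_measure_c\<close>,
  isolated so that existence and uniqueness can be treated separately.\<close>

definition energy_rep :: "('a \<Rightarrow> real) \<Rightarrow> 'a measure \<Rightarrow> bool" where
  "energy_rep u \<mu> \<longleftrightarrow> sets \<mu> = sets borel \<and> finite_measure \<mu> \<and>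
     (\<forall>f\<in>F \<inter> Cc. (\<integral>x. f x \<partial>\<mu>) = 2 * Ec (\<lambda>x. u x * f x) u - Ec (\<lambda>x. (u x)\<^sup>2) f)"

lemma finite_radon: "sets \<mu> = sets borel \<Longrightarrow> finite_measure \<mu> \<Longrightarrow> radon_measure_on UNIV \<mu>"
  by (simp add: radon_measure_on_def sets_restrict_space finite_measure.emeasure_finite less_top[symmetric])

lemma energy_rep_unique:
  assumes "energy_rep u \<mu>" "energy_rep u \<nu>"
  shows "\<mu> = \<nu>"
  using assms unfolding energy_rep_def
  by (intro measure_eqI_integral Cc_integrable finite_radon) auto

text \<open>The Radon measure representing the functional is null off the support of
  \<open>u\<close>: for \<open>f\<close> supported there \<open>u * f = 0\<close>, and strong
  locality removes \<open>Ec (u^2) f\<close>. So it is finite. Testing it with a cutoff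
  \<open>h\<close> equal to 1 near the support gives the total mass, since \<open>u * h = u\<close>
  and, again by strong locality, \<open>Ec (u^2) h = 0\<close>.\<close>

lemma energy_rep_exists:
  assumes u: "u \<in> F \<inter> Cc"
  obtains \<mu> where "energy_rep u \<mu>" "measure \<mu> UNIV = 2 * Ec u u"
proof -
  define L where "L f = 2 * Ec (\<lambda>x. u x * f x) u - Ec (\<lambda>x. (u x)\<^sup>2) f" for f
  have u2: "(\<lambda>x. (u x)\<^sup>2) \<in> F \<inter> Cc" by (rule square_mem[OF u])
  interpret positive_functional "F \<inter> Cc" L
  proof
    fix f g assume f: "f \<in> F \<inter> Cc" and g: "g \<in> F \<inter> Cc"
    show "L (\<lambda>x. f x + g x) = L f + L g"
      using EcC.G.B_add[OF mult_mem[OF u f] mult_mem[OF u g] u] EcC.G.B_add_right[OF f g u2]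
      by (simp add: L_def distrib_left)
  next
    fix f c assume f: "f \<in> F \<inter> Cc"
    have "Ec (\<lambda>x. u x * (c * f x)) u = c * Ec (\<lambda>x. u x * f x) u"
      using EcC.G.B_cmult[OF mult_mem[OF u f] u, of c] by (simp add: mult.left_commute)
    then show "L (\<lambda>x. c * f x) = c * L f"
      using EcC.G.B_cmult_right[OF f u2, of c] by (simp add: L_def algebra_simps)
  next
    fix f :: "'a \<Rightarrow> real" assume "f \<in> F \<inter> Cc" "\<And>x. 0 \<le> f x"
    then show "0 \<le> L f" unfolding L_def by (rule Ec_energy_nonneg[OF u])
  qed
  obtain \<mu> where mu: "radon_measure_on UNIV \<mu>" "\<And>f. f \<in> F \<inter> Cc \<Longrightarrow> (\<integral>x. f x \<partial>\<mu>) = L f"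
    using representing_measure by blast
  note sets_mu = radon_sets[OF mu(1)]
  have sp: "space \<mu> = UNIV" using sets_eq_imp_space_eq[OF sets_mu] by simp
  let ?K = "closure {x. u x \<noteq> 0}"
  have K: "compact ?K" using Cc_D u by blast
  have suppu2: "closure {x. (u x)\<^sup>2 \<noteq> 0} = ?K" by simp
  obtain h W where h: "h \<in> F \<inter> Cc" "\<And>x. 0 \<le> h x" "\<And>x. h x \<le> 1" "open W" "?K \<subseteq> W" "\<And>x. x \<in> W \<Longrightarrow> h x = 1"
    using bump[OF K open_UNIV] by auto
  have null: "emeasure \<mu> (- ?K) = 0"
  proof -
    have "open (- ?K)" by auto
    then obtain f :: "nat \<Rightarrow> 'a \<Rightarrow> real" where f: "\<And>n. f n \<in> F \<inter> Cc" "\<And>n x. f n x \<ge> 0"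
      "\<And>n. closure {x. f n x \<noteq> 0} \<subseteq> - ?K" "- ?K = (\<Union>n. {x. f n x > 0})"
      using open_cover[of "- ?K"] by metis
    have B: "{x. f n x > 0} \<in> sets \<mu>" for n using open_pos[OF f(1)] sets_mu by simp
    have "emeasure \<mu> {x. f n x > 0} = 0" for n
    proof -
      have "u x * f n x = 0" for x
      proof (rule ccontr)
        assume "u x * f n x \<noteq> 0"
        then have "x \<in> ?K" "x \<in> closure {x. f n x \<noteq> 0}" using Cc_supp[of u x] Cc_supp[of "f n" x] by auto
        then show False using f(3)[of n] by blast
      qed
      then have "(\<lambda>x. u x * f n x) = (\<lambda>x. 0)" by auto
      moreover have "Ec (\<lambda>x. (u x)\<^sup>2) (f n) = 0"
      proof (rule Ec_local[OF u2 f(1)])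
        show "open (- closure {x. f n x \<noteq> 0})" by auto
        show "closure {x. (u x)\<^sup>2 \<noteq> 0} \<subseteq> - closure {x. f n x \<noteq> 0}" unfolding suppu2 using f(3)[of n] by blast
        show "f n x = 0" if "x \<in> - closure {x. f n x \<noteq> 0}" for x using that Cc_supp[of "f n" x] by blast
      qed
      ultimately have "(\<integral>x. f n x \<partial>\<mu>) = 0" using mu(2)[OF f(1)] EcC.G.B_zero[OF u] by (simp add: L_def)
      then have "AE x in \<mu>. f n x = 0"
        using f(1) by (subst (asm) integral_nonneg_eq_0_iff_AE[OF Cc_integrable[OF mu(1)]]) (auto simp: f(2))
      then have "AE x in \<mu>. \<not> (x \<in> {x. f n x > 0})" by eventually_elim simp
      then show ?thesis using B[of n] by (simp add: AE_iff_measurable[OF B[of n]] sp)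
    qed
    then show ?thesis unfolding f(4) using B by (intro emeasure_UN_eq_0) auto
  qed
  have "emeasure \<mu> UNIV \<le> emeasure \<mu> ?K + emeasure \<mu> (- ?K)"
    using emeasure_subadditive[of ?K \<mu> "- ?K"] sets_mu by simp
  also have "\<dots> < \<infinity>" using null radon_finite[OF mu(1) K] by simp
  finally have fin: "finite_measure \<mu>" by (intro finite_measureI) (simp add: sp)
  have ae: "AE x in \<mu>. h x = 1"
  proof -
    have "AE x in \<mu>. \<not> x \<in> - ?K"
      using null by (subst AE_iff_measurable[of "- ?K"]) (auto simp: sp sets_mu)
    then show ?thesis by (rule eventually_mono) (use h(5,6) in auto)
  qed
  have "measure \<mu> UNIV = (\<integral>x. 1 \<partial>\<mu>)" using sp by simp
  also have "\<dots> = (\<integral>x. h x \<partial>\<mu>)"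
    using Cc_measurable[OF sets_mu] h(1) ae by (intro integral_cong_AE) auto
  also have "\<dots> = L h" using mu(2) h(1) .
  also have "\<dots> = 2 * Ec u u"
  proof -
    have "u x * h x = u x" for x using h(5,6) Cc_supp[of u x] by (cases "u x = 0") auto
    then have uh: "(\<lambda>x. u x * h x) = u" by (rule ext)
    have "Ec (\<lambda>x. (u x)\<^sup>2) h = 0"
      by (rule Ec_local[OF u2 h(1) h(4), of 1]) (use h in auto)
    then show ?thesis unfolding L_def uh by simp
  qed
  finally have "measure \<mu> UNIV = 2 * Ec u u" .
  moreover have "energy_rep u \<mu>" unfolding energy_rep_def using sets_mu fin mu(2) by (simp add: L_def)
  ultimately show thesis using that by blast
qed

lemma energy_measure_c_eq: "energy_rep u \<mu> \<Longrightarrow> energy_measure_c Ec F u = \<mu>"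
  unfolding energy_measure_c_def energy_rep_def[symmetric]
  by (rule the_equality) (auto intro: energy_rep_unique)

lemma energy_measure_c:
  assumes "u \<in> F \<inter> Cc"
  shows "energy_rep u (energy_measure_c Ec F u)" "measure (energy_measure_c Ec F u) UNIV = 2 * Ec u u"
  using energy_rep_exists[OF assms] energy_measure_c_eq by metis+

text \<open>The total mass of the energy measure is quadratic:
  \<open>(2 * 4 - 2 - 2) / 2 = 2\<close>. This is how equality of the mutual energy measures gives
  back \<open>Ec\<close>.\<close>

lemma mutual_energy_diag:
  assumes u: "u \<in> F \<inter> Cc"
  shows "mutual_energy_c Ec F u u UNIV = 2 * Ec u u"
proof -
  have "Ec (\<lambda>x. u x + u x) (\<lambda>x. u x + u x) = 4 * Ec u u"
    using EcC.G.B_expand[OF u u, of 1] by simp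
  then show ?thesis
    unfolding mutual_energy_c_def energy_measure_c(2)[OF u] energy_measure_c(2)[OF add[OF u u]] by simp
qed

end

section \<open>The jumping measure\<close>

lemma radon_diag_sets: "radon_measure_on S J \<Longrightarrow> sets J = sets (restrict_space borel S)"
  by (simp add: radon_measure_on_def)

lemma open_offdiag: "open (- Id :: ('a::t2_space \<times> 'a) set)"
proof -
  have eq: "(Id :: ('a \<times> 'a) set) = {y. \<exists>x. y = (x, x)}" by auto
  have "closed (Id :: ('a \<times> 'a) set)" unfolding eq by (rule closed_diagonal)
  then show ?thesis by (rule open_Compl)
qed

lemma radon_compact:
  fixes K :: "'a::t2_space set"
  assumes "radon_measure_on S J" "compact K" "K \<subseteq> S"
  shows "K \<in> sets J" "emeasure J K < \<infinity>"
proof -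
  have "K = S \<inter> K" using assms by blast
  moreover have "K \<in> sets borel" using assms(2)[THEN compact_imp_closed, THEN borel_closed] .
  ultimately have "K \<in> (\<inter>) S ` sets borel" by blast
  then show "K \<in> sets J" unfolding radon_diag_sets[OF assms(1)] sets_restrict_space .
  show "emeasure J K < \<infinity>" using assms by (simp add: radon_measure_on_def)
qed

text \<open>The product of two disjoint compact supports is a compact set off the diagonal, where
  \<open>J\<close> is finite.\<close>

lemma tensor_integrable:
  fixes J :: "('a::{metric_space, second_countable_topology} \<times> 'a) measure"
  assumes J: "radon_measure_on (- Id) J" and f: "f \<in> Cc" and g: "g \<in> Cc"
    and disj: "closure {x. f x \<noteq> 0} \<inter> closure {x. g x \<noteq> 0} = {}"
  shows "integrable J (\<lambda>(x, y). f x * g y)"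
proof -
  let ?K = "closure {x. f x \<noteq> 0}" and ?L = "closure {x. g x \<noteq> 0}"
  obtain M where M: "M > 0" "\<And>x. \<bar>f x\<bar> \<le> M" using Cc_bounded[OF f] by blast
  obtain N where N: "N > 0" "\<And>x. \<bar>g x\<bar> \<le> N" using Cc_bounded[OF g] by blast
  have KL: "compact (?K \<times> ?L)" "?K \<times> ?L \<subseteq> - Id"
    using compact_Times[OF Cc_D(2)[OF f] Cc_D(2)[OF g]] disj by auto
  note KLs = radon_compact(1)[OF J KL] and fin = radon_compact(2)[OF J KL]
  have "continuous_on UNIV (\<lambda>p. f (fst p) * g (snd p))"
    by (intro continuous_on_mult continuous_on_compose2[OF Cc_D(1)[OF f]] continuous_on_compose2[OF Cc_D(1)[OF g]]
        continuous_on_fst continuous_on_snd continuous_on_id subset_UNIV)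
  then have "(\<lambda>p. f (fst p) * g (snd p)) \<in> borel_measurable (restrict_space borel (- Id))"
    by (intro measurable_restrict_space1 borel_measurable_continuous_onI)
  then have meas: "(\<lambda>(x, y). f x * g y) \<in> borel_measurable J"
    unfolding measurable_cong_sets[OF radon_diag_sets[OF J] refl] by (simp add: split_beta')
  have "integrable J (\<lambda>p. (M * N) * indicator (?K \<times> ?L) p)"
    using fin KLs by (intro integrable_mult_right integrable_real_indicator) auto
  then show ?thesis
  proof (rule Bochner_Integration.integrable_bound[OF _ meas], intro AE_I2)
    fix p
    show "norm (case p of (x, y) \<Rightarrow> f x * g y) \<le> norm (M * N * indicator (?K \<times> ?L) p)"
    proof (cases p)
      case (Pair x y)
      show ?thesis
      proof (cases "f x = 0 \<or> g y = 0")
        case True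
        then show ?thesis using Pair by auto
      next
        case False
        then have "p \<in> ?K \<times> ?L" using Pair Cc_supp[of f x] Cc_supp[of g y] by auto
        moreover have "\<bar>f x\<bar> * \<bar>g y\<bar> \<le> M * N" using M N by (intro mult_mono) auto
        ultimately show ?thesis using Pair M N by (simp add: abs_mult)
      qed
    qed
  qed
qed

text \<open>The products at equal arguments vanish by disjointness of the supports; the two mixed
  terms remain and have equal integrals by the symmetry of \<open>J\<close>.\<close>

lemma jump_integral_tensor:
  fixes J :: "('a::{metric_space, second_countable_topology} \<times> 'a) measure"
  assumes J: "radon_measure_on (- Id) J" and sym: "\<And>A. A \<in> sets J \<Longrightarrow> emeasure J (prod.swap -` A) = emeasure J A"
    and f: "f \<in> Cc" and g: "g \<in> Cc" and disj: "closure {x. f x \<noteq> 0} \<inter> closure {x. g x \<noteq> 0} = {}"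
  shows "(\<integral>(x, y). (f x - f y) * (g x - g y) \<partial>J) = - 2 * (\<integral>(x, y). f x * g y \<partial>J)"
proof -
  have sp: "space J = - Id"
    using sets_eq_imp_space_eq[OF radon_diag_sets[OF J]] by (simp add: space_restrict_space)
  have "continuous_on UNIV (prod.swap :: 'a \<times> 'a \<Rightarrow> 'a \<times> 'a)"
    by (intro continuous_on_swap)
  then have "prod.swap \<in> measurable (restrict_space borel (- Id)) (borel :: ('a \<times> 'a) measure)"
    by (intro measurable_restrict_space1 borel_measurable_continuous_onI)
  then have "prod.swap \<in> measurable (restrict_space borel (- Id)) (restrict_space borel (- Id :: ('a \<times> 'a) set))"
    by (rule measurable_restrict_space2[rotated]) (auto simp: space_restrict_space)
  then have sw: "prod.swap \<in> measurable J J"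
    unfolding measurable_cong_sets[OF radon_diag_sets[OF J] radon_diag_sets[OF J]] .
  have distr: "distr J J prod.swap = J"
  proof (rule measure_eqI)
    fix A assume "A \<in> sets (distr J J prod.swap)"
    then have A: "A \<in> sets J" by simp
    then have "A \<subseteq> - Id" using sets.sets_into_space sp by blast
    then have "prod.swap -` A \<inter> space J = prod.swap -` A" unfolding sp by auto
    then show "emeasure (distr J J prod.swap) A = emeasure J A"
      using emeasure_distr[OF sw A] sym[OF A] by simp
  qed simp
  have i1: "integrable J (\<lambda>(x, y). f x * g y)" by (rule tensor_integrable[OF J f g disj])
  have i2: "integrable J (\<lambda>(x, y). g x * f y)" by (rule tensor_integrable[OF J g f]) (use disj in blast)
  have "(\<integral>(x, y). g x * f y \<partial>J) = (\<integral>(x, y). g x * f y \<partial>(distr J J prod.swap))" by (simp only: distr)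
  also have "\<dots> = (\<integral>p. (case prod.swap p of (x, y) \<Rightarrow> g x * f y) \<partial>J)"
    using i2 by (intro integral_distr[OF sw]) auto
  also have "\<dots> = (\<integral>(x, y). f x * g y \<partial>J)"
    by (rule Bochner_Integration.integral_cong) (auto simp: mult.commute)
  finally have swap: "(\<integral>(x, y). g x * f y \<partial>J) = (\<integral>(x, y). f x * g y \<partial>J)" .
  have z: "f x * g x = 0" for x
  proof (rule ccontr)
    assume "f x * g x \<noteq> 0"
    then have "x \<in> closure {x. f x \<noteq> 0}" "x \<in> closure {x. g x \<noteq> 0}" using Cc_supp[of f x] Cc_supp[of g x] by auto
    then show False using disj by blast
  qed
  have "(\<integral>(x, y). (f x - f y) * (g x - g y) \<partial>J) =
      (\<integral>p. - (case p of (x, y) \<Rightarrow> f x * g y) - (case p of (x, y) \<Rightarrow> g x * f y) \<partial>J)"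
  proof (rule Bochner_Integration.integral_cong[OF refl])
    fix p :: "'a \<times> 'a"
    show "(case p of (x, y) \<Rightarrow> (f x - f y) * (g x - g y)) =
        - (case p of (x, y) \<Rightarrow> f x * g y) - (case p of (x, y) \<Rightarrow> g x * f y)"
      using z[of "fst p"] z[of "snd p"] by (cases p) (auto simp: algebra_simps)
  qed
  also have "\<dots> = - 2 * (\<integral>(x, y). f x * g y \<partial>J)"
    using i1 i2 by (simp add: swap)
  finally show ?thesis .
qed

section \<open>Off-diagonal rectangles determine the jumping measure\<close>

context core
begin

text \<open>Disjointness is demanded of the closed supports, not only of the sets, so that each
  rectangle lies in a compact set off the diagonal and has finite measure.\<close>

definition rects :: "('a \<times> 'a) set set" where
  "rects = {{x. f x > 0} \<times> {y. g y > 0} |f g. f \<in> A \<and> g \<in> A \<and> (\<forall>x. 0 \<le> f x) \<and> (\<forall>x. 0 \<le> g x) \<and>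
     closure {x. f x \<noteq> 0} \<inter> closure {x. g x \<noteq> 0} = {}}"

lemma rectsI:
  assumes "f \<in> A" "g \<in> A" "\<And>x. 0 \<le> f x" "\<And>x. 0 \<le> g x"
    "closure {x. f x \<noteq> 0} \<inter> closure {x. g x \<noteq> 0} = {}"
  shows "{x. f x > 0} \<times> {y. g y > 0} \<in> rects"
  unfolding rects_def using assms by (intro CollectI exI[of _ f] exI[of _ g]) simp

lemma rectsD:
  assumes "R \<in> rects"
  shows "\<exists>f g. R = {x. f x > 0} \<times> {y. g y > 0} \<and> f \<in> A \<and> g \<in> A \<and> (\<forall>x. 0 \<le> f x) \<and> (\<forall>x. 0 \<le> g x) \<and>
    closure {x. f x \<noteq> 0} \<inter> closure {x. g x \<noteq> 0} = {}"
  using assms unfolding rects_def mem_Collect_eq .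

lemma rects_offdiag: "R \<in> rects \<Longrightarrow> R \<subseteq> - Id"
proof
  fix p assume "R \<in> rects" "p \<in> R"
  obtain f g where fg: "R = {x. f x > 0} \<times> {y. g y > 0}" "f \<in> A" "g \<in> A"
      "closure {x. f x \<noteq> 0} \<inter> closure {x. g x \<noteq> 0} = {}"
    using rectsD[OF \<open>R \<in> rects\<close>] by (elim exE conjE) (rule that)
  have "f (fst p) > 0" "g (snd p) > 0" using fg(1) \<open>p \<in> R\<close> by auto
  then have "fst p \<noteq> snd p" using fg(4) Cc_supp[of f "fst p"] Cc_supp[of g "snd p"] by auto
  then show "p \<in> - Id" by auto
qed

lemma open_rects: "R \<in> rects \<Longrightarrow> open R"
  by (drule rectsD, elim exE conjE) (simp add: open_Times open_pos)

lemma Int_stable_rects: "Int_stable rects"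
proof (rule Int_stableI)
  fix R S assume RS: "R \<in> rects" "S \<in> rects"
  obtain f g where R0: "R = {x. f x > 0} \<times> {y. g y > 0}" "f \<in> A" "g \<in> A" "\<forall>x. 0 \<le> f x" "\<forall>x. 0 \<le> g x"
      "closure {x. f x \<noteq> 0} \<inter> closure {x. g x \<noteq> 0} = {}"
    using rectsD[OF RS(1)] by (elim exE conjE) (rule that)
  note R = R0(1-3) R0(4,5)[rule_format] R0(6)
  obtain f' g' where S0: "S = {x. f' x > 0} \<times> {y. g' y > 0}" "f' \<in> A" "g' \<in> A" "\<forall>x. 0 \<le> f' x" "\<forall>x. 0 \<le> g' x"
      "closure {x. f' x \<noteq> 0} \<inter> closure {x. g' x \<noteq> 0} = {}"
    using rectsD[OF RS(2)] by (elim exE conjE) (rule that)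
  note S = S0(1-3) S0(4,5)[rule_format] S0(6)
  let ?f = "\<lambda>x. min (f x) (f' x)" and ?g = "\<lambda>x. min (g x) (g' x)"
  have "{x. ?f x \<noteq> 0} \<subseteq> {x. f x \<noteq> 0}" "{x. ?g x \<noteq> 0} \<subseteq> {x. g x \<noteq> 0}"
    using R(4,5) S(4,5) by (auto simp: min_def antisym)
  note this[THEN closure_mono]
  then have "closure {x. ?f x \<noteq> 0} \<inter> closure {x. ?g x \<noteq> 0} = {}" using R(6) by blast
  then have "{x. ?f x > 0} \<times> {y. ?g y > 0} \<in> rects"
    using R(4,5) S(4,5) by (intro rectsI min R S) auto
  moreover have "R \<inter> S = {x. ?f x > 0} \<times> {y. ?g y > 0}" unfolding R(1) S(1) by auto
  ultimately show "R \<inter> S \<in> rects" by simp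
qed

text \<open>Two distinct coordinates have disjoint neighbourhoods, and core functions supported in
  them give a rectangle inside \<open>W\<close>; Lindelof's theorem reduces to countably
  many.\<close>

lemma rects_cover:
  assumes W: "open W" "W \<subseteq> - Id"
  obtains C where "C \<subseteq> rects" "countable C" "\<Union>C = W"
proof -
  let ?F = "{R \<in> rects. R \<subseteq> W}"
  have "\<And>S. S \<in> ?F \<Longrightarrow> open S" using open_rects by blast
  then obtain C where C: "C \<subseteq> ?F" "countable C" "\<Union>C = \<Union>?F" by (rule Lindelof)
  have "p \<in> \<Union>?F" if p: "p \<in> W" for p
  proof -
    obtain x y where xy: "p = (x, y)" by (cases p)
    then have ne: "x \<noteq> y" using W p by auto
    obtain U V where UV: "open U" "open V" "x \<in> U" "y \<in> V" "U \<inter> V = {}" using hausdorff[OF ne] by blast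
    obtain U' V' where UV': "open U'" "open V'" "p \<in> U' \<times> V'" "U' \<times> V' \<subseteq> W"
      using open_prod_elim[OF W(1) p] by blast
    obtain f where f: "f \<in> A" "\<And>y. 0 \<le> f y" "f x > 0" "closure {x. f x \<noteq> 0} \<subseteq> U \<inter> U'"
      using bump_point[of "U \<inter> U'" x] UV UV' xy by auto
    obtain g where g: "g \<in> A" "\<And>y. 0 \<le> g y" "g y > 0" "closure {x. g x \<noteq> 0} \<subseteq> V \<inter> V'"
      using bump_point[of "V \<inter> V'" y] UV UV' xy by auto
    let ?R = "{x. f x > 0} \<times> {y. g y > 0}"
    have "closure {x. f x \<noteq> 0} \<inter> closure {x. g x \<noteq> 0} = {}" using f(4) g(4) UV by blast
    then have "?R \<in> rects" using f g by (intro rectsI)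
    moreover have "?R \<subseteq> W"
    proof
      fix q assume "q \<in> ?R"
      then have "fst q \<in> U'" "snd q \<in> V'" using f(4) g(4) Cc_supp[of f "fst q"] Cc_supp[of g "snd q"] by auto
      then show "q \<in> W" using UV'(4) by (cases q) auto
    qed
    moreover have "p \<in> ?R" using xy f g by auto
    ultimately show ?thesis by blast
  qed
  then have "\<Union>?F = W" by blast
  with C show thesis using that[of C] by auto
qed

lemma sigma_rects: "sigma_sets (- Id) rects = sets (restrict_space borel (- Id :: ('a \<times> 'a) set))"
proof -
  have "sets (restrict_space borel (- Id :: ('a \<times> 'a) set)) = (\<inter>) (- Id) ` sigma_sets UNIV {S. open S}"
    by (simp add: sets_restrict_space borel_def)
  also have "\<dots> = sigma_sets (- Id) ((\<inter>) (- Id) ` {S. open S})"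
    by (rule sigma_sets_Int) (auto intro: sigma_sets.Basic open_offdiag)
  also have "\<dots> = sigma_sets (- Id) rects"
  proof (rule sigma_sets_eqI)
    fix W :: "('a \<times> 'a) set" assume "W \<in> (\<inter>) (- Id) ` {S. open S}"
    then have "open W" "W \<subseteq> - Id" using open_offdiag by auto
    then obtain C where C: "C \<subseteq> rects" "countable C" "\<Union>C = W" using rects_cover by metis
    have "\<Union>C \<in> sigma_sets (- Id) rects"
      using C by (intro sigma_sets_UNION) (auto intro: sigma_sets.Basic)
    then show "W \<in> sigma_sets (- Id) rects" using C by simp
  next
    fix R assume "R \<in> rects"
    then have "R = - Id \<inter> R" "open R" using rects_offdiag open_rects by blast+
    then show "R \<in> sigma_sets (- Id) ((\<inter>) (- Id) ` {S. open S})" by (intro sigma_sets.Basic) blast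
  qed
  finally show ?thesis by simp
qed

lemma emeasure_rect_SUP:
  assumes J: "radon_measure_on (- Id) J" and f: "f \<in> A" "\<And>x. 0 \<le> f x" and g: "g \<in> A" "\<And>x. 0 \<le> g x"
    and disj: "closure {x. f x \<noteq> 0} \<inter> closure {x. g x \<noteq> 0} = {}"
  shows "emeasure J ({x. f x > 0} \<times> {y. g y > 0}) =
    (SUP n. ennreal (\<integral>(x, y). min (max (real n * f x) 0) 1 * min (max (real n * g y) 0) 1 \<partial>J))"
proof -
  let ?f = "\<lambda>n x. min (max (real n * f x) 0) 1" and ?g = "\<lambda>n x. min (max (real n * g x) 0) 1"
  let ?R = "{x. f x > 0} \<times> {y. g y > 0}"
  have R: "?R \<in> rects" using f g disj by (intro rectsI)
  have int: "integrable J (\<lambda>(x, y). ?f n x * ?g n y)" for n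
  proof (rule tensor_integrable[OF J CcD[OF unit_n[OF f(1)]] CcD[OF unit_n[OF g(1)]]])
    have "closure {x. ?f n x \<noteq> 0} \<subseteq> closure {x. f x \<noteq> 0}" "closure {x. ?g n x \<noteq> 0} \<subseteq> closure {x. g x \<noteq> 0}"
      by (intro closure_mono; auto)+
    then show "closure {x. ?f n x \<noteq> 0} \<inter> closure {x. ?g n x \<noteq> 0} = {}" using disj by blast
  qed
  have "emeasure J ?R = (SUP n. \<integral>\<^sup>+p. ennreal (case p of (x, y) \<Rightarrow> ?f n x * ?g n y) \<partial>J)"
  proof (rule emeasure_SUP_indicator)
    show "?R \<in> sets J" unfolding radon_diag_sets[OF J] sigma_rects[symmetric] using R by (rule sigma_sets.Basic)
    show "(\<lambda>(x, y). ?f n x * ?g n y) \<in> borel_measurable J" for n using int by (rule borel_measurable_integrable)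
    show "(case p of (x, y) \<Rightarrow> ?f n x * ?g n y) \<le> (case p of (x, y) \<Rightarrow> ?f (Suc n) x * ?g (Suc n) y)" for n p
      using unit_seq_mono[OF f(2), of n] unit_seq_mono[OF g(2), of n]
      by (cases p) (simp only: prod.case, intro mult_mono, auto)
    show "(\<lambda>n. case p of (x, y) \<Rightarrow> ?f n x * ?g n y) \<longlonglongrightarrow> indicat_real ?R p" for p
    proof (cases p)
      case (Pair x y)
      have "(\<lambda>n. ?f n x * ?g n y) \<longlonglongrightarrow> (if f x > 0 then 1 else 0) * (if g y > 0 then 1 else 0)"
        by (intro tendsto_mult unit_seq_lim f g)
      also have "(if f x > 0 then 1 else 0) * (if g y > 0 then 1 else 0) = indicat_real ?R p"
        unfolding Pair by (simp add: indicator_def)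
      finally show ?thesis unfolding Pair by (simp only: prod.case)
    qed
  qed
  also have "\<dots> = (SUP n. ennreal (\<integral>(x, y). ?f n x * ?g n y \<partial>J))"
  proof (intro SUP_cong refl)
    fix n
    show "(\<integral>\<^sup>+p. ennreal (case p of (x, y) \<Rightarrow> ?f n x * ?g n y) \<partial>J) = ennreal (\<integral>(x, y). ?f n x * ?g n y \<partial>J)"
      by (rule nn_integral_eq_integral[OF int]) (simp add: split_beta')
  qed
  finally show ?thesis .
qed

text \<open>The rectangles form a pi-system of sets of finite measure that generates the Borel sets
  off the diagonal. On each of them the measure is the supremum of integrals of tensor products of
  truncated core functions.\<close>

lemma jump_measure_eqI:
  assumes J: "radon_measure_on (- Id) J" and J': "radon_measure_on (- Id) J'"
    and eq: "\<And>f g. f \<in> A \<Longrightarrow> g \<in> A \<Longrightarrow> closure {x. f x \<noteq> 0} \<inter> closure {x. g x \<noteq> 0} = {} \<Longrightarrow>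
      (\<integral>(x, y). f x * g y \<partial>J) = (\<integral>(x, y). f x * g y \<partial>J')"
  shows "J = J'"
proof -
  obtain C where C: "C \<subseteq> rects" "countable C" "\<Union>C = - Id"
    by (rule rects_cover[OF open_offdiag subset_refl])
  show ?thesis
  proof (rule measure_eqI_generator_eq_countable[OF Int_stable_rects _ _ _ _ C(1,3,2)])
    show "rects \<subseteq> Pow (- Id)" using rects_offdiag by blast
    show "sets J = sigma_sets (- Id) rects" "sets J' = sigma_sets (- Id) rects"
      unfolding sigma_rects using radon_diag_sets J J' by blast+
    fix R assume "R \<in> rects"
    from rectsD[OF this] obtain f g where R0: "R = {x. f x > 0} \<times> {y. g y > 0}" "f \<in> A" "g \<in> A"
      "\<forall>x. 0 \<le> f x" "\<forall>x. 0 \<le> g x" "closure {x. f x \<noteq> 0} \<inter> closure {x. g x \<noteq> 0} = {}"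
      by (elim exE conjE) (rule that)
    note R = R0(1-3) R0(4,5)[rule_format] R0(6)
    let ?f = "\<lambda>n x. min (max (real n * f x) 0) 1" and ?g = "\<lambda>n x. min (max (real n * g x) 0) 1"
    have "closure {x. ?f n x \<noteq> 0} \<subseteq> closure {x. f x \<noteq> 0}" "closure {x. ?g n x \<noteq> 0} \<subseteq> closure {x. g x \<noteq> 0}" for n
      by (intro closure_mono; auto)+
    then have "closure {x. ?f n x \<noteq> 0} \<inter> closure {x. ?g n x \<noteq> 0} = {}" for n using R(6) by blast
    then have "(\<integral>(x, y). ?f n x * ?g n y \<partial>J) = (\<integral>(x, y). ?f n x * ?g n y \<partial>J')" for n
      using eq[OF unit_n[OF R(2)] unit_n[OF R(3)]] by blast
    then show "emeasure J R = emeasure J' R"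
      unfolding R(1) emeasure_rect_SUP[OF J R(2,4,3,5,6)] emeasure_rect_SUP[OF J' R(2,4,3,5,6)] by simp
  next
    fix R assume "R \<in> C"
    then have "R \<in> rects" using C by blast
    from rectsD[OF this] obtain f g where R: "R = {x. f x > 0} \<times> {y. g y > 0}" "f \<in> A" "g \<in> A"
      "closure {x. f x \<noteq> 0} \<inter> closure {x. g x \<noteq> 0} = {}"
      by (elim exE conjE) (rule that)
    let ?K = "closure {x. f x \<noteq> 0} \<times> closure {x. g x \<noteq> 0}"
    have K: "compact ?K" "?K \<subseteq> - Id"
      using compact_Times[OF Cc_D(2)[OF CcD[OF R(2)]] Cc_D(2)[OF CcD[OF R(3)]]] R(4) by auto
    note Ks = radon_compact(1)[OF J K]
    have "R \<subseteq> ?K" unfolding R using Cc_supp[of f] Cc_supp[of g] by force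
    then have "emeasure J R \<le> emeasure J ?K" using Ks by (rule emeasure_mono)
    also have "\<dots> < \<infinity>" by (rule radon_compact(2)[OF J K])
    finally show "emeasure J R \<noteq> \<infinity>" by simp
  qed
qed

end

lemma disjoint_supports:
  assumes "closure {x. u x \<noteq> (0::real)} \<inter> closure {x. v x \<noteq> (0::real)} = {}"
  shows "u x * v x = 0"
  using assms Cc_supp[of u x] Cc_supp[of v x] by fastforce

context bd_form
begin

lemma energy_disjoint:
  assumes u: "u \<in> F \<inter> Cc" and v: "v \<in> F \<inter> Cc"
    and disj: "closure {x. u x \<noteq> 0} \<inter> closure {x. v x \<noteq> 0} = {}"
  shows "E u v = - 2 * (\<integral>(x, y). u x * v y \<partial>J)"
proof -
  have "Ec u v = 0"
  proof (rule Ec_local[OF u v])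
    show "open (- closure {x. v x \<noteq> 0})" by auto
    show "closure {x. u x \<noteq> 0} \<subseteq> - closure {x. v x \<noteq> 0}" using disj by blast
    show "v x = 0" if "x \<in> - closure {x. v x \<noteq> 0}" for x using that Cc_supp[of v x] by blast
  qed
  moreover have "(\<integral>x. u x * v x \<partial>k) = 0" by (simp only: disjoint_supports[OF disj] Bochner_Integration.integral_zero)
  ultimately show ?thesis
    using decomp[OF u v] jump_integral_tensor[OF bdD(4,5) _ _ disj] u v by simp
qed

end

section \<open>Regular subspaces\<close>

theorem theorem2p1:
  fixes m :: "'a::{metric_space, second_countable_topology} measure"
    and E E' Ec Ec' :: "'a form"
    and F F' :: "('a \<Rightarrow> real) set"
    and J J' :: "('a \<times> 'a) measure"
    and k k' :: "'a measure"
  assumes "locally compact (UNIV :: 'a set)"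
    and "radon_measure_on UNIV m" and "full_support m"
    and "regular_dirichlet_form m E F" and "regular_dirichlet_form m E' F'"
    and "beurling_deny m E F Ec J k" and "beurling_deny m E' F' Ec' J' k'"
  shows "regular_subspace E' F' E F \<longleftrightarrow>
    F' \<inter> Cc \<subseteq> F \<inter> Cc \<and> J = J' \<and> k = k' \<and>
    (\<forall>u\<in>F' \<inter> Cc. \<forall>v\<in>F' \<inter> Cc. \<forall>A\<in>sets borel.
       mutual_energy_c Ec F u v A = mutual_energy_c Ec' F' u v A)"
proof -
  interpret X: bd_form m E F Ec J k by unfold_locales (fact assms)+
  interpret Y: bd_form m E' F' Ec' J' k' by unfold_locales (fact assms)+
  show ?thesis
  proof
    assume "regular_subspace E' F' E F"
    then have sub: "F' \<subseteq> F" and eq: "\<And>u v. u \<in> F' \<Longrightarrow> v \<in> F' \<Longrightarrow> E u v = E' u v"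
      by (auto simp: regular_subspace_def)
    \<comment> \<open>Test functions come from the smaller core \<open>F' \<inter> Cc\<close>
      throughout: they lie in both domains, and regularity of \<open>E'\<close> makes this core rich
      enough to determine measures.\<close>
    have JJ: "J = J'"
    proof (rule Y.jump_measure_eqI[OF X.bdD(4) Y.bdD(4)])
      fix f g assume f: "f \<in> F' \<inter> Cc" and g: "g \<in> F' \<inter> Cc"
        and disj: "closure {x. f x \<noteq> 0} \<inter> closure {x. g x \<noteq> 0} = {}"
      then have "f \<in> F \<inter> Cc" "g \<in> F \<inter> Cc" using sub by auto
      from X.energy_disjoint[OF this disj] Y.energy_disjoint[OF f g disj]
      show "(\<integral>(x, y). f x * g y \<partial>J) = (\<integral>(x, y). f x * g y \<partial>J')" using eq f g by simp
    qed
    have sum_eq: "Ec u v + (\<integral>x. u x * v x \<partial>k) = Ec' u v + (\<integral>x. u x * v x \<partial>k')"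
      if u: "u \<in> F' \<inter> Cc" and v: "v \<in> F' \<inter> Cc" for u v
    proof -
      have "u \<in> F \<inter> Cc" "v \<in> F \<inter> Cc" using sub u v by auto
      from X.decomp[OF this] Y.decomp[OF u v] show ?thesis using eq u v JJ by simp
    qed
    have kk: "k = k'"
    proof (rule Y.measure_eqI_integral)
      show "sets k = sets borel" "sets k' = sets borel" using radon_sets X.bdD(6) Y.bdD(6) by blast+
      show "integrable k f" "integrable k' f" if "f \<in> F' \<inter> Cc" for f
        using that Cc_integrable X.bdD(6) Y.bdD(6) by blast+
      fix u assume u: "u \<in> F' \<inter> Cc"
      obtain h W where h: "h \<in> F' \<inter> Cc" "\<And>x. 0 \<le> h x" "\<And>x. h x \<le> 1" "open W" "closure {x. u x \<noteq> 0} \<subseteq> W"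
        "\<And>x. x \<in> W \<Longrightarrow> h x = 1"
        using Y.bump[of "closure {x. u x \<noteq> 0}" UNIV] Cc_D(2)[of u] u by auto
      \<comment> \<open>Since \<open>h\<close> is 1 near the support of \<open>u\<close>, strong
        locality removes both local parts, and \<open>u * h = u\<close> leaves the integrals of
        \<open>u\<close> itself.\<close>
      have "Ec u h = 0" using sub u h by (intro X.Ec_local[OF _ _ h(4,5)]) auto
      moreover have "Ec' u h = 0" by (rule Y.Ec_local[OF u h(1,4,5,6)])
      moreover have "u x * h x = u x" for x using h(5,6) Cc_supp[of u x] by (cases "u x = 0") auto
      then have "(\<lambda>x. u x * h x) = u" by (rule ext)
      ultimately show "(\<integral>x. u x \<partial>k) = (\<integral>x. u x \<partial>k')" using sum_eq[OF u h(1)] by simp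
    qed
    have Ec_eq: "Ec u v = Ec' u v" if "u \<in> F' \<inter> Cc" "v \<in> F' \<inter> Cc" for u v
      using sum_eq[OF that] kk by simp
    have energy_eq: "energy_measure_c Ec F u = energy_measure_c Ec' F' u" if u: "u \<in> F' \<inter> Cc" for u
    proof -
      \<comment> \<open>The measure represents the functional of \<open>Ec\<close> on all of
        \<open>F \<inter> Cc\<close>, hence on the smaller core, where the two functionals agree;
        uniqueness there identifies it with the energy measure of \<open>Ec'\<close>.\<close>
      have "X.energy_rep u (energy_measure_c Ec F u)" using X.energy_measure_c(1) u sub by blast
      then have "Y.energy_rep u (energy_measure_c Ec F u)"
        unfolding X.energy_rep_def Y.energy_rep_def
        using sub Ec_eq[OF Y.mult_mem[OF u] u] Ec_eq[OF Y.square_mem[OF u]] by auto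
      then show ?thesis using Y.energy_measure_c_eq by simp
    qed
    show "F' \<inter> Cc \<subseteq> F \<inter> Cc \<and> J = J' \<and> k = k' \<and>
      (\<forall>u\<in>F' \<inter> Cc. \<forall>v\<in>F' \<inter> Cc. \<forall>A\<in>sets borel.
         mutual_energy_c Ec F u v A = mutual_energy_c Ec' F' u v A)"
      using sub JJ kk energy_eq Y.add by (auto simp: mutual_energy_c_def)
  next
    assume R: "F' \<inter> Cc \<subseteq> F \<inter> Cc \<and> J = J' \<and> k = k' \<and>
      (\<forall>u\<in>F' \<inter> Cc. \<forall>v\<in>F' \<inter> Cc. \<forall>A\<in>sets borel.
         mutual_energy_c Ec F u v A = mutual_energy_c Ec' F' u v A)"
    then have sub: "F' \<inter> Cc \<subseteq> F \<inter> Cc" and JJ: "J = J'" and kk: "k = k'" by auto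
    \<comment> \<open>Only the total masses, the case \<open>A = UNIV\<close>, enter here.\<close>
    have diag: "E u u = E' u u" if u: "u \<in> F' \<inter> Cc" for u
    proof -
      have uF: "u \<in> F \<inter> Cc" using sub u by blast
      have "mutual_energy_c Ec F u u UNIV = mutual_energy_c Ec' F' u u UNIV" using R u by auto
      then have "Ec u u = Ec' u u"
        unfolding X.mutual_energy_diag[OF uF] Y.mutual_energy_diag[OF u] by simp
      then show ?thesis unfolding X.decomp[OF uF uF] Y.decomp[OF u u] JJ kk by simp
    qed
    \<comment> \<open>Differences of approximants from \<open>F' \<inter> Cc\<close> have equal
      energy under both forms. A sequence converging for \<open>E'\<close> is therefore Cauchy for
      \<open>E\<close>, and \<open>closed_limit\<close> identifies its limit for \<open>E\<close>
      with the same \<open>u\<close>.\<close>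
    have ext: "u \<in> F \<and> E u u = E' u u" if u: "u \<in> F'" for u
    proof -
      have "\<exists>w\<in>F' \<inter> Cc. dist_1 m E' u w < 1 / real (Suc n)" for n
        using Y.regular u by (simp add: regular_dirichlet_form_def)
      then obtain w where w: "\<And>n. w n \<in> F' \<inter> Cc" "\<And>n. dist_1 m E' u (w n) < 1 / real (Suc n)" by metis
      have wF: "w n \<in> F \<inter> Cc" "w n \<in> F'" for n using w(1)[of n] sub by auto
      have "dist_1 m E' (w n) u = dist_1 m E' u (w n)" for n
      proof -
        have "(dist_1 m E' (w n) u)\<^sup>2 = (dist_1 m E' u (w n))\<^sup>2"
          unfolding dist_1_sq(1)[OF Y.sym wF(2) u] dist_1_sq(1)[OF Y.sym u wF(2)]
            Y.FE.B_diff_self[OF wF(2) u] Y.FE.B_diff_self[OF u wF(2)] Y.FE.B_sym[OF wF(2) u]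
          by (simp add: algebra_simps)
        then show ?thesis using dist_1_sq(3)[OF Y.sym wF(2) u] dist_1_sq(3)[OF Y.sym u wF(2)]
          by (simp add: power2_eq_iff_nonneg)
      qed
      then have "(\<lambda>n. dist_1 m E' (w n) u) \<longlonglongrightarrow> 0"
        using w(2) dist_1_sq(3)[OF Y.sym wF(2) u]
        by (intro tendsto_sandwich[OF _ _ tendsto_const lim_inverse_n'[THEN LIMSEQ_Suc]])
          (auto intro!: always_eventually less_imp_le)
      note lim' = dist_1_tendsto[OF Y.sym wF(2) u this]
      have cau: "\<exists>N. \<forall>i\<ge>N. \<forall>j\<ge>N. E (\<lambda>x. w i x - w j x) (\<lambda>x. w i x - w j x) < e" if e: "e > 0" for e
      proof -
        have "\<forall>\<^sub>F n in sequentially. E' (\<lambda>x. w n x - u x) (\<lambda>x. w n x - u x) < e / 4"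
          using order_tendstoD(2)[OF lim'(1), of "e / 4"] e by simp
        then obtain N where N: "\<And>n. n \<ge> N \<Longrightarrow> E' (\<lambda>x. w n x - u x) (\<lambda>x. w n x - u x) < e / 4"
          unfolding eventually_sequentially by blast
        have "E (\<lambda>x. w i x - w j x) (\<lambda>x. w i x - w j x) < e" if "i \<ge> N" "j \<ge> N" for i j
        proof -
          have "E (\<lambda>x. w i x - w j x) (\<lambda>x. w i x - w j x) = E' (\<lambda>x. w i x - w j x) (\<lambda>x. w i x - w j x)"
            by (rule diag[OF Y.diff[OF w(1) w(1)]])
          also have "\<dots> = E' (\<lambda>x. (w i x - u x) - (w j x - u x)) (\<lambda>x. (w i x - u x) - (w j x - u x))" by simp
          also have "\<dots> \<le> 2 * E' (\<lambda>x. w i x - u x) (\<lambda>x. w i x - u x) + 2 * E' (\<lambda>x. w j x - u x) (\<lambda>x. w j x - u x)"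
            by (rule Y.FE.B_diff_le[OF Y.FE.V_diff[OF wF(2) u] Y.FE.V_diff[OF wF(2) u]])
          also have "\<dots> < e" using N[OF that(1)] N[OF that(2)] by linarith
          finally show ?thesis .
        qed
        then show ?thesis by (intro exI[of _ N] allI impI)
      qed
      have uL: "u \<in> L2 m" using symmetric_form_L2[OF Y.sym u] .
      have wF1: "w n \<in> F" for n using wF(1) by blast
      note lim = closed_limit[OF X.sym X.cl wF1 uL cau lim'(2)]
      \<comment> \<open>Stated for an arbitrary form because it is applied to \<open>E\<close> and
        to \<open>E'\<close> along the same sequence; comparing the two limits gives
        \<open>E u u = E' u u\<close>.\<close>
      have conv: "(\<lambda>n. B (w n) (w n)) \<longlonglongrightarrow> B u u"
        if B: "bform V B" "\<And>n. w n \<in> V" "u \<in> V" "(\<lambda>n. B (\<lambda>x. w n x - u x) (\<lambda>x. w n x - u x)) \<longlonglongrightarrow> 0" for V B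
      proof -
        interpret bform V B by fact
        have "(\<lambda>n. B (\<lambda>x. w n x - u x) (\<lambda>x. w n x - u x) * B u u) \<longlonglongrightarrow> 0 * B u u"
          by (intro tendsto_mult B tendsto_const)
        then have l: "(\<lambda>n. B (\<lambda>x. w n x - u x) (\<lambda>x. w n x - u x) * B u u) \<longlonglongrightarrow> 0" by simp
        have "(\<lambda>n. (B (\<lambda>x. w n x - u x) u)\<^sup>2) \<longlonglongrightarrow> 0"
          by (rule tendsto_sandwich[OF _ _ tendsto_const l]; intro always_eventually allI)
            (simp, rule Cauchy_Schwarz[OF V_diff[OF B(2,3)] B(3)])
        then have "(\<lambda>n. B (\<lambda>x. w n x - u x) u) \<longlonglongrightarrow> 0"
          using tendsto_real_sqrt[of "\<lambda>n. (B (\<lambda>x. w n x - u x) u)\<^sup>2" 0 sequentially] by (simp add: tendsto_rabs_zero_iff)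
        then have "(\<lambda>n. B (\<lambda>x. w n x - u x) (\<lambda>x. w n x - u x) + 2 * B (\<lambda>x. w n x - u x) u + B u u) \<longlonglongrightarrow> 0 + 2 * 0 + B u u"
          by (intro tendsto_intros B)
        moreover have "B (\<lambda>x. w n x - u x) (\<lambda>x. w n x - u x) + 2 * B (\<lambda>x. w n x - u x) u + B u u = B (w n) (w n)" for n
          using B_diff_self[OF B(2,3)] B_diff[OF B(2,3,3)] by simp
        ultimately show ?thesis by simp
      qed
      have "(\<lambda>n. E (w n) (w n)) \<longlonglongrightarrow> E u u" by (rule conv[OF X.FE.bform_axioms wF1 lim])
      moreover have "(\<lambda>n. E (w n) (w n)) \<longlonglongrightarrow> E' u u"
        using conv[OF Y.FE.bform_axioms wF(2) u lim'(1)] diag[OF w(1)] by simp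
      ultimately show ?thesis using LIMSEQ_unique lim(1) by blast
    qed
    \<comment> \<open>Polarisation: the diagonal identity is applied to \<open>u\<close>,
      \<open>v\<close> and \<open>u + v\<close>.\<close>
    have "E u v = E' u v" if u: "u \<in> F'" and v: "v \<in> F'" for u v
    proof -
      have F: "u \<in> F" "v \<in> F" using ext u v by auto
      have "E (\<lambda>x. u x + v x) (\<lambda>x. u x + v x) = E' (\<lambda>x. u x + v x) (\<lambda>x. u x + v x)"
        using ext[OF Y.FE.V_add[OF u v]] by blast
      then show ?thesis
        using X.FE.B_expand[OF F, of 1] Y.FE.B_expand[OF u v, of 1] ext[OF u] ext[OF v] by simp
    qed
    then show "regular_subspace E' F' E F" using ext by (auto simp: regular_subspace_def)
  qed
qed

end
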